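(* Let $d\ge 6$ be an even integer and let $P=\{\xi\in\mathbb F_q^d:\xi_d=\xi_1^2+\cdots+\xi_{d-1}^2\}$ be the paraboloid. Then for each $\varepsilon>0$ we have $$R_P^*\left(2\to \frac{6d+8}{3d-2}+\varepsilon\right)\lesssim 1.$$
   Context: $\mathbb F_q$ is the finite field with $q$ elements, where $q$ is a power of an odd prime, and $\chi$ is a nontrivial additive character of $\mathbb F_q$. For $f:P\to\mathbb C$ define $$(fd\sigma)^\vee(m)=\frac1{|P|}\sum_{\xi\in P}f(\xi)\chi(m\cdot\xi),\qquad m\in\mathbb F_q^d,$$ where $m\cdot\xi=\sum_i m_i\xi_i$ (so $d\sigma$ is the normalized surface measure on $P$ giving mass $1/|P|$ to each point). Norms: $\|f\|_{L^p(P,d\sigma)}=\big(\frac1{|P|}\sum_{\xi\in P}|f(\xi)|^p\big)^{1/p}$, and $\|F\|_{L^r(\mathbb F_q^d,dm)}=\big(\sum_{m\in\mathbb F_q^d}|F(m)|^r\big)^{1/r}$ (counting measure), with the usual convention for exponent $\infty$. For $1\le p,r\le\infty$, $R_P^*(p\to r)$ is the smallest positive real number such that $\|(fd\sigma)^\vee\|_{L^r(\mathbb F_q^d,dm)}\le R_P^*(p\to r)\,\|f\|_{L^p(P,d\sigma)}$ for all $f:P\to\mathbb C$. The notation $X\lesssim Y$ means $X\le CY$ with a constant $C>0$ independent of $q$ (here $C$ may depend on $d$ and $\varepsilon$). *)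

theory Defs
  imports Complex_Main "HOL-Algebra.Ring" "HOL-Computational_Algebra.Primes"
    "HOL-Library.FuncSet" "HOL-Library.Extended_Real"
begin

text \<open>
  Finite fields are rings in the sense of HOL-Algebra with a finite carrier, not types of a class,
  so that a constant can be quantified before the field.  When the carrier type is infinite
  (e.g. nat), a quantifier over all such fields ranges over all finite fields up to isomorphism.
\<close>

definition odd_finite_field :: "('a, 'm) ring_scheme \<Rightarrow> bool" where
  "odd_finite_field F \<longleftrightarrow> field F \<and> finite (carrier F) \<and>
     (\<exists>p n. prime (p::nat) \<and> odd p \<and> n > 0 \<and> card (carrier F) = p ^ n)"

definition nontrivial_additive_character ::
    "('a, 'm) ring_scheme \<Rightarrow> ('a \<Rightarrow> complex) \<Rightarrow> bool" where
  "nontrivial_additive_character F \<chi> \<longleftrightarrow>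
     (\<forall>x\<in>carrier F. norm (\<chi> x) = 1) \<and>
     (\<forall>x\<in>carrier F. \<forall>y\<in>carrier F. \<chi> (x \<oplus>\<^bsub>F\<^esub> y) = \<chi> x * \<chi> y) \<and>
     (\<exists>x\<in>carrier F. \<chi> x \<noteq> 1)"

text \<open>Vectors have coordinates 1, ..., d; extensionality makes the space finite.\<close>

definition vec_space :: "('a, 'm) ring_scheme \<Rightarrow> nat \<Rightarrow> (nat \<Rightarrow> 'a) set" where
  "vec_space F d = ({1..d} \<rightarrow>\<^sub>E carrier F)"

definition dot :: "('a, 'm) ring_scheme \<Rightarrow> nat \<Rightarrow> (nat \<Rightarrow> 'a) \<Rightarrow> (nat \<Rightarrow> 'a) \<Rightarrow> 'a" where
  "dot F d m \<xi> = (\<Oplus>\<^bsub>F\<^esub>i\<in>{1..d}. m i \<otimes>\<^bsub>F\<^esub> \<xi> i)"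

definition paraboloid :: "('a, 'm) ring_scheme \<Rightarrow> nat \<Rightarrow> (nat \<Rightarrow> 'a) set" where
  "paraboloid F d =
     {\<xi> \<in> vec_space F d. \<xi> d = (\<Oplus>\<^bsub>F\<^esub>i\<in>{1..d-1}. \<xi> i [^]\<^bsub>F\<^esub> (2::nat))}"

definition extension_op :: "('a, 'm) ring_scheme \<Rightarrow> ('a \<Rightarrow> complex) \<Rightarrow> nat \<Rightarrow>
    (nat \<Rightarrow> 'a) set \<Rightarrow> ((nat \<Rightarrow> 'a) \<Rightarrow> complex) \<Rightarrow> (nat \<Rightarrow> 'a) \<Rightarrow> complex" where
  "extension_op F \<chi> d P f m =
     1 / of_nat (card P) * (\<Sum>\<xi>\<in>P. f \<xi> * \<chi> (dot F d m \<xi>))"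

definition Lp_norm_counting :: "'b set \<Rightarrow> ereal \<Rightarrow> ('b \<Rightarrow> complex) \<Rightarrow> real" where
  "Lp_norm_counting A r g =
     (if r = \<infinity> then (MAX x\<in>A. norm (g x))
      else (\<Sum>x\<in>A. norm (g x) powr real_of_ereal r) powr (1 / real_of_ereal r))"

definition Lp_norm_normalized :: "'b set \<Rightarrow> ereal \<Rightarrow> ('b \<Rightarrow> complex) \<Rightarrow> real" where
  "Lp_norm_normalized A p g =
     (if p = \<infinity> then (MAX x\<in>A. norm (g x))
      else (1 / real (card A) * (\<Sum>x\<in>A. norm (g x) powr real_of_ereal p))
             powr (1 / real_of_ereal p))"

text \<open>
  The exponents satisfy \<open>1 \<le> p, r \<le> \<infinity>\<close>.  A function on \<open>P\<close> is represented by a function on the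
  whole type; only its values on \<open>P\<close> enter.
\<close>

definition R_star :: "('a, 'm) ring_scheme \<Rightarrow> ('a \<Rightarrow> complex) \<Rightarrow> nat \<Rightarrow>
    (nat \<Rightarrow> 'a) set \<Rightarrow> ereal \<Rightarrow> ereal \<Rightarrow> real" where
  "R_star F \<chi> d P p r = (LEAST R. R > 0 \<and>
     (\<forall>f. Lp_norm_counting (vec_space F d) r (extension_op F \<chi> d P f)
            \<le> R * Lp_norm_normalized P p f))"

end

theory Submission
  imports "HOL-Algebra.Multiplicative_Group"
    "HOL-Analysis.Convex" Defs
begin

text \<open>
  Let \<open>d = n + 1\<close> with \<open>n = 2 k + 1\<close> and parametrize \<open>P\<close> by \<open>x \<mapsto> (x, x \<cdot> x)\<close>, \<open>x \<in> F\<^sup>n\<close>.  By duality the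
  extension estimate follows, up to the loss of \<open>\<epsilon>\<close> in the passage from weak to strong type, from
  \<open>W \<le> 5 N powr (2 / r')\<close> where \<open>W\<close> is the squared \<open>L\<^sup>2(P, d\<sigma>)\<close> norm of the Fourier transform of a function
  bounded by 1 on a set \<open>G\<close> of \<open>N\<close> points.  Plancherel handles large \<open>N\<close>, and the Fourier decay of
  the paraboloid handles small \<open>N\<close>.  In between, expand \<open>W\<close> into pairs of horizontal slices of \<open>G\<close>.
  Completing the square turns the interaction of a slice \<open>E\<close> with all the others into values of the
  extension operator applied to \<open>E\<close>, so that Hoelder's inequality reduces the estimate to the
  additive energy of \<open>E\<close> lifted to \<open>P\<close>.

  The energy is at most the number of triples in \<open>E\<close> with \<open>(x - z) \<cdot> (y - z) = 0\<close>.  For fixed \<open>x\<close>,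
  Cauchy-Schwarz in \<open>y\<close> leaves only the pairs of points \<open>z, z'\<close> on a common line through \<open>x\<close>, and the sum over
  scalars cancels unless \<open>z = z'\<close> or the line is isotropic.  Since \<open>n\<close> is odd, the Gauss sums give
  square root cancellation in the number of isotropic pairs of \<open>E\<close>.
\<close>

section \<open>Sums and inequalities over the reals and complex numbers\<close>

text \<open>The difficulty is isotropic directions. From a single \<open>x\<close> nothing prevents
  many points \<open>z\<close> with \<open>x - z\<close> isotropic, and on such lines the sum over
  scalars does not cancel; only the sum over all \<open>x\<close> is under control. There the parity
  of \<open>n\<close> decides: \<open>gauss t ^ n\<close> is a constant times one Gauss sum, and
  single Gauss sums against \<open>\<chi>\<close> add up to \<open>q\<close> times (number of square
  roots - 1). For this it suffices that the squares of the Gauss sums agree, which follows from sums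
  of two squares without the quadratic character. Slices are the right pieces because the kernel
  vanishes between distinct points of equal height, while relative to a fixed height the points at
  all others correspond injectively to frequencies of the extension operator. The energy bound has
  three terms, hence, with the diagonal, four terms in the middle range; the constant 5 is
  \<open>1 + 1 + 2 + 1\<close>. The exponent is \<open>r = 2 * (3 * k + 5) / (3 * k + 2)\<close>, so
  that \<open>2 / r' = (3 * k + 8) / (3 * k + 5)\<close>.\<close>

lemma sum_norm_square_expand:
  fixes \<phi> :: "'p \<Rightarrow> 'w \<Rightarrow> complex"
  shows "complex_of_real (\<Sum>w\<in>W. (norm (\<Sum>p\<in>Y. \<phi> p w))\<^sup>2)
    = (\<Sum>p\<in>Y. \<Sum>p'\<in>Y. \<Sum>w\<in>W. \<phi> p w * cnj (\<phi> p' w))"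
proof -
  have "complex_of_real (\<Sum>w\<in>W. (norm (\<Sum>p\<in>Y. \<phi> p w))\<^sup>2)
      = (\<Sum>w\<in>W. (\<Sum>p\<in>Y. \<phi> p w) * cnj (\<Sum>p\<in>Y. \<phi> p w))"
    unfolding of_real_sum by (simp only: complex_norm_square)
  also have "\<dots> = (\<Sum>w\<in>W. \<Sum>p\<in>Y. \<Sum>p'\<in>Y. \<phi> p w * cnj (\<phi> p' w))"
    by (simp add: sum_product)
  also have "\<dots> = (\<Sum>p\<in>Y. \<Sum>w\<in>W. \<Sum>p'\<in>Y. \<phi> p w * cnj (\<phi> p' w))" by (rule sum.swap)
  also have "\<dots> = (\<Sum>p\<in>Y. \<Sum>p'\<in>Y. \<Sum>w\<in>W. \<phi> p w * cnj (\<phi> p' w))"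
    by (intro sum.cong refl sum.swap)
  finally show ?thesis .
qed

text \<open>Coefficients bounded by 1 can be discarded once the square is expanded, because the
  correlations of the \<open>\<psi> p\<close> are nonnegative; what survives is the number of
  correlated pairs. The relation \<open>R\<close> will be equality for the Plancherel bounds and the
  energy relation for the fourth moment.\<close>

lemma sum_norm_square_le_card:
  fixes \<psi> :: "'p \<Rightarrow> 'w \<Rightarrow> complex"
  assumes "finite Y" and h: "\<And>p. p \<in> Y \<Longrightarrow> norm (h p) \<le> 1" and "c \<ge> 0"
    and R: "\<And>p p'. p \<in> Y \<Longrightarrow> p' \<in> Y \<Longrightarrow>
      (\<Sum>w\<in>W. \<psi> p w * cnj (\<psi> p' w)) = (if R p p' then of_real c else 0)"
  shows "(\<Sum>w\<in>W. (norm (\<Sum>p\<in>Y. h p * \<psi> p w))\<^sup>2) \<le> c * card {(p, p') \<in> Y \<times> Y. R p p'}"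
proof -
  have "(\<Sum>w\<in>W. (norm (\<Sum>p\<in>Y. h p * \<psi> p w))\<^sup>2)
      = norm (complex_of_real (\<Sum>w\<in>W. (norm (\<Sum>p\<in>Y. h p * \<psi> p w))\<^sup>2))"
    by (simp only: norm_of_real abs_of_nonneg sum_nonneg zero_le_power2)
  also have "\<dots> = norm (\<Sum>p\<in>Y. \<Sum>p'\<in>Y. \<Sum>w\<in>W. (h p * \<psi> p w) * cnj (h p' * \<psi> p' w))"
    by (simp only: sum_norm_square_expand)
  also have "\<dots> = norm (\<Sum>p\<in>Y. \<Sum>p'\<in>Y. h p * cnj (h p') * (\<Sum>w\<in>W. \<psi> p w * cnj (\<psi> p' w)))"
    by (simp add: sum_distrib_left mult_ac)
  also have "\<dots> \<le> (\<Sum>p\<in>Y. \<Sum>p'\<in>Y. if R p p' then c else 0)"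
  proof (rule sum_norm_le, rule sum_norm_le)
    fix p p' assume p: "p \<in> Y" "p' \<in> Y"
    have "norm (h p) * norm (h p') \<le> 1 * 1" using h p by (intro mult_mono) auto
    then have "norm (h p) * norm (h p') * c \<le> 1 * c" using \<open>c \<ge> 0\<close> by (intro mult_right_mono) auto
    then show "norm (h p * cnj (h p') * (\<Sum>w\<in>W. \<psi> p w * cnj (\<psi> p' w))) \<le> (if R p p' then c else 0)"
      using R[OF p] \<open>c \<ge> 0\<close> by (simp add: norm_mult)
  qed
  also have "\<dots> = (\<Sum>z\<in>Y \<times> Y. if R (fst z) (snd z) then c else 0)"
    by (simp add: sum.cartesian_product case_prod_unfold)
  also have "\<dots> = c * card {(p, p') \<in> Y \<times> Y. R p p'}"
    using \<open>finite Y\<close> by (simp add: sum.If_cases Int_def case_prod_unfold conj_commute mem_Times_iff)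
  finally show ?thesis .
qed

lemma sum_sum_sum_factor:
  fixes f g :: "_ \<Rightarrow> _ \<Rightarrow> complex"
  shows "(\<Sum>t\<in>T. \<Sum>p\<in>P. \<Sum>w\<in>W. f t w * g p w / c) = (\<Sum>w\<in>W. (\<Sum>t\<in>T. f t w) * (\<Sum>p\<in>P. g p w) / c)"
proof -
  have "(\<Sum>w\<in>W. (\<Sum>t\<in>T. f t w) * (\<Sum>p\<in>P. g p w) / c) = (\<Sum>w\<in>W. \<Sum>t\<in>T. \<Sum>p\<in>P. f t w * g p w / c)"
    by (simp add: sum_product sum_divide_distrib)
  also have "\<dots> = (\<Sum>t\<in>T. \<Sum>w\<in>W. \<Sum>p\<in>P. f t w * g p w / c)" by (rule sum.swap)
  also have "\<dots> = (\<Sum>t\<in>T. \<Sum>p\<in>P. \<Sum>w\<in>W. f t w * g p w / c)" by (intro sum.cong refl sum.swap)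
  finally show ?thesis by simp
qed

lemma norm_sum_square_le:
  fixes f :: "'b \<Rightarrow> complex"
  shows "(norm (\<Sum>x\<in>A. f x))\<^sup>2 \<le> card A * (\<Sum>x\<in>A. (norm (f x))\<^sup>2)"
proof -
  have "(norm (\<Sum>x\<in>A. f x))\<^sup>2 \<le> (\<Sum>x\<in>A. norm (f x))\<^sup>2"
    by (intro power_mono norm_sum) auto
  also have "\<dots> \<le> card A * (\<Sum>x\<in>A. (norm (f x))\<^sup>2)"
    using sum_squared_le_sum_of_squares[of "\<lambda>x. norm (f x)" A] by (simp add: mult.commute)
  finally show ?thesis .
qed

text \<open>Hoelder with exponents 4 and 4/3 against the constant 1, as two applications of
  Cauchy-Schwarz. It produces the fourth moment that the additive energy controls.\<close>

lemma sum_power4_le: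
  fixes f :: "'b \<Rightarrow> real"
  assumes "\<And>x. x \<in> A \<Longrightarrow> f x \<ge> 0"
  shows "(\<Sum>x\<in>A. f x) ^ 4 \<le> real (card A) ^ 3 * (\<Sum>x\<in>A. f x ^ 4)"
proof -
  have 1: "(\<Sum>x\<in>A. f x)\<^sup>2 \<le> card A * (\<Sum>x\<in>A. (f x)\<^sup>2)"
    using sum_squared_le_sum_of_squares[of f A] by (simp add: mult.commute)
  have 2: "(\<Sum>x\<in>A. (f x)\<^sup>2)\<^sup>2 \<le> card A * (\<Sum>x\<in>A. f x ^ 4)"
    using sum_squared_le_sum_of_squares[of "\<lambda>x. (f x)\<^sup>2" A] by (simp add: mult.commute)
  have "(\<Sum>x\<in>A. f x) ^ 4 = ((\<Sum>x\<in>A. f x)\<^sup>2)\<^sup>2" by simp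
  also have "\<dots> \<le> (card A * (\<Sum>x\<in>A. (f x)\<^sup>2))\<^sup>2"
    by (rule power_mono[OF 1]) simp
  also have "\<dots> = (real (card A))\<^sup>2 * (\<Sum>x\<in>A. (f x)\<^sup>2)\<^sup>2" by (simp add: power_mult_distrib)
  also have "\<dots> \<le> (real (card A))\<^sup>2 * (card A * (\<Sum>x\<in>A. f x ^ 4))"
    by (rule mult_left_mono[OF 2]) simp
  finally show ?thesis by (simp add: power2_eq_square power3_eq_cube mult.assoc)
qed

lemma power4_powr_quarter:
  fixes x :: real assumes "x \<ge> 0" shows "(x ^ 4) powr (1 / 4) = x"
proof (cases "x = 0")
  case False
  with assms have "(x ^ 4) powr (1 / 4) = (x powr 4) powr (1 / 4)" by simp
  also have "\<dots> = x powr (4 * (1 / 4))" by (rule powr_powr)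
  finally show ?thesis using assms by simp
qed simp

lemma cnj_sgn_mult: "cnj (sgn z) * z = complex_of_real (norm z)"
proof (cases "z = 0")
  case False
  have "cnj z * z = (complex_of_real (norm z))\<^sup>2"
    using complex_norm_square[of z] by (simp add: mult.commute)
  then show ?thesis using False by (simp add: sgn_eq power2_eq_square)
qed simp

text \<open>Jensen for a concave power. Young's inequality is applied to each \<open>e b\<close>
  paired with the mean \<open>M\<close>; it is an equality at \<open>e b = M\<close>, so equal terms
  are the extremal case. It will be used with one term per slice.\<close>

lemma sum_powr_le:
  fixes e :: "'b \<Rightarrow> real"
  assumes A: "finite A" and e: "\<And>b. b \<in> A \<Longrightarrow> e b \<ge> 0" and \<theta>: "0 < \<theta>" "\<theta> < 1"
  shows "(\<Sum>b\<in>A. e b powr \<theta>) \<le> real (card A) powr (1 - \<theta>) * (\<Sum>b\<in>A. e b) powr \<theta>"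
proof (cases "(\<Sum>b\<in>A. e b) = 0")
  case True
  then have "\<forall>b\<in>A. e b = 0" using A e by (simp add: sum_nonneg_eq_0_iff)
  then have "(\<Sum>b\<in>A. e b powr \<theta>) = 0" by (intro sum.neutral) simp
  then show ?thesis by simp
next
  case False
  define M where "M = (\<Sum>b\<in>A. e b) / card A"
  have "card A > 0" using False A by (auto simp: card_gt_0_iff)
  have sum_pos: "(\<Sum>b\<in>A. e b) > 0" using False sum_nonneg[of A e] e by fastforce
  then have M: "M > 0" using \<open>card A > 0\<close> by (simp add: M_def)
  have "e b powr \<theta> * M powr (1 - \<theta>) \<le> \<theta> * e b + (1 - \<theta>) * M" if b: "b \<in> A" for b
  proof (cases "e b = 0")
    case True
    then show ?thesis using M \<theta> by simp
  next
    case False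
    then show ?thesis using Youngs_inequality_0[of \<theta> "1 - \<theta>" "e b" M] M \<theta> e[OF b] by simp
  qed
  then have "(\<Sum>b\<in>A. e b powr \<theta> * M powr (1 - \<theta>)) \<le> (\<Sum>b\<in>A. \<theta> * e b + (1 - \<theta>) * M)"
    by (rule sum_mono)
  also have "\<dots> = \<theta> * (\<Sum>b\<in>A. e b) + (1 - \<theta>) * (card A * M)"
    by (simp add: sum.distrib sum_distrib_left)
  also have "\<dots> = (\<Sum>b\<in>A. e b)" using \<open>card A > 0\<close> by (simp add: M_def algebra_simps)
  finally have "(\<Sum>b\<in>A. e b powr \<theta>) \<le> (\<Sum>b\<in>A. e b) / M powr (1 - \<theta>)"
    using M by (simp add: sum_distrib_right[symmetric] field_simps)
  also have "\<dots> = real (card A) powr (1 - \<theta>) * ((\<Sum>b\<in>A. e b) powr 1 / (\<Sum>b\<in>A. e b) powr (1 - \<theta>))"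
    using sum_pos \<open>card A > 0\<close> by (simp add: M_def powr_divide)
  also have "(\<Sum>b\<in>A. e b) powr 1 / (\<Sum>b\<in>A. e b) powr (1 - \<theta>) = (\<Sum>b\<in>A. e b) powr \<theta>"
    by (simp only: powr_diff[symmetric]) simp
  finally show ?thesis .
qed

text \<open>After division by \<open>x + y\<close> both summands lie in [0, 1], where a power with
  exponent at most 1 does not decrease a number.\<close>

lemma powr_add_le:
  fixes x y :: real
  assumes "x \<ge> 0" "y \<ge> 0" "0 < \<theta>" "\<theta> \<le> 1"
  shows "(x + y) powr \<theta> \<le> x powr \<theta> + y powr \<theta>"
proof (cases "x + y = 0")
  case False
  then have s: "x + y > 0" using assms by simp
  have *: "z / (x + y) \<le> (z / (x + y)) powr \<theta>" if "0 \<le> z" "z \<le> x + y" for z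
  proof (cases "z = 0")
    case False
    then have "0 < z / (x + y)" "z / (x + y) \<le> 1" using that s by auto
    then have "(z / (x + y)) powr 1 \<le> (z / (x + y)) powr \<theta>" using assms by (intro powr_mono') auto
    moreover have "(z / (x + y)) powr 1 = z / (x + y)" using that s by (intro powr_one) simp
    ultimately show ?thesis by simp
  qed simp
  have "1 = x / (x + y) + y / (x + y)" using s by (simp add: add_divide_distrib[symmetric])
  also have "\<dots> \<le> (x / (x + y)) powr \<theta> + (y / (x + y)) powr \<theta>"
    using * assms by (intro add_mono) auto
  also have "\<dots> = (x powr \<theta> + y powr \<theta>) / (x + y) powr \<theta>"
    using assms s by (simp add: powr_divide add_divide_distrib)
  finally show ?thesis using s by (simp add: field_simps)
qed (use assms in auto)

text \<open>With \<open>N = q powr \<gamma>\<close> all bounds are linear in \<open>\<gamma>\<close>: assumption \<open>B\<close> suffices for \<open>\<gamma> \<ge> (3 k + 5) / 3\<close> and \<open>A\<close> for\n  \<open>\<gamma> \<le> (2 k + 1) (3 k + 5) / (2 (3 k + 2))\<close>, so that \<open>C\<close> need only be compared with the claim at these two ends.\<close>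

lemma exponent_comparison:
  fixes q N W :: real and k :: nat
  assumes k: "k \<ge> 2" and q: "q \<ge> 1" and N: "N \<ge> 1"
    and A: "W \<le> N + N powr 2 * q powr (- (2 * real k + 1) / 2)"
    and B: "W \<le> q * N"
    and C: "W \<le> N + N powr (3/2) * q powr (- real k / 2) + 2 * (N powr (5/4) * q powr ((2 - real k) / 4))
              + N powr (9/8) * q powr ((6 - real k) / 8)"
  shows "W \<le> 5 * N powr ((3 * real k + 8) / (3 * real k + 5))"
proof -
  \<comment> \<open>Measuring \<open>ln N\<close> in units of \<open>3 * k + 5\<close> clears the
    denominator of the claimed exponent: the target becomes \<open>exp ((3 * x + 8) * a)\<close> and
    every comparison is linear in \<open>a\<close> and \<open>l\<close>.\<close>
  define a l where "a = ln N / (3 * k + 5)" and "l = ln q"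
  define x where "x = real k"
  have x: "x \<ge> 2" using k by (simp add: x_def)
  have a0: "a \<ge> 0" and l0: "l \<ge> 0" using N q by (simp_all add: a_def l_def)
  have L: "ln N = (3 * x + 5) * a" by (simp add: a_def x_def)
  have pw: "N powr u * q powr v = exp (u * ((3 * x + 5) * a) + v * l)" for u v
    using N q by (simp add: powr_def exp_add l_def L)
  have pN: "N powr u = exp (u * ((3 * x + 5) * a))" for u
    using N by (simp add: powr_def L)
  have beta: "N powr ((3 * real k + 8) / (3 * real k + 5)) = exp ((3 * x + 8) * a)"
    using x by (simp add: pN x_def[symmetric])
  have N1: "N \<le> exp ((3 * x + 8) * a)"
  proof -
    have "N = N powr 1" using N by simp
    also have "\<dots> \<le> exp ((3 * x + 8) * a)" unfolding pN using a0 by (simp add: mult_right_mono)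
    finally show ?thesis .
  qed
  \<comment> \<open>At the first boundary \<open>q * N\<close> equals the target, at the second the
    term \<open>N powr 2 * q powr (- (2 * k + 1) / 2)\<close> does.\<close>
  consider "l \<le> 3 * a" | "2 * (3 * x + 2) * a \<le> (2 * x + 1) * l"
    | "3 * a \<le> l" "(2 * x + 1) * l \<le> 2 * (3 * x + 2) * a" by linarith
  then show ?thesis
  proof cases
    case 1
    have "q * N = N powr 1 * q powr 1" using N q by simp
    also have "\<dots> \<le> exp ((3 * x + 8) * a)" unfolding pw using 1 by (simp add: algebra_simps)
    finally have "W \<le> exp ((3 * x + 8) * a)" using B by linarith
    then show ?thesis unfolding beta using exp_gt_zero[of "(3 * x + 8) * a"] by linarith
  next
    case 2
    have "N powr 2 * q powr (- (2 * real k + 1) / 2) \<le> exp ((3 * x + 8) * a)"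
      unfolding pw using 2 by (simp add: x_def[symmetric] field_simps)
    then have "W \<le> 2 * exp ((3 * x + 8) * a)" using A N1 by linarith
    then show ?thesis unfolding beta using exp_gt_zero[of "(3 * x + 8) * a"] by linarith
  next
    case 3
    have xa: "3 * (x * a) \<le> x * l" using mult_left_mono[OF 3(1), of x] x by (simp add: mult_ac)
    have "N powr (3/2) * q powr (- real k / 2) \<le> exp ((3 * x + 8) * a)"
      unfolding pw using xa a0 by (simp add: x_def[symmetric] field_simps)
    moreover have "N powr (5/4) * q powr ((2 - real k) / 4) \<le> exp ((3 * x + 8) * a)"
    proof -
      have "(x - 2) * (3 * a) \<le> (x - 2) * l" using 3(1) x by (intro mult_left_mono) auto
      then show ?thesis unfolding pw using a0 by (simp add: x_def[symmetric] field_simps)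
    qed
    moreover have "N powr (9/8) * q powr ((6 - real k) / 8) \<le> exp ((3 * x + 8) * a)"
    proof -
      have "(3 * x - 19) * a \<le> (x - 6) * l"
      proof (cases "x \<ge> 6")
        case True
        have "(x - 6) * (3 * a) \<le> (x - 6) * l" using 3(1) True by (intro mult_left_mono) auto
        then show ?thesis using a0 by (simp add: algebra_simps)
      next
        case False
        \<comment> \<open>The coefficient \<open>6 - x\<close> of \<open>l\<close> is positive, so
          the term is largest at the upper end of the range of \<open>l\<close>, where the decay
          bound takes over.\<close>
        have "(6 - x) * ((2 * x + 1) * l) \<le> (6 - x) * (2 * (3 * x + 2) * a)"
          using 3(2) False by (intro mult_left_mono) auto
        also have "\<dots> = (6 - x) * (2 * (3 * x + 2)) * a" by simp
        \<comment> \<open>Expanded, this is \<open>24 \<le> 3 * x + 19\<close>, true for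
          \<open>x \<ge> 2\<close> and false for \<open>x = 1\<close>: the comparison breaks down
          here for \<open>d = 4\<close>.\<close>
        also have "\<dots> \<le> ((19 - 3 * x) * (2 * x + 1)) * a"
          using x a0 by (intro mult_right_mono) (simp_all add: algebra_simps)
        finally have "(2 * x + 1) * ((6 - x) * l) \<le> (2 * x + 1) * ((19 - 3 * x) * a)" by (simp add: mult_ac)
        then have "(6 - x) * l \<le> (19 - 3 * x) * a" using x by (simp add: mult_le_cancel_left)
        then show ?thesis by (simp add: algebra_simps)
      qed
      then show ?thesis unfolding pw by (simp add: x_def[symmetric] field_simps)
    qed
    ultimately have "W \<le> 5 * exp ((3 * x + 8) * a)" using C N1 by linarith
    then show ?thesis unfolding beta .
  qed
qed

text \<open>Dyadic decomposition of the values of \<open>F\<close>. Using the weak bound at the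
  lower end of each level costs the factor \<open>2 powr r\<close>, and the surplus exponent
  \<open>\<epsilon>\<close> leaves a geometric series of ratio \<open>2 powr - \<epsilon>\<close>;
  without it the number of levels would enter.\<close>

lemma sum_powr_le_of_weak_type:
  fixes F :: "'b \<Rightarrow> real"
  assumes S: "finite S" and F: "\<And>p. p \<in> S \<Longrightarrow> 0 \<le> F p \<and> F p \<le> 1" and B: "B \<ge> 0"
    and r: "r > 0" and \<epsilon>: "\<epsilon> > 0"
    and weak: "\<And>t. t > 0 \<Longrightarrow> real (card {p\<in>S. F p \<ge> t}) \<le> B * t powr - r"
  shows "(\<Sum>p\<in>S. F p powr (r + \<epsilon>)) \<le> B * 2 powr r / (1 - 2 powr - \<epsilon>)"
proof -
  \<comment> \<open>On \<open>T\<close> one has \<open>0 < F p \<le> 1\<close>, so the floor is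
    nonnegative and \<open>nat\<close> truncates nothing. Points with \<open>F p = 0\<close>
    contribute nothing and stay outside \<open>T\<close>.\<close>
  define j where "j = (\<lambda>p. nat \<lfloor>- log 2 (F p)\<rfloor>)"
  define T where "T = {p\<in>S. F p > 0}"
  have T: "finite T" using S by (simp add: T_def)
  define x where "x = (2::real) powr - \<epsilon>"
  have x: "0 < x" "x < 1" using \<epsilon> powr_less_mono[of "- \<epsilon>" 0 "2::real"] by (simp_all add: x_def)
  have bounds: "2 powr (- real (j p) - 1) \<le> F p" "F p \<le> 2 powr (- real (j p))" if p: "p \<in> T" for p
  proof -
    have p0: "F p > 0" "F p \<le> 1" using p F by (auto simp: T_def)
    then have "- log 2 (F p) \<ge> 0" by simp
    then have "real (j p) \<le> - log 2 (F p)" "- log 2 (F p) < real (j p) + 1"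
      unfolding j_def by linarith+
    then have "2 powr (- real (j p) - 1) \<le> 2 powr log 2 (F p)" "2 powr log 2 (F p) \<le> 2 powr (- real (j p))"
      by simp_all
    then show "2 powr (- real (j p) - 1) \<le> F p" "F p \<le> 2 powr (- real (j p))" using p0 by simp_all
  qed
  have "(\<Sum>p\<in>S. F p powr (r + \<epsilon>)) = (\<Sum>p\<in>T. F p powr (r + \<epsilon>))"
    using S F by (intro sum.mono_neutral_right) (auto simp: T_def less_le)
  also have "\<dots> = (\<Sum>i\<in>j ` T. \<Sum>p\<in>{p\<in>T. j p = i}. F p powr (r + \<epsilon>))"
    using T by (rule sum.image_gen)
  also have "\<dots> \<le> (\<Sum>i\<in>j ` T. B * 2 powr r * x ^ i)"
  proof (rule sum_mono)
    fix i
    have "(\<Sum>p\<in>{p\<in>T. j p = i}. F p powr (r + \<epsilon>)) \<le> (\<Sum>p\<in>{p\<in>T. j p = i}. (2 powr (- real i)) powr (r + \<epsilon>))"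
      using bounds(2) r \<epsilon> by (intro sum_mono powr_mono2) (auto simp: T_def)
    also have "\<dots> = real (card {p\<in>T. j p = i}) * 2 powr (- real i * (r + \<epsilon>))" by (simp add: powr_powr)
    also have "\<dots> \<le> (B * (2 powr (- real i - 1)) powr - r) * 2 powr (- real i * (r + \<epsilon>))"
    proof (rule mult_right_mono)
      have "card {p\<in>T. j p = i} \<le> card {p\<in>S. F p \<ge> 2 powr (- real i - 1)}"
        using S bounds(1) by (intro card_mono) (auto simp: T_def)
      then show "real (card {p\<in>T. j p = i}) \<le> B * (2 powr (- real i - 1)) powr - r"
        by (intro order_trans[OF of_nat_mono weak]) simp_all
    qed simp
    also have "\<dots> = B * 2 powr r * x ^ i"
    proof -
      have "x ^ i = 2 powr (- \<epsilon> * real i)" by (simp add: x_def powr_powr flip: powr_realpow)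
      then have "2 powr r * x ^ i = 2 powr (r + - \<epsilon> * real i)" by (simp only: powr_add)
      moreover have "(2 powr (- real i - 1)) powr - r * 2 powr (- real i * (r + \<epsilon>)) = 2 powr (r + - \<epsilon> * real i)"
        by (simp add: powr_powr algebra_simps flip: powr_add)
      ultimately show ?thesis by simp
    qed
    finally show "(\<Sum>p\<in>{p\<in>T. j p = i}. F p powr (r + \<epsilon>)) \<le> B * 2 powr r * x ^ i" .
  qed
  also have "\<dots> = B * 2 powr r * (\<Sum>i\<in>j ` T. x ^ i)" by (rule sum_distrib_left[symmetric])
  also have "\<dots> \<le> B * 2 powr r * (\<Sum>i. x ^ i)"
    using x T B by (intro mult_left_mono sum_le_suminf) auto
  also have "(\<Sum>i. x ^ i) = 1 / (1 - x)" using x by (intro suminf_geometric) simp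
  finally show ?thesis by (simp add: x_def)
qed

text \<open>The \<open>LEAST\<close> in \<open>R_star\<close> ranges over the reals, where it is
  informative only if the infimum is attained. Admissible constants have to be positive, so a
  positive lower bound is what keeps the infimum among them.\<close>

lemma Least_real_le:
  fixes P :: "real \<Rightarrow> bool"
  assumes closed: "\<And>y. y > 0 \<Longrightarrow> (\<And>x. x > y \<Longrightarrow> P x) \<Longrightarrow> P y" and up: "\<And>x y. P x \<Longrightarrow> x \<le> y \<Longrightarrow> P y"
    and low: "l > 0" "\<And>x. P x \<Longrightarrow> l \<le> x" and C: "P C"
  shows "(LEAST x. P x) \<le> C"
proof -
  define i where "i = Inf {x. P x}"
  have bdd: "bdd_below {x. P x}" using low(2) by (intro bdd_belowI[of _ l]) auto
  have "l \<le> i" unfolding i_def using C low(2) by (intro cInf_greatest) auto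
  have "P i"
  proof (rule closed)
    show "i > 0" using \<open>l \<le> i\<close> low by linarith
    fix x assume "x > i"
    then obtain y where "P y" "y < x"
      unfolding i_def using cInf_lessD[of "{x. P x}" x] C by auto
    then show "P x" using up by auto
  qed
  moreover have le: "i \<le> y" if "P y" for y unfolding i_def using that bdd by (intro cInf_lower) auto
  ultimately have "(LEAST x. P x) = i" by (rule Least_equality)
  then show ?thesis using le[OF C] by simp
qed

text \<open>The left side is the fourth root of the bound for \<open>Q\<close> times the energy of a
  slice of \<open>e\<close> points. Subadditivity separates it into pure powers of \<open>e\<close>,
  each of which can be summed over the slices. The factor 2 is a crude bound for
  \<open>2 powr (1/4)\<close>.\<close>

lemma energy_quarter_power_le:
  fixes Q e :: real
  assumes Q: "Q > 0" and e: "e \<ge> 0"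
  shows "(e ^ 3 + Q ^ (k + 1) * e * (2 * e + sqrt (Q ^ (k + 1) * e))) powr (1/4)
    \<le> e powr (3/4) + 2 * (Q powr ((real k + 1) / 4) * e powr (1/2)) + Q powr (3 * (real k + 1) / 8) * e powr (3/8)"
proof -
  define b where "b = Q ^ (k + 1)"
  have b: "b > 0" using Q by (simp add: b_def)
  have bQ: "b powr u = Q powr ((real k + 1) * u)" for u
  proof -
    have "b = Q powr (real (k + 1))" using Q by (simp only: b_def powr_realpow)
    then show ?thesis by (simp add: powr_powr add.commute)
  qed
  have "e ^ 3 + b * e * (2 * e + sqrt (b * e)) = e ^ 3 + (2 * b * e\<^sup>2 + b * e * sqrt (b * e))"
    by (simp add: algebra_simps power2_eq_square)
  then have "(e ^ 3 + b * e * (2 * e + sqrt (b * e))) powr (1/4)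
      \<le> (e ^ 3) powr (1/4) + (2 * b * e\<^sup>2 + b * e * sqrt (b * e)) powr (1/4)"
    using b e powr_add_le[of "e ^ 3" "2 * b * e\<^sup>2 + b * e * sqrt (b * e)" "1/4"] by simp
  moreover have "(2 * b * e\<^sup>2 + b * e * sqrt (b * e)) powr (1/4)
      \<le> (2 * b * e\<^sup>2) powr (1/4) + (b * e * sqrt (b * e)) powr (1/4)"
    using b e by (intro powr_add_le) auto
  moreover have "(e ^ 3) powr (1/4) = e powr (3/4)"
  proof -
    have "e ^ 3 = e powr 3" using e by simp
    then show ?thesis by (simp only: powr_powr) simp
  qed
  moreover have "(2 * b * e\<^sup>2) powr (1/4) \<le> 2 * (Q powr ((real k + 1) / 4) * e powr (1/2))"
  proof -
    have "e\<^sup>2 = e powr 2" using e by simp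
    then have "(2 * b * e\<^sup>2) powr (1/4) = 2 powr (1/4) * (b powr (1/4) * e powr (1/2))"
      using b by (simp add: powr_mult powr_powr)
    also have "\<dots> \<le> 2 * (b powr (1/4) * e powr (1/2))"
      using powr_mono[of "1/4" 1 "2::real"] by (intro mult_right_mono) auto
    finally show ?thesis by (simp add: bQ)
  qed
  moreover have "(b * e * sqrt (b * e)) powr (1/4) = Q powr (3 * (real k + 1) / 8) * e powr (3/8)"
  proof -
    have "b * e * sqrt (b * e) = (b * e) powr 1 * (b * e) powr (1/2)" using b e by (simp add: powr_half_sqrt)
    also have "\<dots> = (b * e) powr (3/2)" unfolding powr_add[symmetric] by simp
    finally have "(b * e * sqrt (b * e)) powr (1/4) = (b * e) powr (3/8)" by (simp only: powr_powr) simp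
    also have "\<dots> = b powr (3/8) * e powr (3/8)" using b e by (simp add: powr_mult)
    finally show ?thesis by (simp add: bQ mult.commute)
  qed
  ultimately show ?thesis unfolding b_def[symmetric] by linarith
qed

text \<open>\<open>A\<close> stands for the field and \<open>e b\<close> for the size of the slice
  at height \<open>b\<close>: there are \<open>Q\<close> slices and their sizes add up to
  \<open>N\<close>. By concavity the worst case is that of equal slices, in which the powers
  \<open>e b powr \<theta>\<close> add up to
  \<open>Q powr (1 - \<theta>) * N powr \<theta>\<close>.\<close>

lemma slices_sum_le:
  fixes e :: "'b \<Rightarrow> real" and k :: nat and Q N :: real
  assumes A: "finite A" "A \<noteq> {}" and e: "\<And>b. b \<in> A \<Longrightarrow> e b \<ge> 0"
  defines "Q \<equiv> real (card A)" and "N \<equiv> (\<Sum>b\<in>A. e b)"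
  assumes N: "N > 0"
  shows "Q powr (- (2 * real k + 1) / 2) * (\<Sum>b\<in>A. (N ^ 3 * (Q ^ (2 * k + 1) *
      (e b ^ 3 + Q ^ (k + 1) * e b * (2 * e b + sqrt (Q ^ (k + 1) * e b))))) powr (1/4))
    \<le> N powr (3/2) * Q powr (- real k / 2) + 2 * (N powr (5/4) * Q powr ((2 - real k) / 4))
        + N powr (9/8) * Q powr ((6 - real k) / 8)"
proof -
  have Q: "Q > 0" using A by (simp add: Q_def card_gt_0_iff)
  define X where "X = N powr (3/4) * Q powr ((2 * real k + 1) / 4)"
  have "(\<Sum>b\<in>A. (N ^ 3 * (Q ^ (2 * k + 1) *
      (e b ^ 3 + Q ^ (k + 1) * e b * (2 * e b + sqrt (Q ^ (k + 1) * e b))))) powr (1/4))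
    \<le> (\<Sum>b\<in>A. X * (e b powr (3/4) + 2 * (Q powr ((real k + 1) / 4) * e b powr (1/2)) + Q powr (3 * (real k + 1) / 8) * e b powr (3/8)))"
  proof (rule sum_mono)
    fix b assume b: "b \<in> A"
    let ?y = "e b ^ 3 + Q ^ (k + 1) * e b * (2 * e b + sqrt (Q ^ (k + 1) * e b))"
    have y: "?y \<ge> 0" using e[OF b] Q by simp
    have "(N ^ 3) powr (1/4) = N powr (3/4)" "(Q ^ (2 * k + 1)) powr (1/4) = Q powr ((2 * real k + 1) / 4)"
      unfolding powr_realpow[OF N, symmetric] powr_realpow[OF Q, symmetric] powr_powr
      by (simp_all add: add.commute)
    then have "(N ^ 3 * (Q ^ (2 * k + 1) * ?y)) powr (1/4) = X * ?y powr (1/4)"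
      using N Q y unfolding X_def by (simp only: powr_mult mult.assoc)
    also have "\<dots> \<le> X * (e b powr (3/4) + 2 * (Q powr ((real k + 1) / 4) * e b powr (1/2)) + Q powr (3 * (real k + 1) / 8) * e b powr (3/8))"
      by (intro mult_left_mono energy_quarter_power_le Q e b) (simp add: X_def)
    finally show "(N ^ 3 * (Q ^ (2 * k + 1) * ?y)) powr (1/4) \<le> \<dots>" .
  qed
  also have "\<dots> = X * ((\<Sum>b\<in>A. e b powr (3/4)) + 2 * (Q powr ((real k + 1) / 4) * (\<Sum>b\<in>A. e b powr (1/2)))
      + Q powr (3 * (real k + 1) / 8) * (\<Sum>b\<in>A. e b powr (3/8)))"
    unfolding sum_distrib_left sum.distrib[symmetric] by (rule sum.cong) (simp_all add: algebra_simps)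
  also have "\<dots> \<le> X * (Q powr (1/4) * N powr (3/4) + 2 * (Q powr ((real k + 1) / 4) * (Q powr (1/2) * N powr (1/2)))
      + Q powr (3 * (real k + 1) / 8) * (Q powr (5/8) * N powr (3/8)))"
    using sum_powr_le[OF A(1), of e "3/4"] sum_powr_le[OF A(1), of e "1/2"] sum_powr_le[OF A(1), of e "3/8"] e
    by (intro mult_left_mono add_mono) (simp_all add: X_def Q_def N_def)
  finally have "Q powr (- (2 * real k + 1) / 2) * (\<Sum>b\<in>A. (N ^ 3 * (Q ^ (2 * k + 1) *
      (e b ^ 3 + Q ^ (k + 1) * e b * (2 * e b + sqrt (Q ^ (k + 1) * e b))))) powr (1/4))
    \<le> Q powr (- (2 * real k + 1) / 2) * (X * (Q powr (1/4) * N powr (3/4) + 2 * (Q powr ((real k + 1) / 4) * (Q powr (1/2) * N powr (1/2)))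
      + Q powr (3 * (real k + 1) / 8) * (Q powr (5/8) * N powr (3/8))))"
    by (rule mult_left_mono) simp
  also have "\<dots> = N powr (3/2) * Q powr (- real k / 2) + 2 * (N powr (5/4) * Q powr ((2 - real k) / 4))
        + N powr (9/8) * Q powr ((6 - real k) / 8)"
  proof -
    let ?c = "Q powr (- (2 * real k + 1) / 2)"
    have "?c * (X * (Q powr (1/4) * N powr (3/4))) = N powr (3/2) * Q powr (- real k / 2)"
      unfolding X_def powr_def using N Q by (simp flip: exp_add) (simp add: field_simps)
    moreover have "?c * (X * (Q powr ((real k + 1) / 4) * (Q powr (1/2) * N powr (1/2))))
        = N powr (5/4) * Q powr ((2 - real k) / 4)"
      unfolding X_def powr_def using N Q by (simp flip: exp_add) (simp add: field_simps)
    moreover have "?c * (X * (Q powr (3 * (real k + 1) / 8) * (Q powr (5/8) * N powr (3/8))))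
        = N powr (9/8) * Q powr ((6 - real k) / 8)"
      unfolding X_def powr_def using N Q by (simp flip: exp_add) (simp add: field_simps)
    ultimately show ?thesis by (simp only: distrib_left mult.left_commute[of _ 2])
  qed
  finally show ?thesis .
qed

section \<open>Characters and Gauss sums of a finite field\<close>

locale odd_character = field F for F (structure) +
  fixes \<chi> :: "'a \<Rightarrow> complex"
  assumes fin: "finite (carrier F)" and odd_card: "odd (card (carrier F))"
    and character: "nontrivial_additive_character F \<chi>"
begin

abbreviation K where "K \<equiv> carrier F"
abbreviation q where "q \<equiv> card (carrier F)"

lemma chi_norm: "x \<in> K \<Longrightarrow> norm (\<chi> x) = 1"
  and chi_add: "x \<in> K \<Longrightarrow> y \<in> K \<Longrightarrow> \<chi> (x \<oplus> y) = \<chi> x * \<chi> y"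
  using character by (auto simp: nontrivial_additive_character_def)

lemma chi_zero: "\<chi> \<zero> = 1"
proof -
  have "\<chi> \<zero> = \<chi> \<zero> * \<chi> \<zero>" using chi_add[of \<zero> \<zero>] by simp
  moreover have "\<chi> \<zero> \<noteq> 0" using chi_norm[of \<zero>] by auto
  ultimately show ?thesis by simp
qed

lemma chi_uminus: assumes "x \<in> K" shows "\<chi> (\<ominus> x) = cnj (\<chi> x)"
proof -
  have 1: "\<chi> x * \<chi> (\<ominus> x) = 1"
    using assms chi_add[of x "\<ominus> x"] by (simp add: r_neg chi_zero)
  have 2: "\<chi> x * cnj (\<chi> x) = 1"
    using chi_norm[OF assms] by (simp add: complex_norm_square[symmetric])
  have "\<chi> x \<noteq> 0" using chi_norm[OF assms] by auto
  with 1 2 show ?thesis by (metis mult_left_cancel)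
qed

lemma chi_minus: "x \<in> K \<Longrightarrow> y \<in> K \<Longrightarrow> \<chi> (x \<ominus> y) = \<chi> x * cnj (\<chi> y)"
  by (simp add: a_minus_def chi_add chi_uminus)

lemma sum_shift: assumes "a \<in> K" shows "(\<Sum>s\<in>K. f (s \<oplus> a)) = (\<Sum>s\<in>K. f s)"
  by (rule sum.reindex_bij_witness[where i="\<lambda>s. s \<ominus> a" and j="\<lambda>s. s \<oplus> a"])
     (use assms in \<open>auto simp: a_minus_def a_assoc r_neg l_neg\<close>)

lemma sum_chi: assumes "c \<in> K" shows "(\<Sum>s\<in>K. \<chi> (s \<otimes> c)) = (if c = \<zero> then of_nat q else 0)"
proof (cases "c = \<zero>")
  case False
  obtain x where x: "x \<in> K" "\<chi> x \<noteq> 1"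
    using character by (auto simp: nontrivial_additive_character_def)
  define s0 where "s0 = x \<otimes> inv c"
  have s0: "s0 \<in> K" "s0 \<otimes> c = x"
    using x assms False by (auto simp: s0_def m_assoc field_Units)
  have "(\<Sum>s\<in>K. \<chi> (s \<otimes> c)) = (\<Sum>s\<in>K. \<chi> ((s \<oplus> s0) \<otimes> c))"
    using sum_shift[of s0 "\<lambda>s. \<chi> (s \<otimes> c)"] s0 by simp
  also have "\<dots> = (\<Sum>s\<in>K. \<chi> x * \<chi> (s \<otimes> c))"
    by (rule sum.cong) (use s0 assms x in \<open>auto simp: l_distr chi_add\<close>)
  also have "\<dots> = \<chi> x * (\<Sum>s\<in>K. \<chi> (s \<otimes> c))" by (simp add: sum_distrib_left)
  finally have "(\<Sum>s\<in>K. \<chi> (s \<otimes> c)) * (1 - \<chi> x) = 0" by (simp add: algebra_simps)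
  with x False show ?thesis by simp
qed (simp add: chi_zero)

lemma sum_chi': "c \<in> K \<Longrightarrow> (\<Sum>s\<in>K. \<chi> (c \<otimes> s)) = (if c = \<zero> then of_nat q else 0)"
  using sum_chi[of c] by (simp add: m_comm cong: sum.cong)

lemma q_pos: "q > 0" using fin by (auto simp: card_gt_0_iff)

definition two where "two = \<one> \<oplus> \<one>"

lemma two_closed [simp]: "two \<in> K" by (simp add: two_def)

text \<open>By Lagrange in the additive group the \<open>q\<close>-fold multiple of
  \<open>\<one>\<close> vanishes; if \<open>two\<close> were zero, this odd multiple would equal
  \<open>\<one>\<close>. In this form odd characteristic enters the proof.\<close>

lemma two_nonzero: "two \<noteq> \<zero>"
proof
  assume two: "two = \<zero>"
  have "[q] \<cdot> \<one> = \<zero>"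
    using group.pow_order_eq_1[OF a_group, of \<one>] by (simp add: order_def add_pow_def)
  moreover obtain k where k: "q = 2 * k + 1" using odd_card by (auto elim: oddE)
  moreover have "[(2 * k + 1)] \<cdot> \<one> = [k] \<cdot> two \<oplus> \<one>"
    by (simp add: add.nat_pow_mult[symmetric] add.nat_pow_distrib mult_2 two_def)
  ultimately show False by (simp add: two)
qed

lemma two_mult: "x \<in> K \<Longrightarrow> two \<otimes> x = x \<oplus> x"
  by (simp add: two_def l_distr)

text \<open>\<open>dual t = -1 / (4 t)\<close> is the coefficient produced by completing the square.\<close>

definition dual where "dual t = \<ominus> (inv (two \<otimes> two \<otimes> t))"

lemma dual_eq: assumes "t \<in> K - {\<zero>}" shows "two \<otimes> two \<otimes> t \<otimes> dual t = \<ominus> \<one>"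
proof -
  have "two \<otimes> two \<otimes> t \<in> Units F"
    using assms two_nonzero by (simp add: field_Units integral_iff)
  then show ?thesis by (simp add: dual_def r_minus Units_closed)
qed

lemma dual_closed: assumes "t \<in> K - {\<zero>}" shows "dual t \<in> K - {\<zero>}"
proof -
  have "two \<otimes> two \<otimes> t \<in> Units F"
    using assms two_nonzero by (simp add: field_Units integral_iff)
  then have "dual t \<in> K" by (simp add: dual_def)
  moreover have "dual t \<noteq> \<zero>"
  proof
    assume "dual t = \<zero>"
    then have "\<ominus> \<one> = \<zero>" using dual_eq[OF assms] assms by simp
    then have "\<one> = \<zero>" by (metis minus_minus minus_zero one_closed)
    then show False by simp
  qed
  ultimately show ?thesis by simp
qed

lemma dual_dual: assumes "t \<in> K - {\<zero>}" shows "dual (dual t) = t"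
proof -
  define c where "c = dual t"
  have c: "c \<in> K - {\<zero>}" using dual_closed[OF assms] by (simp add: c_def)
  have *: "two \<otimes> two \<otimes> c \<otimes> t = \<ominus> \<one>"
    using dual_eq[OF assms] assms c by (simp add: c_def m_ac)
  have "two \<otimes> two \<otimes> c \<otimes> t = two \<otimes> two \<otimes> c \<otimes> dual c"
    using * dual_eq[OF c] by simp
  moreover have "two \<otimes> two \<otimes> c \<noteq> \<zero>" using c two_nonzero by (simp add: integral_iff)
  ultimately have "t = dual c" using m_lcancel[of "two \<otimes> two \<otimes> c" t "dual c"] c assms dual_closed[OF c] by simp
  then show ?thesis by (simp add: c_def)
qed

text \<open>Reparametrizing the nonzero frequencies by \<open>dual\<close> lets any nonzero
  coefficient of a quadratic phase be read as the outcome of completing a square.\<close>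

lemma bij_dual: "bij_betw dual (K - {\<zero>}) (K - {\<zero>})"
  by (rule bij_betw_byWitness[where f'=dual]) (use dual_dual dual_closed in auto)

definition gauss where "gauss t = (\<Sum>y\<in>K. \<chi> (t \<otimes> (y \<otimes> y)))"

lemma gauss_complete_square:
  assumes t: "t \<in> K - {\<zero>}" and u: "u \<in> K"
  shows "(\<Sum>y\<in>K. \<chi> (t \<otimes> (y \<otimes> y) \<oplus> u \<otimes> y)) = \<chi> (dual t \<otimes> (u \<otimes> u)) * gauss t"
proof -
  define c where "c = dual t"
  \<comment> \<open>The shift is \<open>v = 2 * dual t * u\<close>, that is -u / (2 t), and
    \<open>p = t * v\<close> is -u / 2. The identity for \<open>p \<oplus> p\<close> carries the
    defining property of \<open>dual\<close> through the computation.\<close>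
  define w where "w = c \<otimes> u"
  define v where "v = w \<oplus> w"
  define p where "p = t \<otimes> v"
  have tK: "t \<in> K" using t by simp
  have c: "c \<in> K" using dual_closed[OF t] by (simp add: c_def)
  have w: "w \<in> K" "v \<in> K" "p \<in> K" using c tK u by (simp_all add: w_def v_def p_def)
  have "p \<oplus> p = two \<otimes> (t \<otimes> (two \<otimes> w))" using w tK by (simp add: p_def v_def two_mult)
  also have "\<dots> = (two \<otimes> two \<otimes> t \<otimes> c) \<otimes> u" using c tK u by (simp add: w_def m_ac)
  also have "\<dots> = \<ominus> u" unfolding c_def dual_eq[OF t] using u by (simp add: l_minus)
  finally have pp: "p \<oplus> p = \<ominus> u" .
  have *: "t \<otimes> ((y \<oplus> v) \<otimes> (y \<oplus> v)) \<oplus> u \<otimes> (y \<oplus> v) = c \<otimes> (u \<otimes> u) \<oplus> t \<otimes> (y \<otimes> y)"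
    if y: "y \<in> K" for y
  proof -
    have "t \<otimes> ((y \<oplus> v) \<otimes> (y \<oplus> v)) \<oplus> u \<otimes> (y \<oplus> v) = t \<otimes> (y \<otimes> y) \<oplus> (p \<oplus> p) \<otimes> y \<oplus> p \<otimes> v \<oplus> u \<otimes> (y \<oplus> v)"
      unfolding p_def using w tK u y by algebra
    also have "p \<otimes> v = (p \<oplus> p) \<otimes> w" unfolding v_def using w by algebra
    also have "t \<otimes> (y \<otimes> y) \<oplus> (p \<oplus> p) \<otimes> y \<oplus> (p \<oplus> p) \<otimes> w \<oplus> u \<otimes> (y \<oplus> v) = u \<otimes> w \<oplus> t \<otimes> (y \<otimes> y)"
      unfolding pp v_def using w tK u y by algebra
    also have "u \<otimes> w = c \<otimes> (u \<otimes> u)" using c u by (simp add: w_def m_ac)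
    finally show ?thesis .
  qed
  have "(\<Sum>y\<in>K. \<chi> (t \<otimes> (y \<otimes> y) \<oplus> u \<otimes> y))
     = (\<Sum>y\<in>K. \<chi> (t \<otimes> ((y \<oplus> v) \<otimes> (y \<oplus> v)) \<oplus> u \<otimes> (y \<oplus> v)))"
    using sum_shift[of v "\<lambda>y. \<chi> (t \<otimes> (y \<otimes> y) \<oplus> u \<otimes> y)"] w by simp
  also have "\<dots> = (\<Sum>y\<in>K. \<chi> (c \<otimes> (u \<otimes> u)) * \<chi> (t \<otimes> (y \<otimes> y)))"
    by (rule sum.cong) (use * c u tK in \<open>auto simp: chi_add\<close>)
  also have "\<dots> = \<chi> (c \<otimes> (u \<otimes> u)) * gauss t"
    by (simp add: gauss_def sum_distrib_left)
  finally show ?thesis by (simp add: c_def)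
qed

lemma gauss_zero: "gauss \<zero> = of_nat q"
  by (simp add: gauss_def chi_zero)

lemma gauss_norm: assumes t: "t \<in> K - {\<zero>}" shows "gauss t * cnj (gauss t) = of_nat q"
proof -
  have tK: "t \<in> K" using t by simp
  have "gauss t * cnj (gauss t) = (\<Sum>y\<in>K. \<Sum>x\<in>K. \<chi> (t \<otimes> (x \<otimes> x)) * cnj (\<chi> (t \<otimes> (y \<otimes> y))))"
    unfolding gauss_def by (subst sum.swap) (simp add: sum_product)
  \<comment> \<open>Translating \<open>x\<close> by \<open>y\<close> cancels the square of
    \<open>y\<close>. What remains is linear in \<open>y\<close> with coefficient
    \<open>two \<otimes> t \<otimes> x\<close>, and its sum over \<open>y\<close> forces
    \<open>x = \<zero>\<close>.\<close>
  also have "\<dots> = (\<Sum>y\<in>K. \<Sum>x\<in>K. \<chi> (t \<otimes> ((x \<oplus> y) \<otimes> (x \<oplus> y)) \<ominus> t \<otimes> (y \<otimes> y)))"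
  proof (rule sum.cong[OF refl])
    fix y assume y: "y \<in> K"
    have "(\<Sum>x\<in>K. \<chi> (t \<otimes> (x \<otimes> x)) * cnj (\<chi> (t \<otimes> (y \<otimes> y))))
        = (\<Sum>x\<in>K. \<chi> (t \<otimes> ((x \<oplus> y) \<otimes> (x \<oplus> y))) * cnj (\<chi> (t \<otimes> (y \<otimes> y))))"
      using sum_shift[OF y, of "\<lambda>x. \<chi> (t \<otimes> (x \<otimes> x)) * cnj (\<chi> (t \<otimes> (y \<otimes> y)))"] by simp
    also have "\<dots> = (\<Sum>x\<in>K. \<chi> (t \<otimes> ((x \<oplus> y) \<otimes> (x \<oplus> y)) \<ominus> t \<otimes> (y \<otimes> y)))"
      by (rule sum.cong) (use tK y in \<open>auto simp: chi_minus\<close>)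
    finally show "(\<Sum>x\<in>K. \<chi> (t \<otimes> (x \<otimes> x)) * cnj (\<chi> (t \<otimes> (y \<otimes> y))))
      = (\<Sum>x\<in>K. \<chi> (t \<otimes> ((x \<oplus> y) \<otimes> (x \<oplus> y)) \<ominus> t \<otimes> (y \<otimes> y)))" .
  qed
  also have "\<dots> = (\<Sum>y\<in>K. \<Sum>x\<in>K. \<chi> (t \<otimes> (x \<otimes> x)) * \<chi> (y \<otimes> (two \<otimes> t \<otimes> x)))"
  proof (intro sum.cong refl)
    fix x y assume xy: "x \<in> K" "y \<in> K"
    have "t \<otimes> ((x \<oplus> y) \<otimes> (x \<oplus> y)) \<ominus> t \<otimes> (y \<otimes> y) = t \<otimes> (x \<otimes> x) \<oplus> y \<otimes> (two \<otimes> t \<otimes> x)"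
      using xy tK unfolding two_def by algebra
    then show "\<chi> (t \<otimes> ((x \<oplus> y) \<otimes> (x \<oplus> y)) \<ominus> t \<otimes> (y \<otimes> y)) = \<chi> (t \<otimes> (x \<otimes> x)) * \<chi> (y \<otimes> (two \<otimes> t \<otimes> x))"
      using xy tK by (simp add: chi_add)
  qed
  also have "\<dots> = (\<Sum>x\<in>K. \<chi> (t \<otimes> (x \<otimes> x)) * (\<Sum>y\<in>K. \<chi> (y \<otimes> (two \<otimes> t \<otimes> x))))"
    by (subst sum.swap) (simp add: sum_distrib_left)
  also have "\<dots> = (\<Sum>x\<in>K. if x = \<zero> then of_nat q else 0)"
  proof (intro sum.cong refl)
    fix x assume x: "x \<in> K"
    have "two \<otimes> t \<otimes> x = \<zero> \<longleftrightarrow> x = \<zero>"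
      using x t two_nonzero by (simp add: integral_iff)
    then show "\<chi> (t \<otimes> (x \<otimes> x)) * (\<Sum>y\<in>K. \<chi> (y \<otimes> (two \<otimes> t \<otimes> x))) = (if x = \<zero> then of_nat q else 0)"
      using x tK by (simp add: sum_chi chi_zero)
  qed
  also have "\<dots> = of_nat q" using fin by simp
  finally show ?thesis .
qed

lemma norm_gauss: assumes t: "t \<in> K - {\<zero>}" shows "norm (gauss t) = sqrt q"
proof -
  have "complex_of_real ((norm (gauss t))\<^sup>2) = of_nat q"
    using gauss_norm[OF t] by (simp only: complex_norm_square)
  then have "(norm (gauss t))\<^sup>2 = real q" by (metis of_real_eq_iff of_real_of_nat_eq)
  then show ?thesis by (metis norm_ge_zero real_sqrt_unique)
qed

text \<open>The character count \<open>q N = q\<^sup>2 + \<dots>\<close> has an error of at most \<open>(q - 1) q\<close>.\<close>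

lemma sum_two_squares:
  assumes t: "t \<in> K" shows "\<exists>a\<in>K. \<exists>b\<in>K. t = a \<otimes> a \<oplus> b \<otimes> b"
proof (rule ccontr)
  assume neg: "\<not> ?thesis"
  have "(\<Sum>s\<in>K. (gauss s)\<^sup>2 * cnj (\<chi> (s \<otimes> t))) = (\<Sum>s\<in>K. \<Sum>a\<in>K. \<Sum>b\<in>K. \<chi> (s \<otimes> (a \<otimes> a \<oplus> b \<otimes> b \<ominus> t)))"
  proof (rule sum.cong)
    fix s assume s: "s \<in> K"
    have "\<chi> (s \<otimes> (a \<otimes> a \<oplus> b \<otimes> b \<ominus> t)) = \<chi> (s \<otimes> (a \<otimes> a)) * \<chi> (s \<otimes> (b \<otimes> b)) * cnj (\<chi> (s \<otimes> t))"
      if "a \<in> K" "b \<in> K" for a b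
    proof -
      have "s \<otimes> (a \<otimes> a \<oplus> b \<otimes> b \<ominus> t) = s \<otimes> (a \<otimes> a) \<oplus> s \<otimes> (b \<otimes> b) \<ominus> s \<otimes> t"
        using that s t by algebra
      then show ?thesis using that s t by (simp add: chi_minus chi_add)
    qed
    then show "(gauss s)\<^sup>2 * cnj (\<chi> (s \<otimes> t)) = (\<Sum>a\<in>K. \<Sum>b\<in>K. \<chi> (s \<otimes> (a \<otimes> a \<oplus> b \<otimes> b \<ominus> t)))"
      unfolding gauss_def power2_eq_square sum_distrib_right
      by (intro sum.cong refl) (simp add: sum_distrib_left sum_distrib_right)
  qed simp
  also have "\<dots> = (\<Sum>a\<in>K. \<Sum>b\<in>K. \<Sum>s\<in>K. \<chi> (s \<otimes> (a \<otimes> a \<oplus> b \<otimes> b \<ominus> t)))"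
    by (subst sum.swap) (intro sum.cong refl sum.swap)
  also have "\<dots> = 0"
  proof (rule sum.neutral, rule ballI, rule sum.neutral, rule ballI)
    fix a b assume ab: "a \<in> K" "b \<in> K"
    have "a \<otimes> a \<oplus> b \<otimes> b \<ominus> t \<noteq> \<zero>" using ab t neg r_right_minus_eq[of "a \<otimes> a \<oplus> b \<otimes> b" t] by auto
    then show "(\<Sum>s\<in>K. \<chi> (s \<otimes> (a \<otimes> a \<oplus> b \<otimes> b \<ominus> t))) = 0" using ab t by (simp add: sum_chi)
  qed
  finally have "(\<Sum>s\<in>K. (gauss s)\<^sup>2 * cnj (\<chi> (s \<otimes> t))) = 0" .
  then have "of_nat (q\<^sup>2) = - (\<Sum>s\<in>K-{\<zero>}. (gauss s)\<^sup>2 * cnj (\<chi> (s \<otimes> t)))"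
    using t fin by (simp add: sum.remove[of K \<zero>] gauss_zero chi_zero group_add_class.eq_neg_iff_add_eq_0)
  then have "real (q\<^sup>2) = norm (\<Sum>s\<in>K-{\<zero>}. (gauss s)\<^sup>2 * cnj (\<chi> (s \<otimes> t)))"
    by (metis norm_minus_cancel norm_of_nat)
  also have "\<dots> \<le> (\<Sum>s\<in>K-{\<zero>}. norm ((gauss s)\<^sup>2 * cnj (\<chi> (s \<otimes> t))))" by (rule norm_sum)
  also have "\<dots> = (\<Sum>s\<in>K-{\<zero>}. real q)"
    by (rule sum.cong) (use t in \<open>auto simp: norm_mult norm_power norm_gauss chi_norm\<close>)
  also have "\<dots> < real (q\<^sup>2)" using q_pos fin by (simp add: power2_eq_square)
  finally show False by simp
qed

text \<open>If \<open>t = a\<^sup>2 + b\<^sup>2\<close>, multiplication by \<open>a + i b\<close> scales the form \<open>x\<^sup>2 + y\<^sup>2\<close> by \<open>t\<close>.\<close>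

lemma gauss_square: assumes t: "t \<in> K - {\<zero>}" shows "(gauss t)\<^sup>2 = (gauss \<one>)\<^sup>2"
proof -
  have tK: "t \<in> K" using t by simp
  obtain a b where ab: "a \<in> K" "b \<in> K" "t = a \<otimes> a \<oplus> b \<otimes> b" using sum_two_squares[OF tK] by auto
  define h where "h = (\<lambda>(x, y). (a \<otimes> x \<ominus> b \<otimes> y, b \<otimes> x \<oplus> a \<otimes> y))"
  have inj: "inj_on h (K \<times> K)"
  proof (rule inj_onI, clarify)
    fix x y x' y' assume xy: "x \<in> K" "y \<in> K" "x' \<in> K" "y' \<in> K" and "h (x, y) = h (x', y')"
    then have 1: "a \<otimes> x \<ominus> b \<otimes> y = a \<otimes> x' \<ominus> b \<otimes> y'" "b \<otimes> x \<oplus> a \<otimes> y = b \<otimes> x' \<oplus> a \<otimes> y'"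
      by (auto simp: h_def)
    \<comment> \<open>Multiplication by the conjugate \<open>a - i b\<close> recovers
      \<open>t\<close> times the original pair, and \<open>t\<close> can be cancelled.\<close>
    have e: "t \<otimes> x = a \<otimes> (a \<otimes> x \<ominus> b \<otimes> y) \<oplus> b \<otimes> (b \<otimes> x \<oplus> a \<otimes> y)"
            "t \<otimes> y = a \<otimes> (b \<otimes> x \<oplus> a \<otimes> y) \<ominus> b \<otimes> (a \<otimes> x \<ominus> b \<otimes> y)" if "x \<in> K" "y \<in> K" for x y
      using ab that by (simp only: ab(3), algebra)+
    have "t \<otimes> x = t \<otimes> x'" "t \<otimes> y = t \<otimes> y'" using e[OF xy(1,2)] e[OF xy(3,4)] 1 by auto
    then show "x = x' \<and> y = y'" using t xy m_lcancel[of t] by auto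
  qed
  have im: "h ` (K \<times> K) = K \<times> K"
    by (rule endo_inj_surj[OF _ _ inj]) (use fin ab in \<open>auto simp: h_def\<close>)
  have bij: "bij_betw h (K \<times> K) (K \<times> K)" using inj im by (simp add: bij_betw_def)
  have sq: "(gauss s)\<^sup>2 = (\<Sum>p\<in>K \<times> K. \<chi> (s \<otimes> (fst p \<otimes> fst p \<oplus> snd p \<otimes> snd p)))" if "s \<in> K" for s
    unfolding gauss_def power2_eq_square sum_product sum.cartesian_product
    by (rule sum.cong) (use that in \<open>auto simp: r_distr chi_add\<close>)
  have "(gauss \<one>)\<^sup>2 = (\<Sum>p\<in>K \<times> K. \<chi> (\<one> \<otimes> (fst (h p) \<otimes> fst (h p) \<oplus> snd (h p) \<otimes> snd (h p))))"
    by (subst sum.reindex_bij_betw[OF bij]) (simp add: sq)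
  also have "\<dots> = (\<Sum>p\<in>K \<times> K. \<chi> (t \<otimes> (fst p \<otimes> fst p \<oplus> snd p \<otimes> snd p)))"
  proof (rule sum.cong[OF refl])
    fix p assume "p \<in> K \<times> K"
    then obtain x y where p: "p = (x, y)" "x \<in> K" "y \<in> K" by auto
    have "\<one> \<otimes> ((a \<otimes> x \<ominus> b \<otimes> y) \<otimes> (a \<otimes> x \<ominus> b \<otimes> y) \<oplus> (b \<otimes> x \<oplus> a \<otimes> y) \<otimes> (b \<otimes> x \<oplus> a \<otimes> y))
       = t \<otimes> (x \<otimes> x \<oplus> y \<otimes> y)"
      unfolding ab(3) using ab(1,2) p by algebra
    then show "\<chi> (\<one> \<otimes> (fst (h p) \<otimes> fst (h p) \<oplus> snd (h p) \<otimes> snd (h p))) = \<chi> (t \<otimes> (fst p \<otimes> fst p \<oplus> snd p \<otimes> snd p))"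
      by (simp add: p h_def)
  qed
  also have "\<dots> = (gauss t)\<^sup>2" using sq[OF tK] by simp
  finally show ?thesis by simp
qed

lemma card_square_roots: assumes c: "c \<in> K" shows "card {y\<in>K. y \<otimes> y = c} \<le> 2"
proof (cases "\<exists>y0\<in>K. y0 \<otimes> y0 = c")
  case True
  then obtain y0 where y0: "y0 \<in> K" "y0 \<otimes> y0 = c" by auto
  have "{y\<in>K. y \<otimes> y = c} \<subseteq> {y0, \<ominus> y0}"
  proof
    fix y assume "y \<in> {y\<in>K. y \<otimes> y = c}"
    then have y: "y \<in> K" "c = y \<otimes> y" by auto
    have "(y \<ominus> y0) \<otimes> (y \<oplus> y0) = y \<otimes> y \<ominus> y0 \<otimes> y0" using y y0 by algebra
    also have "\<dots> = \<zero>" using y y0 by simp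
    finally have "y \<ominus> y0 = \<zero> \<or> y \<oplus> y0 = \<zero>" using y y0 by (simp add: integral_iff)
    then show "y \<in> {y0, \<ominus> y0}" using y y0 minus_equality[of y y0] r_right_minus_eq[of y y0] by auto
  qed
  then have "card {y\<in>K. y \<otimes> y = c} \<le> card {y0, \<ominus> y0}" by (intro card_mono) auto
  also have "\<dots> \<le> 2" by (simp add: card_insert_le_m1)
  finally show ?thesis .
next
  case False
  then have empty: "{y\<in>K. y \<otimes> y = c} = {}" by auto
  show ?thesis unfolding empty by simp
qed

text \<open>Including \<open>t = \<zero>\<close> turns the sum into \<open>q\<close> times the
  number of square roots of \<open>c\<close>; without it the value is \<open>q\<close> times that
  number minus 1, hence one of -q, 0, q. Termwise estimation would only give about
  \<open>q powr (3/2)\<close>.\<close>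

lemma sum_gauss_chi_bound:
  assumes c: "c \<in> K"
  shows "norm (\<Sum>t\<in>K-{\<zero>}. cnj (gauss t) * \<chi> (t \<otimes> c)) \<le> q"
proof -
  have "(\<Sum>t\<in>K. cnj (gauss t) * \<chi> (t \<otimes> c)) = (\<Sum>t\<in>K. \<Sum>y\<in>K. \<chi> (t \<otimes> (c \<ominus> y \<otimes> y)))"
  proof (rule sum.cong[OF refl])
    fix t assume t: "t \<in> K"
    have "\<chi> (t \<otimes> (c \<ominus> y \<otimes> y)) = cnj (\<chi> (t \<otimes> (y \<otimes> y))) * \<chi> (t \<otimes> c)" if "y \<in> K" for y
    proof -
      have "t \<otimes> (c \<ominus> y \<otimes> y) = t \<otimes> c \<ominus> t \<otimes> (y \<otimes> y)" using that t c by algebra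
      then show ?thesis using that t c by (simp add: chi_minus)
    qed
    then show "cnj (gauss t) * \<chi> (t \<otimes> c) = (\<Sum>y\<in>K. \<chi> (t \<otimes> (c \<ominus> y \<otimes> y)))"
      by (simp add: gauss_def sum_distrib_right)
  qed
  also have "\<dots> = (\<Sum>y\<in>K. \<Sum>t\<in>K. \<chi> (t \<otimes> (c \<ominus> y \<otimes> y)))" by (rule sum.swap)
  also have "\<dots> = (\<Sum>y\<in>K. if y \<otimes> y = c then of_nat q else 0)"
    by (rule sum.cong[OF refl]) (use c in \<open>auto simp: sum_chi\<close>)
  also have "\<dots> = of_nat (q * card {y\<in>K. y \<otimes> y = c})"
    using fin by (simp add: sum.If_cases Int_def conj_commute)
  finally have "(\<Sum>t\<in>K-{\<zero>}. cnj (gauss t) * \<chi> (t \<otimes> c)) = of_nat (q * card {y\<in>K. y \<otimes> y = c}) - of_nat q"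
    using fin c by (simp add: sum.remove[of K \<zero>] gauss_zero chi_zero algebra_simps)
  also have "\<dots> = of_real (real q * (real (card {y\<in>K. y \<otimes> y = c}) - 1))"
    by (simp add: algebra_simps)
  finally have "norm (\<Sum>t\<in>K-{\<zero>}. cnj (gauss t) * \<chi> (t \<otimes> c)) = real q * \<bar>real (card {y\<in>K. y \<otimes> y = c}) - 1\<bar>"
    by (simp only: norm_of_real abs_mult abs_of_nat)
  also have "\<dots> \<le> real q * 1"
    using card_square_roots[OF c] by (intro mult_left_mono) auto
  finally show ?thesis by simp
qed

section \<open>Vectors and isotropic pairs\<close>

abbreviation V where "V n \<equiv> vec_space F n"

text \<open>Not extensional: differences lie in \<open>{1..n} \<rightarrow> K\<close> rather than in
  \<open>V n\<close>, which suffices because \<open>dot F n\<close> reads only the coordinates 1 to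
  n.\<close>

definition vdiff where "vdiff x z = (\<lambda>i::nat. x i \<ominus> z i)"

lemma V_vec: "x \<in> V n \<Longrightarrow> x \<in> {1..n} \<rightarrow> K"
  by (auto simp: vec_space_def PiE_def)

lemma V_eqI: "x \<in> V n \<Longrightarrow> y \<in> V n \<Longrightarrow> (\<And>i. i \<in> {1..n} \<Longrightarrow> x i = y i) \<Longrightarrow> x = y"
  unfolding vec_space_def by (rule PiE_ext)

lemma finite_V: "finite (V n)"
  using fin by (auto simp: vec_space_def intro: finite_PiE)

lemma card_V: "card (V n) = q ^ n"
  by (simp add: vec_space_def card_PiE)

lemma vdiff_vec [intro]: "x \<in> {1..n} \<rightarrow> K \<Longrightarrow> y \<in> {1..n} \<rightarrow> K \<Longrightarrow> vdiff x y \<in> {1..n} \<rightarrow> K"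
  by (auto simp: vdiff_def)

lemma vdiff_V: "x \<in> V n \<Longrightarrow> y \<in> V n \<Longrightarrow> vdiff x y \<in> {1..n} \<rightarrow> K"
  using vdiff_vec V_vec by blast

lemma scale_vec [intro]: "s \<in> K \<Longrightarrow> x \<in> {1..n} \<rightarrow> K \<Longrightarrow> (\<lambda>i. s \<otimes> x i) \<in> {1..n} \<rightarrow> K"
  by auto

lemma dot_closed [simp]: "x \<in> {1..n} \<rightarrow> K \<Longrightarrow> y \<in> {1..n} \<rightarrow> K \<Longrightarrow> dot F n x y \<in> K"
  by (auto simp: dot_def intro!: finsum_closed)

lemma dot_cong: "(\<And>i. i \<in> {1..n} \<Longrightarrow> x i = x' i) \<Longrightarrow> (\<And>i. i \<in> {1..n} \<Longrightarrow> y i = y' i) \<Longrightarrow>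
    x' \<in> {1..n} \<rightarrow> K \<Longrightarrow> y' \<in> {1..n} \<rightarrow> K \<Longrightarrow> dot F n x y = dot F n x' y'"
  unfolding dot_def by (rule finsum_cong') auto

lemma dot_commute: "x \<in> {1..n} \<rightarrow> K \<Longrightarrow> y \<in> {1..n} \<rightarrow> K \<Longrightarrow> dot F n x y = dot F n y x"
  unfolding dot_def by (rule finsum_cong') (auto simp: Pi_iff m_comm)

lemma dot_scale_left:
  assumes "s \<in> K" "x \<in> {1..n} \<rightarrow> K" "y \<in> {1..n} \<rightarrow> K"
  shows "dot F n (\<lambda>i. s \<otimes> x i) y = s \<otimes> dot F n x y"
proof -
  have "s \<otimes> dot F n x y = (\<Oplus>i\<in>{1..n}. s \<otimes> (x i \<otimes> y i))"
    unfolding dot_def using assms by (intro finsum_rdistr) auto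
  also have "\<dots> = dot F n (\<lambda>i. s \<otimes> x i) y"
    unfolding dot_def using assms by (intro finsum_cong') (auto simp: Pi_iff m_assoc)
  finally show ?thesis by simp
qed

lemma dot_uminus_left:
  assumes "x \<in> {1..n} \<rightarrow> K" "y \<in> {1..n} \<rightarrow> K"
  shows "dot F n (\<lambda>i. \<ominus> x i) y = \<ominus> dot F n x y"
proof -
  have "dot F n (\<lambda>i. \<ominus> x i) y = dot F n (\<lambda>i. \<ominus> \<one> \<otimes> x i) y"
    by (rule dot_cong) (use assms in \<open>auto simp: Pi_iff l_minus\<close>)
  then show ?thesis using assms by (simp add: dot_scale_left l_minus)
qed

lemma dot_add_left:
  assumes "x \<in> {1..n} \<rightarrow> K" "z \<in> {1..n} \<rightarrow> K" "y \<in> {1..n} \<rightarrow> K"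
  shows "dot F n (\<lambda>i. x i \<oplus> z i) y = dot F n x y \<oplus> dot F n z y"
proof -
  have "dot F n x y \<oplus> dot F n z y = (\<Oplus>i\<in>{1..n}. x i \<otimes> y i \<oplus> z i \<otimes> y i)"
    unfolding dot_def using assms by (intro finsum_addf[symmetric]) auto
  also have "\<dots> = dot F n (\<lambda>i. x i \<oplus> z i) y"
    unfolding dot_def using assms by (intro finsum_cong') (auto simp: Pi_iff l_distr)
  finally show ?thesis by simp
qed

lemma dot_vdiff_left:
  assumes "x \<in> {1..n} \<rightarrow> K" "z \<in> {1..n} \<rightarrow> K" "y \<in> {1..n} \<rightarrow> K"
  shows "dot F n (vdiff x z) y = dot F n x y \<ominus> dot F n z y"
proof -
  have "(\<lambda>i. \<ominus> z i) \<in> {1..n} \<rightarrow> K" using assms by auto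
  then show ?thesis using assms unfolding vdiff_def a_minus_def
    by (simp add: dot_add_left dot_uminus_left)
qed

lemma dot_vdiff_right:
  assumes "x \<in> {1..n} \<rightarrow> K" "z \<in> {1..n} \<rightarrow> K" "y \<in> {1..n} \<rightarrow> K"
  shows "dot F n y (vdiff x z) = dot F n y x \<ominus> dot F n y z"
  using dot_vdiff_left[OF assms] dot_commute[OF assms(3) vdiff_vec[OF assms(1,2)]]
    dot_commute[OF assms(3,1)] dot_commute[OF assms(3,2)] by simp

lemma chi_finsum:
  assumes "finite A" "f \<in> A \<rightarrow> K" shows "\<chi> (\<Oplus>i\<in>A. f i) = (\<Prod>i\<in>A. \<chi> (f i))"
  using assms by (induction A rule: finite_induct) (auto simp: chi_zero chi_add)

lemma chi_dot:
  "x \<in> {1..n} \<rightarrow> K \<Longrightarrow> y \<in> {1..n} \<rightarrow> K \<Longrightarrow> \<chi> (dot F n x y) = (\<Prod>i\<in>{1..n}. \<chi> (x i \<otimes> y i))"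
  unfolding dot_def by (rule chi_finsum) auto

lemma sum_V_prod:
  "(\<Sum>y\<in>V n. \<Prod>i\<in>{1..n}. f i (y i)) = (\<Prod>i\<in>{1..n}. \<Sum>t\<in>K. (f i t :: complex))"
  unfolding vec_space_def using fin by (subst prod_sum_PiE) auto

lemma sum_chi_dot:
  assumes u: "u \<in> {1..n} \<rightarrow> K"
  shows "(\<Sum>y\<in>V n. \<chi> (dot F n u y)) = (if \<forall>i\<in>{1..n}. u i = \<zero> then of_nat (q ^ n) else 0)"
proof -
  have "(\<Sum>y\<in>V n. \<chi> (dot F n u y)) = (\<Sum>y\<in>V n. \<Prod>i\<in>{1..n}. \<chi> (u i \<otimes> y i))"
    by (rule sum.cong) (use u V_vec in \<open>auto simp: chi_dot\<close>)
  also have "\<dots> = (\<Prod>i\<in>{1..n}. \<Sum>t\<in>K. \<chi> (u i \<otimes> t))" by (rule sum_V_prod)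
  also have "\<dots> = (\<Prod>i\<in>{1..n}. if u i = \<zero> then of_nat q else 0)"
    by (rule prod.cong) (use u in \<open>auto simp: sum_chi' Pi_iff\<close>)
  also have "\<dots> = (if \<forall>i\<in>{1..n}. u i = \<zero> then of_nat (q ^ n) else 0)"
    by (auto simp: prod_zero_iff)
  finally show ?thesis .
qed

lemma sum_chi_dot_diff:
  assumes "x \<in> V n" "z \<in> V n"
  shows "(\<Sum>y\<in>V n. \<chi> (dot F n x y) * cnj (\<chi> (dot F n z y))) = (if x = z then of_nat (q ^ n) else 0)"
proof -
  have "(\<Sum>y\<in>V n. \<chi> (dot F n x y) * cnj (\<chi> (dot F n z y))) = (\<Sum>y\<in>V n. \<chi> (dot F n (vdiff x z) y))"
    by (rule sum.cong) (use assms V_vec in \<open>simp_all add: dot_vdiff_left chi_minus\<close>)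
  also have "\<dots> = (if \<forall>i\<in>{1..n}. vdiff x z i = \<zero> then of_nat (q ^ n) else 0)"
    by (rule sum_chi_dot) (rule vdiff_V[OF assms])
  also have "(\<forall>i\<in>{1..n}. vdiff x z i = \<zero>) \<longleftrightarrow> x = z"
    using V_vec[OF assms(1)] V_vec[OF assms(2)] V_eqI[OF assms]
    by (auto simp: vdiff_def Pi_iff)
  finally show ?thesis .
qed

text \<open>The quadratic form is diagonal, so the sum is a product of \<open>n\<close>
  one-dimensional sums, each completed to a square; hence the \<open>n\<close>-th power of
  \<open>gauss t\<close>.\<close>

lemma sum_chi_quadratic:
  assumes t: "t \<in> K - {\<zero>}" and u: "u \<in> {1..n} \<rightarrow> K"
  shows "(\<Sum>y\<in>V n. \<chi> (t \<otimes> dot F n y y \<oplus> dot F n u y)) = \<chi> (dual t \<otimes> dot F n u u) * gauss t ^ n"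
proof -
  have *: "\<chi> (c \<otimes> dot F n y y \<oplus> dot F n v y) = (\<Prod>i\<in>{1..n}. \<chi> (c \<otimes> (y i \<otimes> y i) \<oplus> v i \<otimes> y i))"
    if "y \<in> {1..n} \<rightarrow> K" "v \<in> {1..n} \<rightarrow> K" "c \<in> K" for y v c
  proof -
    have "\<chi> (c \<otimes> dot F n y y \<oplus> dot F n v y) = \<chi> (dot F n (\<lambda>i. c \<otimes> y i) y) * \<chi> (dot F n v y)"
      using that by (simp add: dot_scale_left chi_add)
    also have "\<dots> = (\<Prod>i\<in>{1..n}. \<chi> (c \<otimes> y i \<otimes> y i) * \<chi> (v i \<otimes> y i))"
      using that scale_vec[of c y n] by (simp only: chi_dot prod.distrib)
    also have "\<dots> = (\<Prod>i\<in>{1..n}. \<chi> (c \<otimes> (y i \<otimes> y i) \<oplus> v i \<otimes> y i))"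
      by (rule prod.cong) (use that in \<open>auto simp: chi_add m_assoc Pi_iff\<close>)
    finally show ?thesis .
  qed
  have "(\<Sum>y\<in>V n. \<chi> (t \<otimes> dot F n y y \<oplus> dot F n u y))
      = (\<Sum>y\<in>V n. \<Prod>i\<in>{1..n}. \<chi> (t \<otimes> (y i \<otimes> y i) \<oplus> u i \<otimes> y i))"
    by (rule sum.cong) (use t u V_vec in \<open>auto simp: *\<close>)
  also have "\<dots> = (\<Prod>i\<in>{1..n}. \<Sum>y\<in>K. \<chi> (t \<otimes> (y \<otimes> y) \<oplus> u i \<otimes> y))" by (rule sum_V_prod)
  also have "\<dots> = (\<Prod>i\<in>{1..n}. \<chi> (dual t \<otimes> (u i \<otimes> u i)) * gauss t)"
    by (rule prod.cong) (use u gauss_complete_square[OF t] in \<open>auto simp: Pi_iff\<close>)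
  also have "\<dots> = (\<Prod>i\<in>{1..n}. \<chi> (dual t \<otimes> u i \<otimes> u i)) * gauss t ^ n"
    unfolding prod.distrib using u dual_closed[OF t] by (simp add: m_assoc Pi_iff cong: prod.cong_simp)
  also have "\<dots> = \<chi> (dot F n (\<lambda>i. dual t \<otimes> u i) u) * gauss t ^ n"
    using u dual_closed[OF t] scale_vec[of "dual t" u n] by (simp add: chi_dot)
  finally show ?thesis using u dual_closed[OF t] by (simp add: dot_scale_left)
qed

text \<open>Squares of Gauss sums do not depend on \<open>t\<close>, so for odd \<open>n\<close> the
  power is a constant of modulus \<open>q ^ k\<close> times one conjugated Gauss sum, and the
  remaining sum over \<open>t\<close> cancels. The gain over the termwise bound is about
  \<open>sqrt q\<close>. For even \<open>n\<close> the power would be constant in \<open>t\<close>,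
  with no cancellation at \<open>c = \<zero>\<close>.\<close>

lemma norm_gauss_quadratic_sum:
  assumes n: "n = 2 * k + 1" and c: "c \<in> K"
  shows "norm (\<Sum>t\<in>K-{\<zero>}. cnj (gauss t) ^ n * \<chi> (t \<otimes> c)) \<le> q ^ (k + 1)"
proof -
  have "(\<Sum>t\<in>K-{\<zero>}. cnj (gauss t) ^ n * \<chi> (t \<otimes> c))
      = cnj ((gauss \<one>)\<^sup>2) ^ k * (\<Sum>t\<in>K-{\<zero>}. cnj (gauss t) * \<chi> (t \<otimes> c))"
    unfolding sum_distrib_left
  proof (rule sum.cong[OF refl])
    fix t assume t: "t \<in> K - {\<zero>}"
    have "cnj (gauss t) ^ n = cnj ((gauss t)\<^sup>2) ^ k * cnj (gauss t)"
      unfolding n by (simp add: power_add power_mult)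
    then show "cnj (gauss t) ^ n * \<chi> (t \<otimes> c) = cnj ((gauss \<one>)\<^sup>2) ^ k * (cnj (gauss t) * \<chi> (t \<otimes> c))"
      unfolding gauss_square[OF t] by simp
  qed
  then have "norm (\<Sum>t\<in>K-{\<zero>}. cnj (gauss t) ^ n * \<chi> (t \<otimes> c))
     = real q ^ k * norm (\<Sum>t\<in>K-{\<zero>}. cnj (gauss t) * \<chi> (t \<otimes> c))"
    by (simp add: norm_mult norm_power norm_gauss)
  also have "\<dots> \<le> real q ^ k * real q"
    by (intro mult_left_mono sum_gauss_chi_bound c) auto
  finally show ?thesis by (simp add: mult.commute)
qed

lemma sum_norm_square_chi_dot:
  assumes "E \<subseteq> V n" shows "(\<Sum>w\<in>V n. (norm (\<Sum>x\<in>E. \<chi> (dot F n x w)))\<^sup>2) \<le> q ^ n * card E"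
proof -
  have "(\<Sum>w\<in>V n. (norm (\<Sum>x\<in>E. 1 * \<chi> (dot F n x w)))\<^sup>2) \<le> real (q ^ n) * card {(x, z) \<in> E \<times> E. x = z}"
    by (rule sum_norm_square_le_card) (use assms finite_subset[OF assms finite_V] in \<open>auto simp: sum_chi_dot_diff subset_iff\<close>)
  also have "{(x, z) \<in> E \<times> E. x = z} = (\<lambda>x. (x, x)) ` E" by auto
  also have "card \<dots> = card E" by (rule card_image) (auto simp: inj_on_def)
  finally show ?thesis by simp
qed

text \<open>The zero frequency gives the expected count, the square of \<open>card E\<close> divided
  by \<open>q\<close>. At the other frequencies the phase is written as a transform over
  \<open>w\<close>; this separates \<open>x\<close> from \<open>z\<close> and leaves the squared
  modulus of the transform of \<open>E\<close>. The sum over \<open>t\<close> is bounded uniformly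
  in \<open>w\<close>, and Plancherel handles the sum over \<open>w\<close>.\<close>

lemma isotropic_pairs_bound:
  assumes n: "n = 2 * k + 1" and E: "E \<subseteq> V n"
  shows "q * real (card {(x, z) \<in> E \<times> E. dot F n (vdiff x z) (vdiff x z) = \<zero>})
    \<le> (real (card E))\<^sup>2 + q ^ (k + 1) * card E"
proof -
  have finE: "finite E" using finite_subset[OF E finite_V] .
  define Q where "Q = (\<lambda>p. dot F n (vdiff (fst p) (snd p)) (vdiff (fst p) (snd p)))"
  have pv: "vdiff (fst p) (snd p) \<in> {1..n} \<rightarrow> K" if "p \<in> E \<times> E" for p
    using that E by (intro vdiff_V) auto
  have QK: "Q p \<in> K" if "p \<in> E \<times> E" for p using pv[OF that] by (simp add: Q_def)
  have "of_nat (q * card {p \<in> E \<times> E. Q p = \<zero>}) = (\<Sum>p\<in>E \<times> E. if Q p = \<zero> then of_nat q else (0::complex))"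
    using finE by (simp add: sum.If_cases Int_def conj_commute)
  also have "\<dots> = (\<Sum>p\<in>E \<times> E. \<Sum>s\<in>K. \<chi> (s \<otimes> Q p))"
    by (rule sum.cong) (use QK in \<open>auto simp: sum_chi\<close>)
  also have "\<dots> = (\<Sum>s\<in>K. \<Sum>p\<in>E \<times> E. \<chi> (s \<otimes> Q p))" by (rule sum.swap)
  also have "\<dots> = (\<Sum>p\<in>E \<times> E. \<chi> (\<zero> \<otimes> Q p)) + (\<Sum>s\<in>K-{\<zero>}. \<Sum>p\<in>E \<times> E. \<chi> (s \<otimes> Q p))"
    using fin by (simp add: sum.remove[of K \<zero>])
  also have "(\<Sum>p\<in>E \<times> E. \<chi> (\<zero> \<otimes> Q p)) = (of_nat (card E))\<^sup>2"
    using QK by (simp add: chi_zero card_cartesian_product power2_eq_square cong: sum.cong)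
  also have "(\<Sum>s\<in>K-{\<zero>}. \<Sum>p\<in>E \<times> E. \<chi> (s \<otimes> Q p)) = (\<Sum>t\<in>K-{\<zero>}. \<Sum>p\<in>E \<times> E. \<chi> (dual t \<otimes> Q p))"
    by (rule sum.reindex_bij_betw[OF bij_dual, symmetric])
  \<comment> \<open>\<open>sum_chi_quadratic\<close> is read backwards: as
    \<open>gauss t * cnj (gauss t)\<close> equals \<open>q\<close>, the factor
    \<open>cnj (gauss t) ^ n / q ^ n\<close> undoes the Gauss sums.\<close>
  also have "\<dots> = (\<Sum>t\<in>K-{\<zero>}. \<Sum>p\<in>E \<times> E. \<Sum>w\<in>V n.
      (cnj (gauss t) ^ n * \<chi> (t \<otimes> dot F n w w)) * \<chi> (dot F n (vdiff (fst p) (snd p)) w) / of_nat (q ^ n))"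
  proof (rule sum.cong[OF refl], rule sum.cong[OF refl])
    fix t p assume t: "t \<in> K - {\<zero>}" and p: "p \<in> E \<times> E"
    have "(\<Sum>w\<in>V n. (cnj (gauss t) ^ n * \<chi> (t \<otimes> dot F n w w)) * \<chi> (dot F n (vdiff (fst p) (snd p)) w) / of_nat (q ^ n))
       = cnj (gauss t) ^ n / of_nat (q ^ n) * (\<Sum>w\<in>V n. \<chi> (t \<otimes> dot F n w w \<oplus> dot F n (vdiff (fst p) (snd p)) w))"
      unfolding sum_distrib_left
      by (rule sum.cong) (use t pv[OF p] V_vec in \<open>auto simp: chi_add\<close>)
    also have "\<dots> = (gauss t * cnj (gauss t)) ^ n / of_nat (q ^ n) * \<chi> (dual t \<otimes> Q p)"
      unfolding sum_chi_quadratic[OF t pv[OF p]] Q_def by (simp add: power_mult_distrib)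
    also have "\<dots> = \<chi> (dual t \<otimes> Q p)" unfolding gauss_norm[OF t] using q_pos by simp
    finally show "\<chi> (dual t \<otimes> Q p) = (\<Sum>w\<in>V n. (cnj (gauss t) ^ n * \<chi> (t \<otimes> dot F n w w)) *
        \<chi> (dot F n (vdiff (fst p) (snd p)) w) / of_nat (q ^ n))" by simp
  qed
  also have "\<dots> = (\<Sum>w\<in>V n. (\<Sum>t\<in>K-{\<zero>}. cnj (gauss t) ^ n * \<chi> (t \<otimes> dot F n w w)) *
      (\<Sum>p\<in>E \<times> E. \<chi> (dot F n (vdiff (fst p) (snd p)) w)) / of_nat (q ^ n))"
    by (rule sum_sum_sum_factor[where f="\<lambda>t w. cnj (gauss t) ^ n * \<chi> (t \<otimes> dot F n w w)"
        and g="\<lambda>p w. \<chi> (dot F n (vdiff (fst p) (snd p)) w)"])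
  also have "\<dots> = (\<Sum>w\<in>V n. (\<Sum>t\<in>K-{\<zero>}. cnj (gauss t) ^ n * \<chi> (t \<otimes> dot F n w w)) *
      of_real ((norm (\<Sum>x\<in>E. \<chi> (dot F n x w)))\<^sup>2) / of_nat (q ^ n))"
  proof (rule sum.cong[OF refl])
    fix w assume w: "w \<in> V n"
    have "(\<Sum>p\<in>E \<times> E. \<chi> (dot F n (vdiff (fst p) (snd p)) w))
        = (\<Sum>p\<in>E \<times> E. \<chi> (dot F n (fst p) w) * cnj (\<chi> (dot F n (snd p) w)))"
      by (rule sum.cong) (use E V_vec w in \<open>auto simp: dot_vdiff_left chi_minus subset_iff\<close>)
    also have "\<dots> = (\<Sum>x\<in>E. \<chi> (dot F n x w)) * cnj (\<Sum>x\<in>E. \<chi> (dot F n x w))"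
      by (simp add: sum_product sum.cartesian_product case_prod_unfold)
    also have "\<dots> = of_real ((norm (\<Sum>x\<in>E. \<chi> (dot F n x w)))\<^sup>2)" by (simp only: complex_norm_square)
    finally show "(\<Sum>t\<in>K-{\<zero>}. cnj (gauss t) ^ n * \<chi> (t \<otimes> dot F n w w)) *
        (\<Sum>p\<in>E \<times> E. \<chi> (dot F n (vdiff (fst p) (snd p)) w)) / of_nat (q ^ n)
      = (\<Sum>t\<in>K-{\<zero>}. cnj (gauss t) ^ n * \<chi> (t \<otimes> dot F n w w)) *
        of_real ((norm (\<Sum>x\<in>E. \<chi> (dot F n x w)))\<^sup>2) / of_nat (q ^ n)" by simp
  qed
  finally have eq: "of_nat (q * card {p \<in> E \<times> E. Q p = \<zero>}) = (of_nat (card E))\<^sup>2 + (\<Sum>w\<in>V n.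
      (\<Sum>t\<in>K-{\<zero>}. cnj (gauss t) ^ n * \<chi> (t \<otimes> dot F n w w)) *
      of_real ((norm (\<Sum>x\<in>E. \<chi> (dot F n x w)))\<^sup>2) / of_nat (q ^ n))" (is "_ = _ + ?S") .
  have "norm ?S \<le> (\<Sum>w\<in>V n. q ^ (k + 1) * (norm (\<Sum>x\<in>E. \<chi> (dot F n x w)))\<^sup>2 / real (q ^ n))"
  proof (rule sum_norm_le)
    fix w assume w: "w \<in> V n"
    show "norm ((\<Sum>t\<in>K-{\<zero>}. cnj (gauss t) ^ n * \<chi> (t \<otimes> dot F n w w)) *
      of_real ((norm (\<Sum>x\<in>E. \<chi> (dot F n x w)))\<^sup>2) / of_nat (q ^ n)) \<le>
      q ^ (k + 1) * (norm (\<Sum>x\<in>E. \<chi> (dot F n x w)))\<^sup>2 / real (q ^ n)"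
      unfolding norm_divide norm_mult norm_of_real norm_of_nat abs_power2
      using norm_gauss_quadratic_sum[OF n, of "dot F n w w"] V_vec[OF w]
      by (intro divide_right_mono mult_right_mono) auto
  qed
  also have "\<dots> = q ^ (k + 1) / real (q ^ n) * (\<Sum>w\<in>V n. (norm (\<Sum>x\<in>E. \<chi> (dot F n x w)))\<^sup>2)"
    by (simp add: sum_distrib_left)
  also have "\<dots> \<le> q ^ (k + 1) / real (q ^ n) * (q ^ n * card E)"
    by (intro mult_left_mono sum_norm_square_chi_dot E) auto
  also have "\<dots> = q ^ (k + 1) * card E" using q_pos by simp
  finally have S: "norm ?S \<le> q ^ (k + 1) * card E" .
  have "real (q * card {p \<in> E \<times> E. Q p = \<zero>}) = norm (of_nat (q * card {p \<in> E \<times> E. Q p = \<zero>}) :: complex)"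
    by (simp only: norm_of_nat)
  also have "\<dots> = norm ((of_nat (card E))\<^sup>2 + ?S)" by (simp only: eq)
  also have "\<dots> \<le> (real (card E))\<^sup>2 + norm ?S"
    by (rule order_trans[OF norm_triangle_ineq]) (simp add: norm_power)
  finally show ?thesis using S by (simp add: Q_def case_prod_unfold mem_Times_iff conj_assoc)
qed

section \<open>Additive energy on the paraboloid\<close>

lemma sum_scale_nonzero:
  assumes "s \<in> K - {\<zero>}" shows "(\<Sum>m\<in>K-{\<zero>}. f (m \<otimes> s)) = (\<Sum>m\<in>K-{\<zero>}. f m)"
proof -
  have "inv s \<in> K - {\<zero>}"
    using assms Units_inv_Units[of s] unfolding field_Units by blast
  then show ?thesis
    by (intro sum.reindex_bij_witness[where i="\<lambda>m. m \<otimes> inv s" and j="\<lambda>m. m \<otimes> s"])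
       (use assms in \<open>auto simp: m_assoc field_Units integral_iff\<close>)
qed

lemma sum_chi_nonzero:
  assumes "c \<in> K" shows "(\<Sum>s\<in>K-{\<zero>}. \<chi> (s \<otimes> c)) = (if c = \<zero> then of_nat q - 1 else - 1)"
  using sum_chi[OF assms] fin assms by (auto simp: sum.remove[of K \<zero>] chi_zero algebra_simps
      group_add_class.eq_neg_iff_add_eq_0 split: if_splits)

text \<open>Expanding the square, the sum over \<open>y\<close> forces \<open>s (x - z) = s' (x - z')\<close>.  With \<open>s' = m s\<close> the remaining\n  phase is \<open>s\<close> times \<open>m (m - 1)\<close> times the square of \<open>x - z'\<close>, so that the sum over \<open>s\<close> is negative unless this vanishes.\<close>

lemma orthogonal_pairs_at_bound:
  assumes x: "x \<in> V n" and E: "E \<subseteq> V n"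
  shows "(q * real (card {(y, z) \<in> E \<times> E. dot F n (vdiff x z) (vdiff y z) = \<zero>}) - (real (card E))\<^sup>2)\<^sup>2
     \<le> card E * (q ^ (n + 1) * (card E + q * card {z \<in> E. dot F n (vdiff x z) (vdiff x z) = \<zero>}))"
proof -
  have finE: "finite E" using finite_subset[OF E finite_V] .
  define e where "e = real (card E)"
  define L where "L = K - {\<zero>}"
  have finL: "finite L" using fin by (simp add: L_def)
  define u where "u = (\<lambda>z. vdiff x z)"
  have u: "u z \<in> {1..n} \<rightarrow> K" if "z \<in> E" for z
    unfolding u_def by (rule vdiff_V) (use that E x in auto)
  have Ev: "z \<in> {1..n} \<rightarrow> K" if "z \<in> E" for z using that E V_vec by blast
  \<comment> \<open>As a function of \<open>y\<close>, \<open>D z y\<close> is affine with gradient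
    \<open>x - z\<close>; hence \<open>\<phi> (s, z)\<close> is a character of frequency
    \<open>s (x - z)\<close> up to a constant phase, which \<open>\<kappa>\<close> records
    below.\<close>
  define D where "D = (\<lambda>z y. dot F n (u z) (vdiff y z))"
  have DK: "D z y \<in> K" if "z \<in> E" "y \<in> V n" for y z
    unfolding D_def using u[OF that(1)] that E by (intro dot_closed vdiff_V) auto
  define \<phi> where "\<phi> = (\<lambda>p y. \<chi> (fst p \<otimes> D (snd p) y))"
  define N where "N = card {p \<in> E \<times> E. D (snd p) (fst p) = \<zero>}"
  define S where "S = (\<Sum>y\<in>E. \<Sum>p\<in>L \<times> E. \<phi> p y)"
  have "of_nat (q * N) = (\<Sum>p\<in>E \<times> E. if D (snd p) (fst p) = \<zero> then of_nat q else (0::complex))"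
    unfolding N_def using finE by (simp add: sum.If_cases Int_def conj_commute)
  also have "\<dots> = (\<Sum>p\<in>E \<times> E. \<Sum>s\<in>K. \<chi> (s \<otimes> D (snd p) (fst p)))"
  proof (rule sum.cong[OF refl])
    fix p assume "p \<in> E \<times> E"
    then have "D (snd p) (fst p) \<in> K" using DK E by auto
    then show "(if D (snd p) (fst p) = \<zero> then of_nat q else 0) = (\<Sum>s\<in>K. \<chi> (s \<otimes> D (snd p) (fst p)))"
      by (simp only: sum_chi)
  qed
  also have "\<dots> = (\<Sum>p\<in>E \<times> E. 1 + (\<Sum>s\<in>L. \<chi> (s \<otimes> D (snd p) (fst p))))"
  proof (rule sum.cong[OF refl])
    fix p assume "p \<in> E \<times> E"
    then have "D (snd p) (fst p) \<in> K" using DK E by auto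
    then show "(\<Sum>s\<in>K. \<chi> (s \<otimes> D (snd p) (fst p))) = 1 + (\<Sum>s\<in>L. \<chi> (s \<otimes> D (snd p) (fst p)))"
      using fin by (simp add: sum.remove[of K \<zero>] L_def chi_zero)
  qed
  also have "\<dots> = (of_nat (card E))\<^sup>2 + (\<Sum>y\<in>E. \<Sum>z\<in>E. \<Sum>s\<in>L. \<chi> (s \<otimes> D z y))"
    by (simp add: sum.distrib card_cartesian_product power2_eq_square
        sum.cartesian_product[where A=E and B=E] case_prod_unfold)
  also have "(\<Sum>y\<in>E. \<Sum>z\<in>E. \<Sum>s\<in>L. \<chi> (s \<otimes> D z y)) = S"
  proof -
    have "(\<Sum>z\<in>E. \<Sum>s\<in>L. \<chi> (s \<otimes> D z y)) = (\<Sum>p\<in>L \<times> E. \<chi> (fst p \<otimes> D (snd p) y))" for y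
      by (subst sum.swap) (simp add: sum.cartesian_product case_prod_unfold)
    then show ?thesis by (simp add: S_def \<phi>_def)
  qed
  finally have qN: "of_nat (q * N) = (of_nat (card E))\<^sup>2 + S" .
  have "S = of_real (real q * real N - e\<^sup>2)"
    using qN by (simp add: e_def algebra_simps)
  then have "(real q * real N - e\<^sup>2)\<^sup>2 = (norm S)\<^sup>2" by (simp only: norm_of_real power2_abs)
  also have "\<dots> \<le> e * (\<Sum>y\<in>E. (norm (\<Sum>p\<in>L \<times> E. \<phi> p y))\<^sup>2)"
    unfolding S_def e_def by (rule norm_sum_square_le)
  \<comment> \<open>Cauchy-Schwarz has left squares in \<open>y\<close>, so the range can be
    enlarged from \<open>E\<close> to the whole space, where the sums over \<open>y\<close> are
    exact.\<close>
  also have "\<dots> \<le> e * (\<Sum>y\<in>V n. (norm (\<Sum>p\<in>L \<times> E. \<phi> p y))\<^sup>2)"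
    by (intro mult_left_mono sum_mono2 finite_V E) (auto simp: e_def)
  finally have 1: "(real q * real N - e\<^sup>2)\<^sup>2 \<le> e * (\<Sum>y\<in>V n. (norm (\<Sum>p\<in>L \<times> E. \<phi> p y))\<^sup>2)" .
  define \<kappa> where "\<kappa> = (\<lambda>s z. cnj (\<chi> (s \<otimes> dot F n (u z) z)))"
  have \<phi>: "\<phi> (s, z) y = \<kappa> s z * \<chi> (dot F n (\<lambda>i. s \<otimes> u z i) y)"
    if "s \<in> L" "z \<in> E" "y \<in> V n" for s z y
  proof -
    have "s \<otimes> D z y = s \<otimes> dot F n (u z) y \<ominus> s \<otimes> dot F n (u z) z"
      using that u[of z] Ev[of z] V_vec[of y n] by (simp add: D_def L_def dot_vdiff_right a_minus_def r_distr r_minus)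
    then show ?thesis
      using that u[of z] Ev[of z] V_vec[of y n] by (simp add: \<phi>_def \<kappa>_def L_def chi_minus dot_scale_left)
  qed
  \<comment> \<open>The frequencies \<open>s (x - z)\<close> and \<open>m s (x - z')\<close>
    coincide: \<open>z\<close> lies on the line through \<open>x\<close> and \<open>z'\<close>, with
    ratio \<open>m\<close>.\<close>
  define P where "P = (\<lambda>m z z'. \<forall>i\<in>{1..n}. u z i = m \<otimes> u z' i)"
  have inner: "(\<Sum>y\<in>V n. \<phi> (s, z) y * cnj (\<phi> (m \<otimes> s, z') y))
      = (if P m z z' then of_nat (q ^ n) * \<chi> (s \<otimes> (m \<otimes> (m \<ominus> \<one>) \<otimes> dot F n (u z') (u z'))) else 0)"
    if s: "s \<in> L" and m: "m \<in> L" and z: "z \<in> E" and z': "z' \<in> E" for s m z z'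
  proof -
    have sm: "m \<otimes> s \<in> L" using s m by (auto simp: L_def integral_iff)
    have K: "s \<in> K" "m \<in> K" "m \<otimes> s \<in> K" using s m by (auto simp: L_def)
    have sc: "(\<lambda>i. s \<otimes> u z i) \<in> {1..n} \<rightarrow> K" "(\<lambda>i. m \<otimes> s \<otimes> u z' i) \<in> {1..n} \<rightarrow> K"
      using K u[OF z] u[OF z'] by auto
    have "(\<Sum>y\<in>V n. \<phi> (s, z) y * cnj (\<phi> (m \<otimes> s, z') y))
        = \<kappa> s z * cnj (\<kappa> (m \<otimes> s) z') * (\<Sum>y\<in>V n. \<chi> (dot F n (vdiff (\<lambda>i. s \<otimes> u z i) (\<lambda>i. m \<otimes> s \<otimes> u z' i)) y))"
      unfolding sum_distrib_left
      by (rule sum.cong) (use s sm z z' sc V_vec in \<open>auto simp: \<phi> dot_vdiff_left chi_minus\<close>)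
    also have "(\<Sum>y\<in>V n. \<chi> (dot F n (vdiff (\<lambda>i. s \<otimes> u z i) (\<lambda>i. m \<otimes> s \<otimes> u z' i)) y))
        = (if P m z z' then of_nat (q ^ n) else 0)"
    proof -
      have "vdiff (\<lambda>i. s \<otimes> u z i) (\<lambda>i. m \<otimes> s \<otimes> u z' i) i = \<zero> \<longleftrightarrow> u z i = m \<otimes> u z' i"
        if "i \<in> {1..n}" for i
      proof -
        have ui: "u z i \<in> K" "u z' i \<in> K" using u[OF z] u[OF z'] that by auto
        have "m \<otimes> s \<otimes> u z' i = s \<otimes> (m \<otimes> u z' i)" using K ui by (simp add: m_ac)
        then show ?thesis using ui K s m_lcancel[of s] by (simp add: vdiff_def L_def)
      qed
      then show ?thesis using sum_chi_dot[OF vdiff_vec[OF sc]] by (simp add: P_def)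
    qed
    also have "\<kappa> s z * cnj (\<kappa> (m \<otimes> s) z') * (if P m z z' then of_nat (q ^ n) else 0)
       = (if P m z z' then of_nat (q ^ n) * \<chi> (s \<otimes> (m \<otimes> (m \<ominus> \<one>) \<otimes> dot F n (u z') (u z'))) else 0)"
    proof (cases "P m z z'")
      case True
      define a b c where "a = dot F n (u z') z" and "b = dot F n (u z') z'" and "c = dot F n (u z') (u z')"
      have abc: "a \<in> K" "b \<in> K" "c \<in> K"
        using u[OF z'] Ev[OF z] Ev[OF z'] by (auto simp: a_def b_def c_def)
      have uz: "dot F n (u z) w = m \<otimes> dot F n (u z') w" if "w \<in> {1..n} \<rightarrow> K" for w
      proof -
        have "dot F n (u z) w = dot F n (\<lambda>i. m \<otimes> u z' i) w"
          using True that K u[OF z'] by (intro dot_cong) (auto simp: P_def)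
        then show ?thesis using K u[OF z'] that by (simp add: dot_scale_left)
      qed
      have xv: "x \<in> {1..n} \<rightarrow> K" using V_vec[OF x] .
      \<comment> \<open>The vector \<open>z' - z = (x - z) - (x - z')\<close> is
        \<open>m - 1\<close> times \<open>x - z'\<close>; the identity is its product with
        \<open>x - z'\<close>.\<close>
      have "m \<otimes> c \<ominus> c = b \<ominus> a"
      proof -
        define r where "r = dot F n (u z') x"
        have r: "r \<in> K" using u[OF z'] xv by (simp add: r_def)
        have "c = r \<ominus> b"
          using dot_vdiff_right[OF xv Ev[OF z'] u[OF z']] by (simp add: u_def c_def r_def b_def)
        moreover have "m \<otimes> c = r \<ominus> a"
          using dot_vdiff_right[OF xv Ev[OF z] u[OF z']] uz[OF u[OF z']]
            dot_commute[OF u[OF z'] u[OF z]] by (simp add: u_def c_def r_def a_def)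
        ultimately have "m \<otimes> c \<ominus> c = (r \<ominus> a) \<ominus> (r \<ominus> b)" by simp
        also have "\<dots> = b \<ominus> a" using r abc by algebra
        finally show ?thesis .
      qed
      moreover have "m \<otimes> (m \<ominus> \<one>) \<otimes> c = m \<otimes> (m \<otimes> c \<ominus> c)" using K abc by algebra
      ultimately have mc: "m \<otimes> (m \<ominus> \<one>) \<otimes> c = m \<otimes> (b \<ominus> a)" by simp
      have "s \<otimes> (m \<otimes> (m \<ominus> \<one>) \<otimes> c) = (m \<otimes> s) \<otimes> b \<ominus> s \<otimes> (m \<otimes> a)"
        unfolding mc using K abc by algebra
      then have "\<chi> (s \<otimes> (m \<otimes> (m \<ominus> \<one>) \<otimes> c)) = \<kappa> s z * cnj (\<kappa> (m \<otimes> s) z')"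
        using K abc uz[OF Ev[OF z]] by (simp add: chi_minus \<kappa>_def a_def[symmetric] b_def[symmetric])
      with True show ?thesis by (simp add: c_def)
    qed simp
    finally show ?thesis .
  qed
  define T where "T = {(m, z, z') \<in> L \<times> E \<times> E. P m z z' \<and> m \<otimes> (m \<ominus> \<one>) \<otimes> dot F n (u z') (u z') = \<zero>}"
  have c_closed: "m \<otimes> (m \<ominus> \<one>) \<otimes> dot F n (u z') (u z') \<in> K" if "m \<in> L" "z' \<in> E" for m z'
    using that u[of z'] by (auto simp: L_def)
  have "complex_of_real (\<Sum>y\<in>V n. (norm (\<Sum>p\<in>L \<times> E. \<phi> p y))\<^sup>2)
    = (\<Sum>p\<in>L \<times> E. \<Sum>p'\<in>L \<times> E. \<Sum>y\<in>V n. \<phi> p y * cnj (\<phi> p' y))" by (rule sum_norm_square_expand)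
  also have "\<dots> = (\<Sum>s\<in>L. \<Sum>z\<in>E. \<Sum>z'\<in>E. \<Sum>s'\<in>L. \<Sum>y\<in>V n. \<phi> (s, z) y * cnj (\<phi> (s', z') y))"
  proof -
    have pairs: "(\<Sum>p\<in>L \<times> E. f p) = (\<Sum>s\<in>L. \<Sum>z\<in>E. f (s, z))" for f :: "_ \<Rightarrow> complex"
      by (simp add: sum.cartesian_product)
    show ?thesis unfolding pairs by (intro sum.cong refl sum.swap)
  qed
  also have "\<dots> = (\<Sum>s\<in>L. \<Sum>z\<in>E. \<Sum>z'\<in>E. \<Sum>m\<in>L. \<Sum>y\<in>V n. \<phi> (s, z) y * cnj (\<phi> (m \<otimes> s, z') y))"
  proof (rule sum.cong[OF refl], rule sum.cong[OF refl], rule sum.cong[OF refl])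
    fix s z z' assume "s \<in> L"
    then show "(\<Sum>s'\<in>L. \<Sum>y\<in>V n. \<phi> (s, z) y * cnj (\<phi> (s', z') y))
        = (\<Sum>m\<in>L. \<Sum>y\<in>V n. \<phi> (s, z) y * cnj (\<phi> (m \<otimes> s, z') y))"
      using sum_scale_nonzero[of s "\<lambda>s'. \<Sum>y\<in>V n. \<phi> (s, z) y * cnj (\<phi> (s', z') y)"]
      by (simp add: L_def)
  qed
  also have "\<dots> = (\<Sum>s\<in>L. \<Sum>z\<in>E. \<Sum>z'\<in>E. \<Sum>m\<in>L.
      (if P m z z' then of_nat (q ^ n) * \<chi> (s \<otimes> (m \<otimes> (m \<ominus> \<one>) \<otimes> dot F n (u z') (u z'))) else 0))"
    by (intro sum.cong refl inner)
  also have "\<dots> = (\<Sum>z\<in>E. \<Sum>z'\<in>E. \<Sum>m\<in>L. \<Sum>s\<in>L.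
      (if P m z z' then of_nat (q ^ n) * \<chi> (s \<otimes> (m \<otimes> (m \<ominus> \<one>) \<otimes> dot F n (u z') (u z'))) else 0))"
    by (rule trans[OF sum.swap], rule sum.cong[OF refl], rule trans[OF sum.swap],
        rule sum.cong[OF refl], rule sum.swap)
  also have "\<dots> = (\<Sum>z\<in>E. \<Sum>z'\<in>E. \<Sum>m\<in>L. of_real (if P m z z' then real (q ^ n) *
      (if m \<otimes> (m \<ominus> \<one>) \<otimes> dot F n (u z') (u z') = \<zero> then real q - 1 else - 1) else 0))"
    by (intro sum.cong refl) (use c_closed in \<open>auto simp: sum_distrib_left[symmetric] sum_chi_nonzero L_def\<close>)
  finally have "(\<Sum>y\<in>V n. (norm (\<Sum>p\<in>L \<times> E. \<phi> p y))\<^sup>2)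
     = (\<Sum>z\<in>E. \<Sum>z'\<in>E. \<Sum>m\<in>L. (if P m z z' then real (q ^ n) *
      (if m \<otimes> (m \<ominus> \<one>) \<otimes> dot F n (u z') (u z') = \<zero> then real q - 1 else - 1) else 0))"
    unfolding of_real_sum[symmetric] of_real_eq_iff .
  \<comment> \<open>A nonvanishing phase contributes \<open>- q ^ n\<close>, which is dropped; a
    vanishing one contributes \<open>q ^ n * (q - 1)\<close>, at most
    \<open>q ^ (n + 1)\<close>.\<close>
  also have "\<dots> \<le> (\<Sum>z\<in>E. \<Sum>z'\<in>E. \<Sum>m\<in>L. (if P m z z' \<and>
      m \<otimes> (m \<ominus> \<one>) \<otimes> dot F n (u z') (u z') = \<zero> then real (q ^ (n + 1)) else 0))"
    by (intro sum_mono) (auto simp: algebra_simps)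
  also have "\<dots> = (\<Sum>m\<in>L. \<Sum>z\<in>E. \<Sum>z'\<in>E. (if P m z z' \<and>
      m \<otimes> (m \<ominus> \<one>) \<otimes> dot F n (u z') (u z') = \<zero> then real (q ^ (n + 1)) else 0))"
    by (rule trans[OF _ sum.swap], rule sum.cong[OF refl], rule sum.swap)
  also have "\<dots> = (\<Sum>w\<in>L \<times> E \<times> E. if w \<in> T then real (q ^ (n + 1)) else 0)"
    unfolding sum.cartesian_product by (rule sum.cong) (auto simp: T_def split: if_splits)
  also have "\<dots> = real (q ^ (n + 1)) * card T"
  proof -
    have "(L \<times> E \<times> E) \<inter> T = T" by (auto simp: T_def)
    then show ?thesis using finE finL by (simp add: sum.If_cases)
  qed
  also have "\<dots> \<le> real (q ^ (n + 1)) * (e + q * card {z \<in> E. dot F n (u z) (u z) = \<zero>})"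
  proof (rule mult_left_mono)
    \<comment> \<open>The point \<open>z\<close> is determined as \<open>x - m (x - z')\<close>, so
      it suffices to count pairs \<open>(m, z')\<close>: either \<open>m = \<one>\<close> with any
      \<open>z'\<close>, or any \<open>m\<close> with \<open>x - z'\<close> isotropic.\<close>
    define h where "h = (\<lambda>(m::'a, z::nat \<Rightarrow> 'a, z'::nat \<Rightarrow> 'a). (m, z'))"
    have "inj_on h T"
    proof (rule inj_onI)
      fix w w' assume "w \<in> T" "w' \<in> T" and eq: "h w = h w'"
      then obtain m z z1 z' where w: "w = (m, z, z')" "w' = (m, z1, z')" "z \<in> E" "z1 \<in> E" "P m z z'" "P m z1 z'"
        unfolding T_def h_def by auto
      have "z = z1"
      proof (rule V_eqI[of _ n])
        fix i assume i: "i \<in> {1..n}"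
        then have "x i \<ominus> z i = x i \<ominus> z1 i" using w(5,6) by (simp add: P_def u_def vdiff_def)
        moreover have "x i \<in> K" "z i \<in> K" "z1 i \<in> K" using V_vec[OF x, THEN Pi_mem, OF i] w(3,4)[THEN Ev, THEN Pi_mem, OF i] .
        ultimately show "z i = z1 i"
        proof -
          assume eq: "x i \<ominus> z i = x i \<ominus> z1 i" and K: "x i \<in> K" "z i \<in> K" "z1 i \<in> K"
          have "z i = x i \<ominus> (x i \<ominus> z i)" using K by algebra
          also have "\<dots> = z1 i" unfolding eq using K by algebra
          finally show ?thesis .
        qed
      qed (use w E in auto)
      then show "w = w'" using w by simp
    qed
    then have "card T = card (h ` T)" by (simp add: card_image)
    also have "\<dots> \<le> card ({\<one>} \<times> E \<union> K \<times> {z \<in> E. dot F n (u z) (u z) = \<zero>})"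
    proof (rule card_mono)
      show "h ` T \<subseteq> {\<one>} \<times> E \<union> K \<times> {z \<in> E. dot F n (u z) (u z) = \<zero>}"
      proof
        fix v assume "v \<in> h ` T"
        then obtain m z z' where v: "v = (m, z')" "m \<in> L" "z' \<in> E"
          and 0: "m \<otimes> (m \<ominus> \<one>) \<otimes> dot F n (u z') (u z') = \<zero>"
          unfolding T_def h_def by auto
        have "m \<ominus> \<one> = \<zero> \<or> dot F n (u z') (u z') = \<zero>"
          using 0 v u[of z'] by (auto simp: L_def integral_iff)
        then show "v \<in> {\<one>} \<times> E \<union> K \<times> {z \<in> E. dot F n (u z) (u z) = \<zero>}"
          using v by (auto simp: L_def)
      qed
    qed (use finE fin in auto)
    also have "\<dots> \<le> card ({\<one>} \<times> E) + card (K \<times> {z \<in> E. dot F n (u z) (u z) = \<zero>})"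
      by (rule card_Un_le)
    also have "\<dots> = card E + q * card {z \<in> E. dot F n (u z) (u z) = \<zero>}"
      by (simp add: card_cartesian_product)
    finally have "real (card T) \<le> real (card E + q * card {z \<in> E. dot F n (u z) (u z) = \<zero>})"
      by (simp only: of_nat_le_iff)
    then show "real (card T) \<le> e + q * card {z \<in> E. dot F n (u z) (u z) = \<zero>}"
      by (simp add: e_def)
  qed simp
  finally have 2: "(\<Sum>y\<in>V n. (norm (\<Sum>p\<in>L \<times> E. \<phi> p y))\<^sup>2)
    \<le> real (q ^ (n + 1)) * (e + q * card {z \<in> E. dot F n (u z) (u z) = \<zero>})" .
  have "N = card {(y, z) \<in> E \<times> E. dot F n (vdiff x z) (vdiff y z) = \<zero>}"
    unfolding N_def D_def u_def by (simp add: case_prod_unfold mem_Times_iff conj_assoc)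
  moreover have "(real q * real N - e\<^sup>2)\<^sup>2 \<le> e * (real (q ^ (n + 1)) * (e + q * card {z \<in> E. dot F n (u z) (u z) = \<zero>}))"
    using 1 mult_left_mono[OF 2, of e] by (simp add: e_def)
  ultimately show ?thesis by (simp add: u_def e_def)
qed

text \<open>The deviation from the expected count is summed over \<open>x\<close> by Cauchy-Schwarz,
  so that the isotropic points seen from \<open>x\<close> enter only through their total, which
  \<open>isotropic_pairs_bound\<close> controls. The factor \<open>q ^ (k + 1)\<close> has two
  origins: outside the root it is the square root of \<open>q ^ (n + 1)\<close>, under the root it
  comes from the isotropic pairs.\<close>

lemma orthogonal_triples_bound:
  assumes n: "n = 2 * k + 1" and E: "E \<subseteq> V n"
  shows "q * real (\<Sum>x\<in>E. card {(y, z) \<in> E \<times> E. dot F n (vdiff x z) (vdiff y z) = \<zero>})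
    \<le> real (card E) ^ 3 + q ^ (k + 1) * card E * (2 * card E + sqrt (q ^ (k + 1) * card E))"
proof -
  have finE: "finite E" using finite_subset[OF E finite_V] .
  define e where "e = real (card E)"
  have e0: "e \<ge> 0" by (simp add: e_def)
  define N where "N = (\<lambda>x. real (card {(y, z) \<in> E \<times> E. dot F n (vdiff x z) (vdiff y z) = \<zero>}))"
  define I where "I = (\<lambda>x. real (card {z \<in> E. dot F n (vdiff x z) (vdiff x z) = \<zero>}))"
  define b where "b = real q ^ (k + 1) * e"
  have b0: "b \<ge> 0" using e0 by (simp add: b_def)
  have "(\<Sum>x\<in>E. card {z \<in> E. dot F n (vdiff x z) (vdiff x z) = \<zero>})
      = card (SIGMA x:E. {z \<in> E. dot F n (vdiff x z) (vdiff x z) = \<zero>})"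
    using finE by (simp add: card_SigmaI)
  also have "(SIGMA x:E. {z \<in> E. dot F n (vdiff x z) (vdiff x z) = \<zero>})
      = {(x, z) \<in> E \<times> E. dot F n (vdiff x z) (vdiff x z) = \<zero>}" by auto
  finally have "q * (\<Sum>x\<in>E. I x) \<le> e\<^sup>2 + b"
    using isotropic_pairs_bound[OF n E] unfolding I_def of_nat_sum[symmetric] by (simp add: b_def e_def)
  then have I: "(\<Sum>x\<in>E. e + q * I x) \<le> 2 * e\<^sup>2 + b"
    by (simp add: sum.distrib sum_distrib_left[symmetric] e_def[symmetric] power2_eq_square)
  have "(\<Sum>x\<in>E. q * N x - e\<^sup>2)\<^sup>2 \<le> e * (\<Sum>x\<in>E. (q * N x - e\<^sup>2)\<^sup>2)"
    using sum_squared_le_sum_of_squares[of "\<lambda>x. q * N x - e\<^sup>2" E] by (simp add: mult.commute e_def)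
  also have "\<dots> \<le> e * (\<Sum>x\<in>E. e * (q ^ (n + 1) * (e + q * I x)))"
    using orthogonal_pairs_at_bound[OF _ E] E e0
    by (intro mult_left_mono sum_mono) (auto simp: N_def I_def e_def)
  also have "\<dots> = (q ^ (k + 1) * e)\<^sup>2 * (\<Sum>x\<in>E. e + q * I x)"
  proof -
    have "real q ^ (n + 1) = (real q ^ (k + 1))\<^sup>2" unfolding power_mult[symmetric] by (simp add: n mult.commute)
    then have q2: "real (q ^ (n + 1)) = (real (q ^ (k + 1)))\<^sup>2" by simp
    have "e * (\<Sum>x\<in>E. e * (q ^ (n + 1) * (e + q * I x))) = e * (e * (q ^ (n + 1) * (\<Sum>x\<in>E. e + q * I x)))"
      unfolding sum_distrib_left ..
    then show ?thesis unfolding q2 power_mult_distrib power2_eq_square[of e] by (simp only: mult_ac)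
  qed
  also have "\<dots> \<le> (q ^ (k + 1) * e)\<^sup>2 * (2 * e\<^sup>2 + b)"
    by (intro mult_left_mono I) auto
  also have "\<dots> \<le> (q ^ (k + 1) * e)\<^sup>2 * (2 * e + sqrt b)\<^sup>2"
  proof (intro mult_left_mono)
    have "0 \<le> 2 * e\<^sup>2 + 4 * e * sqrt b" using e0 b0 by simp
    also have "2 * e\<^sup>2 + 4 * e * sqrt b = (2 * e + sqrt b)\<^sup>2 - (2 * e\<^sup>2 + b)"
      using b0 by (simp add: power2_sum)
    finally show "2 * e\<^sup>2 + b \<le> (2 * e + sqrt b)\<^sup>2" by simp
  qed simp
  also have "\<dots> = (q ^ (k + 1) * e * (2 * e + sqrt b))\<^sup>2" by (simp only: power_mult_distrib)
  finally have sq: "(\<Sum>x\<in>E. q * N x - e\<^sup>2)\<^sup>2 \<le> (q ^ (k + 1) * e * (2 * e + sqrt b))\<^sup>2" .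
  have "(\<Sum>x\<in>E. q * N x - e\<^sup>2) \<le> q ^ (k + 1) * e * (2 * e + sqrt b)"
    by (rule power2_le_imp_le[OF sq]) (use e0 b0 in simp)
  moreover have "(\<Sum>x\<in>E. q * N x - e\<^sup>2) = q * (\<Sum>x\<in>E. N x) - e ^ 3"
    unfolding sum_subtractf sum_distrib_left by (simp add: e_def numeral_3_eq_3 power_Suc numeral_2_eq_2)
  ultimately have "q * (\<Sum>x\<in>E. N x) \<le> e ^ 3 + q ^ (k + 1) * e * (2 * e + sqrt b)" by linarith
  then show ?thesis by (simp add: N_def e_def b_def)
qed

text \<open>Additive energy of the lift of \<open>E\<close> to the paraboloid; the last coordinate
  of the vector equation is written as a separate condition.\<close>

definition energy where
  "energy n E = card {((a, b), (c, d)) \<in> (E \<times> E) \<times> (E \<times> E).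
     (\<forall>i\<in>{1..n}. a i \<oplus> b i = c i \<oplus> d i) \<and> dot F n a a \<oplus> dot F n b b = dot F n c c \<oplus> dot F n d d}"

text \<open>Eliminating \<open>d = a + b - c\<close> turns the quadratic condition into twice
  \<open>(a - c) \<cdot> (b - c) = 0\<close>, and \<open>two\<close> can be cancelled: quadruples
  are, up to degeneration, rectangles with a right angle at \<open>c\<close>, determined by three of
  their vertices.\<close>

lemma energy_le_triples:
  assumes E: "E \<subseteq> V n"
  shows "energy n E
    \<le> (\<Sum>x\<in>E. card {(y, z) \<in> E \<times> E. dot F n (vdiff x z) (vdiff y z) = \<zero>})"
proof -
  have finE: "finite E" using finite_subset[OF E finite_V] .
  have Ev: "z \<in> {1..n} \<rightarrow> K" if "z \<in> E" for z using that E V_vec by blast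
  let ?A = "{((a, b), (c, d)) \<in> (E \<times> E) \<times> (E \<times> E). (\<forall>i\<in>{1..n}. a i \<oplus> b i = c i \<oplus> d i) \<and>
      dot F n a a \<oplus> dot F n b b = dot F n c c \<oplus> dot F n d d}"
  let ?B = "SIGMA x:E. {(y, z) \<in> E \<times> E. dot F n (vdiff x z) (vdiff y z) = \<zero>}"
  define h where "h = (\<lambda>((a::nat \<Rightarrow> 'a, b::nat \<Rightarrow> 'a), (c::nat \<Rightarrow> 'a, d::nat \<Rightarrow> 'a)). (a, (b, c)))"
  have d_eq: "d i = a i \<oplus> b i \<ominus> c i"
    if "a \<in> E" "b \<in> E" "c \<in> E" "d \<in> E" "i \<in> {1..n}" "a i \<oplus> b i = c i \<oplus> d i" for a b c d i
  proof -
    have "a i \<in> K" "b i \<in> K" "c i \<in> K" "d i \<in> K"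
      using that(1-4)[THEN Ev, THEN Pi_mem, OF that(5)] .
    moreover from this have "c i \<oplus> d i \<ominus> c i = d i" by algebra
    ultimately show ?thesis using that(6) by simp
  qed
  have "inj_on h ?A"
  proof (rule inj_onI)
    fix w w' assume "w \<in> ?A" "w' \<in> ?A" and eq: "h w = h w'"
    then obtain a b c d d' where w: "w = ((a, b), (c, d))" "w' = ((a, b), (c, d'))"
      "a \<in> E" "b \<in> E" "c \<in> E" "d \<in> E" "d' \<in> E"
      "\<forall>i\<in>{1..n}. a i \<oplus> b i = c i \<oplus> d i" "\<forall>i\<in>{1..n}. a i \<oplus> b i = c i \<oplus> d' i"
      unfolding h_def by auto
    have "d = d'"
    proof (rule V_eqI[of _ n])
      fix i assume i: "i \<in> {1..n}"
      show "d i = d' i" using d_eq[OF w(3,4,5,6) i] d_eq[OF w(3,4,5,7) i] w(8,9) i by simp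
    qed (use w E in auto)
    then show "w = w'" using w by simp
  qed
  moreover have "h ` ?A \<subseteq> ?B"
  proof
    fix v assume "v \<in> h ` ?A"
    then obtain a b c d where v: "v = (a, (b, c))" and abcd: "a \<in> E" "b \<in> E" "c \<in> E" "d \<in> E"
      and 1: "\<forall>i\<in>{1..n}. a i \<oplus> b i = c i \<oplus> d i"
      and 2: "dot F n a a \<oplus> dot F n b b = dot F n c c \<oplus> dot F n d d"
      unfolding h_def by auto
    note vec = Ev[OF abcd(1)] Ev[OF abcd(2)] Ev[OF abcd(3)] Ev[OF abcd(4)]
    have ab: "(\<lambda>i. a i \<oplus> b i) \<in> {1..n} \<rightarrow> K" using vec by auto
    have d: "dot F n y d = dot F n a y \<oplus> dot F n b y \<ominus> dot F n c y" if y: "y \<in> {1..n} \<rightarrow> K" for y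
    proof -
      have "dot F n y d = dot F n d y" by (rule dot_commute[OF y vec(4)])
      also have "\<dots> = dot F n (vdiff (\<lambda>i. a i \<oplus> b i) c) y"
        by (rule dot_cong) (use d_eq[OF abcd] 1 ab vec y in \<open>auto simp: vdiff_def\<close>)
      also have "\<dots> = dot F n a y \<oplus> dot F n b y \<ominus> dot F n c y"
        using ab vec y by (simp only: dot_vdiff_left dot_add_left)
      finally show ?thesis .
    qed
    define aa bb cc x y z where "aa = dot F n a a" and "bb = dot F n b b" and "cc = dot F n c c"
      and "x = dot F n a b" and "y = dot F n a c" and "z = dot F n b c"
    have K: "aa \<in> K" "bb \<in> K" "cc \<in> K" "x \<in> K" "y \<in> K" "z \<in> K"
      using vec by (simp_all add: aa_def bb_def cc_def x_def y_def z_def)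
    have comm: "dot F n b a = x" "dot F n c a = y" "dot F n c b = z"
      using vec dot_commute unfolding x_def y_def z_def by blast+
    define r where "r = x \<ominus> y \<ominus> z \<oplus> cc"
    have r: "r \<in> K" using K by (simp add: r_def)
    have "dot F n d d = (aa \<oplus> x \<ominus> y) \<oplus> (x \<oplus> bb \<ominus> z) \<ominus> (y \<oplus> z \<ominus> cc)"
      using d[OF vec(4)] d[OF vec(1)] d[OF vec(2)] d[OF vec(3)] comm
      by (simp add: aa_def[symmetric] bb_def[symmetric] cc_def[symmetric] x_def[symmetric] y_def[symmetric] z_def[symmetric])
    also have "\<dots> = aa \<oplus> bb \<ominus> cc \<oplus> two \<otimes> r" unfolding two_def r_def using K by algebra
    finally have "aa \<oplus> bb = cc \<oplus> (aa \<oplus> bb \<ominus> cc \<oplus> two \<otimes> r)"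
      using 2 by (simp add: aa_def bb_def cc_def)
    also have "\<dots> = (aa \<oplus> bb) \<oplus> two \<otimes> r" using K r two_closed by algebra
    finally have eq: "(aa \<oplus> bb) \<oplus> two \<otimes> r = aa \<oplus> bb" by simp
    have "two \<otimes> r = ((aa \<oplus> bb) \<oplus> two \<otimes> r) \<ominus> (aa \<oplus> bb)" using K r two_closed by algebra
    also have "\<dots> = \<zero>" unfolding eq using K by simp
    finally have "two \<otimes> r = \<zero>" .
    then have "r = \<zero>" using r two_nonzero by (simp add: integral_iff)
    moreover have "dot F n (vdiff a c) (vdiff b c) = r"
    proof -
      have "dot F n (vdiff a c) (vdiff b c) = (x \<ominus> y) \<ominus> (z \<ominus> cc)"
        using vec comm vdiff_vec[OF vec(2,3)]
        by (simp add: dot_vdiff_left dot_vdiff_right aa_def bb_def cc_def x_def[symmetric] y_def[symmetric] z_def[symmetric])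
      also have "\<dots> = r" unfolding r_def using K by algebra
      finally show ?thesis .
    qed
    ultimately show "v \<in> ?B" using v abcd by simp
  qed
  moreover have "finite ?B" using finE by (intro finite_SigmaI finite_subset[of _ "E \<times> E"]) auto
  ultimately have "card ?A \<le> card ?B" by (rule card_inj_on_le)
  also have "card ?B = (\<Sum>x\<in>E. card {(y, z) \<in> E \<times> E. dot F n (vdiff x z) (vdiff y z) = \<zero>})"
  proof (rule card_SigmaI[OF finE], rule ballI)
    show "finite {(y, z) \<in> E \<times> E. dot F n (vdiff x z) (vdiff y z) = \<zero>}" for x
      by (rule finite_subset[of _ "E \<times> E"]) (use finE in auto)
  qed
  finally show ?thesis unfolding energy_def .
qed

lemma energy_bound:
  assumes n: "n = 2 * k + 1" and E: "E \<subseteq> V n"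
  shows "q * real (energy n E)
    \<le> real (card E) ^ 3 + q ^ (k + 1) * card E * (2 * card E + sqrt (q ^ (k + 1) * card E))"
proof -
  have "q * real (energy n E) \<le> q * real (\<Sum>x\<in>E. card {(y, z) \<in> E \<times> E. dot F n (vdiff x z) (vdiff y z) = \<zero>})"
    by (intro mult_left_mono of_nat_mono energy_le_triples E) simp
  then show ?thesis using orthogonal_triples_bound[OF n E] by linarith
qed

section \<open>The dual restriction estimate\<close>

text \<open>The inner sum is the unnormalised extension operator applied to \<open>h\<close> on the
  lift of \<open>E\<close>, and its square is a sum over pairs from \<open>E\<close>. Orthogonality
  over all \<open>q ^ (n + 1)\<close> frequencies leaves the quadruples counted by
  \<open>energy\<close>.\<close>

lemma fourth_moment_bound:
  assumes E: "E \<subseteq> V n" and h: "\<And>y. y \<in> E \<Longrightarrow> norm (h y) \<le> 1"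
  shows "(\<Sum>v\<in>K \<times> V n. norm (\<Sum>y\<in>E. h y * \<chi> (fst v \<otimes> dot F n y y \<oplus> dot F n (snd v) y)) ^ 4)
    \<le> q ^ (n + 1) * energy n E"
proof -
  have finE: "finite E" using finite_subset[OF E finite_V] .
  have Ev: "z \<in> {1..n} \<rightarrow> K" if "z \<in> E" for z using that E V_vec by blast
  define Q where "Q = (\<lambda>y. dot F n y y)"
  have QK: "Q y \<in> K" if "y \<in> E" for y using Ev[OF that] by (simp add: Q_def)
  define \<phi> where "\<phi> = (\<lambda>y v. \<chi> (fst v \<otimes> Q y \<oplus> dot F n (snd v) y))"
  define \<psi> where "\<psi> = (\<lambda>p v. \<phi> (fst p) v * \<phi> (snd p) v)"
  define H where "H = (\<lambda>p. h (fst p) * h (snd p))"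
  define R where "R = (\<lambda>p p'. (\<forall>i\<in>{1..n}. fst p i \<oplus> snd p i = fst p' i \<oplus> snd p' i) \<and>
      Q (fst p) \<oplus> Q (snd p) = Q (fst p') \<oplus> Q (snd p'))"
  have \<phi>: "\<phi> y (s, w) = \<chi> (s \<otimes> Q y) * \<chi> (dot F n y w)" if "y \<in> E" "s \<in> K" "w \<in> V n" for y s w
    using that QK[of y] Ev[of y] V_vec[of w n] dot_commute[of w n y] by (simp add: \<phi>_def chi_add)
  have "(\<Sum>v\<in>K \<times> V n. norm (\<Sum>y\<in>E. h y * \<phi> y v) ^ 4) = (\<Sum>v\<in>K \<times> V n. (norm (\<Sum>p\<in>E \<times> E. H p * \<psi> p v))\<^sup>2)"
  proof (rule sum.cong[OF refl])
    fix v
    have "(\<Sum>p\<in>E \<times> E. H p * \<psi> p v) = (\<Sum>y\<in>E. h y * \<phi> y v) * (\<Sum>y\<in>E. h y * \<phi> y v)"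
      unfolding sum_product sum.cartesian_product
      by (rule sum.cong) (auto simp: H_def \<psi>_def)
    then show "norm (\<Sum>y\<in>E. h y * \<phi> y v) ^ 4 = (norm (\<Sum>p\<in>E \<times> E. H p * \<psi> p v))\<^sup>2"
      by (simp add: norm_mult power_mult_distrib flip: power_add)
  qed
  also have "\<dots> \<le> real (q ^ (n + 1)) * card {(p, p') \<in> (E \<times> E) \<times> (E \<times> E). R p p'}"
  proof (rule sum_norm_square_le_card)
    show "norm (H p) \<le> 1" if "p \<in> E \<times> E" for p
      using that h mult_mono[of "norm (h (fst p))" 1 "norm (h (snd p))" 1] by (auto simp: H_def norm_mult)
    fix p p' assume "p \<in> E \<times> E" "p' \<in> E \<times> E"
    then obtain a b c d where p: "p = (a, b)" "p' = (c, d)" and E: "a \<in> E" "b \<in> E" "c \<in> E" "d \<in> E" by auto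
    note vec = Ev[OF E(1)] Ev[OF E(2)] Ev[OF E(3)] Ev[OF E(4)]
    note QE = QK[OF E(1)] QK[OF E(2)] QK[OF E(3)] QK[OF E(4)]
    have ab: "(\<lambda>i. a i \<oplus> b i) \<in> {1..n} \<rightarrow> K" "(\<lambda>i. c i \<oplus> d i) \<in> {1..n} \<rightarrow> K" using vec by auto
    define A where "A = Q a \<oplus> Q b \<ominus> (Q c \<oplus> Q d)"
    define u where "u = vdiff (\<lambda>i. a i \<oplus> b i) (\<lambda>i. c i \<oplus> d i)"
    have A: "A \<in> K" using QE by (simp add: A_def)
    have u: "u \<in> {1..n} \<rightarrow> K" unfolding u_def using ab by (rule vdiff_vec)
    have "(\<Sum>v\<in>K \<times> V n. \<psi> p v * cnj (\<psi> p' v)) = (\<Sum>v\<in>K \<times> V n. \<chi> (fst v \<otimes> A) * \<chi> (dot F n u (snd v)))"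
    proof (rule sum.cong[OF refl])
      fix v assume "v \<in> K \<times> V n"
      then obtain s w where v: "v = (s, w)" "s \<in> K" "w \<in> V n" by auto
      have wv: "w \<in> {1..n} \<rightarrow> K" using V_vec v by auto
      have "s \<otimes> A = s \<otimes> Q a \<oplus> s \<otimes> Q b \<ominus> (s \<otimes> Q c \<oplus> s \<otimes> Q d)"
        unfolding A_def using QE v by algebra
      then have 1: "\<chi> (s \<otimes> A) = \<chi> (s \<otimes> Q a) * \<chi> (s \<otimes> Q b) * cnj (\<chi> (s \<otimes> Q c) * \<chi> (s \<otimes> Q d))"
        using QE v by (simp add: chi_add chi_minus)
      have 2: "\<chi> (dot F n u w) = \<chi> (dot F n a w) * \<chi> (dot F n b w) * cnj (\<chi> (dot F n c w) * \<chi> (dot F n d w))"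
        unfolding u_def using vec ab wv by (simp add: dot_vdiff_left dot_add_left chi_add chi_minus)
      show "\<psi> p v * cnj (\<psi> p' v) = \<chi> (fst v \<otimes> A) * \<chi> (dot F n u (snd v))"
        using v E by (simp add: \<psi>_def p \<phi> 1 2)
    qed
    also have "\<dots> = (\<Sum>s\<in>K. \<chi> (s \<otimes> A)) * (\<Sum>w\<in>V n. \<chi> (dot F n u w))"
      by (simp add: sum_product sum.cartesian_product case_prod_unfold)
    also have "\<dots> = (if A = \<zero> then of_nat q else 0) * (if \<forall>i\<in>{1..n}. u i = \<zero> then of_nat (q ^ n) else 0)"
      using sum_chi[OF A] sum_chi_dot[OF u] by simp
    also have "A = \<zero> \<longleftrightarrow> Q a \<oplus> Q b = Q c \<oplus> Q d" using QE by (simp add: A_def)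
    also have "(\<forall>i\<in>{1..n}. u i = \<zero>) \<longleftrightarrow> (\<forall>i\<in>{1..n}. a i \<oplus> b i = c i \<oplus> d i)"
    proof (rule ball_cong[OF refl])
      fix i assume i: "i \<in> {1..n}"
      show "(u i = \<zero>) = (a i \<oplus> b i = c i \<oplus> d i)"
        using ab[THEN Pi_mem, OF i] by (simp add: u_def vdiff_def)
    qed
    finally show "(\<Sum>v\<in>K \<times> V n. \<psi> p v * cnj (\<psi> p' v)) = (if R p p' then of_real (real (q ^ (n + 1))) else 0)"
      by (simp add: R_def p)
  qed (use finE in auto)
  also have "{(p, p') \<in> (E \<times> E) \<times> (E \<times> E). R p p'} = {((a, b), (c, d)) \<in> (E \<times> E) \<times> (E \<times> E).
     (\<forall>i\<in>{1..n}. a i \<oplus> b i = c i \<oplus> d i) \<and> dot F n a a \<oplus> dot F n b b = dot F n c c \<oplus> dot F n d d}"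
    by (auto simp: R_def Q_def)
  finally show ?thesis by (simp add: energy_def \<phi>_def Q_def)
qed

text \<open>The Fourier transform of \<open>g\<close> on \<open>G\<close> at the point of the
  paraboloid above \<open>x\<close>; each \<open>p\<close> is a vector split into its first
  \<open>n\<close> coordinates and its height. The sum of the squared moduli, divided by
  \<open>q ^ n\<close>, is the \<open>W\<close> of the overview.\<close>

definition dual_sum where
  "dual_sum n G g x = (\<Sum>p\<in>G. g p * \<chi> (dot F n (fst p) x \<oplus> snd p \<otimes> dot F n x x))"

text \<open>The paraboloid embeds into \<open>V n \<times> K\<close>; extending the sum of squares
  to the whole space only adds nonnegative terms and makes orthogonality exact.\<close>

lemma dual_sum_bound_Plancherel:
  assumes G: "G \<subseteq> V n \<times> K" and g: "\<And>p. p \<in> G \<Longrightarrow> norm (g p) \<le> 1"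
  shows "(\<Sum>x\<in>V n. (norm (dual_sum n G g x))\<^sup>2) \<le> q ^ (n + 1) * card G"
proof -
  have finG: "finite G" using G finite_V fin by (meson finite_SigmaI finite_subset)
  define \<psi> where "\<psi> = (\<lambda>p v. \<chi> (dot F n (fst p) (fst v)) * \<chi> (snd v \<otimes> snd p))"
  have "(\<Sum>x\<in>V n. (norm (dual_sum n G g x))\<^sup>2)
      = (\<Sum>v\<in>(\<lambda>x. (x, dot F n x x)) ` V n. (norm (\<Sum>p\<in>G. g p * \<psi> p v))\<^sup>2)"
  proof (subst sum.reindex)
    show "(\<Sum>x\<in>V n. (norm (dual_sum n G g x))\<^sup>2)
      = (\<Sum>x\<in>V n. ((\<lambda>v. (norm (\<Sum>p\<in>G. g p * \<psi> p v))\<^sup>2) \<circ> (\<lambda>x. (x, dot F n x x))) x)"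
    proof (rule sum.cong[OF refl])
      fix x assume x: "x \<in> V n"
      have "dual_sum n G g x = (\<Sum>p\<in>G. g p * \<psi> p (x, dot F n x x))"
        unfolding dual_sum_def
      proof (rule sum.cong[OF refl])
        fix p assume "p \<in> G"
        then have "fst p \<in> V n" "snd p \<in> K" using G by auto
        then show "g p * \<chi> (dot F n (fst p) x \<oplus> snd p \<otimes> dot F n x x) = g p * \<psi> p (x, dot F n x x)"
          using V_vec[OF x] V_vec[of "fst p" n] by (simp add: \<psi>_def chi_add m_comm)
      qed
      then show "(norm (dual_sum n G g x))\<^sup>2
          = ((\<lambda>v. (norm (\<Sum>p\<in>G. g p * \<psi> p v))\<^sup>2) \<circ> (\<lambda>x. (x, dot F n x x))) x" by simp
    qed
  qed (auto simp: inj_on_def)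
  also have "\<dots> \<le> (\<Sum>v\<in>V n \<times> K. (norm (\<Sum>p\<in>G. g p * \<psi> p v))\<^sup>2)"
    using finite_V fin V_vec by (intro sum_mono2) auto
  also have "\<dots> \<le> real (q ^ (n + 1)) * card {(p, p') \<in> G \<times> G. p = p'}"
  proof (rule sum_norm_square_le_card[OF finG g])
    fix p p' assume "p \<in> G" "p' \<in> G"
    then obtain m a m' a' where p: "p = (m, a)" "p' = (m', a')" "m \<in> V n" "m' \<in> V n" "a \<in> K" "a' \<in> K"
      using G by (cases p; cases p') auto
    have "(\<Sum>v\<in>V n \<times> K. \<psi> p v * cnj (\<psi> p' v))
       = (\<Sum>x\<in>V n. \<chi> (dot F n m x) * cnj (\<chi> (dot F n m' x))) * (\<Sum>w\<in>K. \<chi> (w \<otimes> a) * cnj (\<chi> (w \<otimes> a')))"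
      unfolding sum_product sum.cartesian_product by (rule sum.cong) (auto simp: \<psi>_def p)
    also have "(\<Sum>w\<in>K. \<chi> (w \<otimes> a) * cnj (\<chi> (w \<otimes> a'))) = (\<Sum>w\<in>K. \<chi> (w \<otimes> (a \<ominus> a')))"
      by (rule sum.cong) (use p in \<open>auto simp: a_minus_def r_distr r_minus chi_add chi_uminus\<close>)
    finally show "(\<Sum>v\<in>V n \<times> K. \<psi> p v * cnj (\<psi> p' v)) = (if p = p' then of_real (real (q ^ (n + 1))) else 0)"
      using p by (simp add: sum_chi_dot_diff sum_chi)
  qed auto
  also have "{(p, p') \<in> G \<times> G. p = p'} = (\<lambda>x. (x, x)) ` G" by auto
  also have "card \<dots> = card G" by (rule card_image) (auto simp: inj_on_def)
  finally show ?thesis by simp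
qed

text \<open>Up to normalisation this is the Fourier transform of the surface measure at the
  difference of two points. At equal heights it vanishes unless the points coincide, so a slice does
  not interact with itself off the diagonal; at different heights its modulus is
  \<open>sqrt q ^ n\<close>.\<close>

lemma sum_chi_paraboloid_diff:
  assumes p: "m \<in> V n" "a \<in> K" "m' \<in> V n" "b \<in> K"
  shows "(\<Sum>x\<in>V n. \<chi> (dot F n m x \<oplus> a \<otimes> dot F n x x) * cnj (\<chi> (dot F n m' x \<oplus> b \<otimes> dot F n x x)))
    = (if a = b then (if m = m' then of_nat (q ^ n) else 0)
       else gauss (a \<ominus> b) ^ n * \<chi> (dual (a \<ominus> b) \<otimes> dot F n (vdiff m m') (vdiff m m')))"
proof -
  have "(\<Sum>x\<in>V n. \<chi> (dot F n m x \<oplus> a \<otimes> dot F n x x) * cnj (\<chi> (dot F n m' x \<oplus> b \<otimes> dot F n x x)))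
    = (\<Sum>x\<in>V n. \<chi> ((a \<ominus> b) \<otimes> dot F n x x \<oplus> dot F n (vdiff m m') x))"
  proof (rule sum.cong[OF refl])
    fix x assume x: "x \<in> V n"
    note vec = V_vec[OF p(1)] V_vec[OF p(3)] V_vec[OF x]
    define A B Q where "A = dot F n m x" and "B = dot F n m' x" and "Q = dot F n x x"
    have K: "A \<in> K" "B \<in> K" "Q \<in> K" using vec by (simp_all add: A_def B_def Q_def)
    have "A \<oplus> a \<otimes> Q \<ominus> (B \<oplus> b \<otimes> Q) = (a \<ominus> b) \<otimes> Q \<oplus> (A \<ominus> B)" using K p by algebra
    then show "\<chi> (dot F n m x \<oplus> a \<otimes> dot F n x x) * cnj (\<chi> (dot F n m' x \<oplus> b \<otimes> dot F n x x))
        = \<chi> ((a \<ominus> b) \<otimes> dot F n x x \<oplus> dot F n (vdiff m m') x)"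
      using K p vec by (simp add: chi_minus[symmetric] dot_vdiff_left A_def[symmetric] B_def[symmetric] Q_def[symmetric])
  qed
  also have "\<dots> = (if a = b then (if m = m' then of_nat (q ^ n) else 0)
       else gauss (a \<ominus> b) ^ n * \<chi> (dual (a \<ominus> b) \<otimes> dot F n (vdiff m m') (vdiff m m')))"
  proof (cases "a = b")
    case True
    have "(\<Sum>x\<in>V n. \<chi> ((a \<ominus> b) \<otimes> dot F n x x \<oplus> dot F n (vdiff m m') x))
        = (\<Sum>x\<in>V n. \<chi> (dot F n m x) * cnj (\<chi> (dot F n m' x)))"
    proof (rule sum.cong[OF refl])
      fix x assume "x \<in> V n"
      note vec = V_vec[OF p(1)] V_vec[OF p(3)] V_vec[OF this]
      have "a \<ominus> b = \<zero>" using True p by simp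
      moreover have "dot F n x x \<in> K" "dot F n m x \<in> K" "dot F n m' x \<in> K" using vec by simp_all
      ultimately show "\<chi> ((a \<ominus> b) \<otimes> dot F n x x \<oplus> dot F n (vdiff m m') x)
          = \<chi> (dot F n m x) * cnj (\<chi> (dot F n m' x))"
        using vec by (simp add: dot_vdiff_left chi_minus)
    qed
    then show ?thesis using True p by (simp add: sum_chi_dot_diff)
  next
    case False
    then have "a \<ominus> b \<in> K - {\<zero>}" using p by simp
    from sum_chi_quadratic[OF this vdiff_V[OF p(1,3)]] False show ?thesis by (simp add: mult.commute)
  qed
  finally show ?thesis .
qed

lemma dual_sum_expand:
  assumes G: "G \<subseteq> V n \<times> K"
  shows "complex_of_real (\<Sum>x\<in>V n. (norm (dual_sum n G g x))\<^sup>2)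
    = (\<Sum>p\<in>G. \<Sum>p'\<in>G. g p * cnj (g p') * (if snd p = snd p' then (if p = p' then of_nat (q ^ n) else 0)
       else gauss (snd p \<ominus> snd p') ^ n *
         \<chi> (dual (snd p \<ominus> snd p') \<otimes> dot F n (vdiff (fst p) (fst p')) (vdiff (fst p) (fst p')))))"
  unfolding dual_sum_def sum_norm_square_expand
proof (rule sum.cong[OF refl], rule sum.cong[OF refl])
  fix p p' assume "p \<in> G" "p' \<in> G"
  then have "fst p \<in> V n" "snd p \<in> K" "fst p' \<in> V n" "snd p' \<in> K" using G by auto
  note * = sum_chi_paraboloid_diff[OF this]
  have "(\<Sum>x\<in>V n. g p * \<chi> (dot F n (fst p) x \<oplus> snd p \<otimes> dot F n x x) *
      cnj (g p' * \<chi> (dot F n (fst p') x \<oplus> snd p' \<otimes> dot F n x x)))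
    = g p * cnj (g p') * (\<Sum>x\<in>V n. \<chi> (dot F n (fst p) x \<oplus> snd p \<otimes> dot F n x x) *
      cnj (\<chi> (dot F n (fst p') x \<oplus> snd p' \<otimes> dot F n x x)))"
    unfolding sum_distrib_left by (rule sum.cong) auto
  also have "\<dots> = g p * cnj (g p') * (if snd p = snd p' then (if p = p' then of_nat (q ^ n) else 0)
       else gauss (snd p \<ominus> snd p') ^ n *
         \<chi> (dual (snd p \<ominus> snd p') \<otimes> dot F n (vdiff (fst p) (fst p')) (vdiff (fst p) (fst p'))))"
    unfolding * by (auto simp: prod_eq_iff)
  finally show "(\<Sum>x\<in>V n. g p * \<chi> (dot F n (fst p) x \<oplus> snd p \<otimes> dot F n x x) *
      cnj (g p' * \<chi> (dot F n (fst p') x \<oplus> snd p' \<otimes> dot F n x x))) = \<dots>" .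
qed

lemma norm_gauss_diff:
  assumes "a \<in> K" "b \<in> K" "a \<noteq> b" shows "norm (gauss (a \<ominus> b)) = sqrt q"
  using assms by (intro norm_gauss) auto

text \<open>Every off-diagonal kernel entry has modulus at most \<open>sqrt q ^ n\<close>; no
  cancellation between pairs is exploited, which is efficient only for small
  \<open>G\<close>.\<close>

lemma dual_sum_bound_decay:
  assumes G: "G \<subseteq> V n \<times> K" and g: "\<And>p. p \<in> G \<Longrightarrow> norm (g p) \<le> 1"
  shows "(\<Sum>x\<in>V n. (norm (dual_sum n G g x))\<^sup>2) \<le> q ^ n * card G + (real (card G))\<^sup>2 * sqrt q ^ n"
proof -
  have finG: "finite G" using G finite_V fin by (meson finite_SigmaI finite_subset)
  let ?M = "\<lambda>p p'. if snd p = snd p' then (if p = p' then of_nat (q ^ n) else 0)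
       else gauss (snd p \<ominus> snd p') ^ n *
         \<chi> (dual (snd p \<ominus> snd p') \<otimes> dot F n (vdiff (fst p) (fst p')) (vdiff (fst p) (fst p')))"
  have "(\<Sum>x\<in>V n. (norm (dual_sum n G g x))\<^sup>2)
      = norm (complex_of_real (\<Sum>x\<in>V n. (norm (dual_sum n G g x))\<^sup>2))"
    by (simp only: norm_of_real abs_of_nonneg sum_nonneg zero_le_power2)
  also have "\<dots> = norm (\<Sum>p\<in>G. \<Sum>p'\<in>G. g p * cnj (g p') * ?M p p')"
    by (simp only: dual_sum_expand[OF G])
  also have "\<dots> \<le> (\<Sum>p\<in>G. \<Sum>p'\<in>G. (if p = p' then real (q ^ n) else 0) + sqrt q ^ n)"
  proof (rule sum_norm_le, rule sum_norm_le)
    fix p p' assume p: "p \<in> G" "p' \<in> G"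
    then have mem: "fst p \<in> V n" "snd p \<in> K" "fst p' \<in> V n" "snd p' \<in> K" using G by auto
    have M: "norm (?M p p') \<le> (if p = p' then real (q ^ n) else 0) + sqrt q ^ n"
    proof (cases "snd p = snd p'")
      case False
      then have "snd p \<ominus> snd p' \<in> K - {\<zero>}" using mem by simp
      then have "dual (snd p \<ominus> snd p') \<in> K" using dual_closed by blast
      then show ?thesis using False mem vdiff_V[OF mem(1,3)]
        by (simp add: norm_mult norm_power norm_gauss_diff chi_norm)
    qed (auto simp: norm_power)
    have "norm (g p * cnj (g p') * ?M p p') = norm (g p) * norm (g p') * norm (?M p p')"
      by (simp only: norm_mult complex_mod_cnj)
    also have "\<dots> \<le> 1 * 1 * norm (?M p p')"
      using g p by (intro mult_mono) auto
    finally show "norm (g p * cnj (g p') * ?M p p') \<le> (if p = p' then real (q ^ n) else 0) + sqrt q ^ n"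
      using M by linarith
  qed
  also have "\<dots> = q ^ n * card G + (real (card G))\<^sup>2 * sqrt q ^ n"
    using finG by (simp add: sum.distrib power2_eq_square algebra_simps)
  finally show ?thesis .
qed

lemma sum_slices:
  fixes f :: "_ \<Rightarrow> complex"
  assumes G: "G \<subseteq> V n \<times> K"
  shows "(\<Sum>p\<in>G. f p) = (\<Sum>b\<in>K. \<Sum>y\<in>{y\<in>V n. (y, b) \<in> G}. f (y, b))"
proof -
  have "(\<Sum>b\<in>K. \<Sum>y\<in>{y\<in>V n. (y, b) \<in> G}. f (y, b)) = (\<Sum>(b, y)\<in>(SIGMA b:K. {y\<in>V n. (y, b) \<in> G}). f (y, b))"
    using fin finite_V by (intro sum.Sigma) auto
  also have "\<dots> = (\<Sum>p\<in>G. f p)"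
    by (rule sum.reindex_bij_witness[where i="\<lambda>(y, b). (b, y)" and j="\<lambda>(b, y). (y, b)"]) (use G in auto)
  finally show ?thesis by simp
qed

text \<open>For \<open>p = (m, a)\<close> and \<open>s = dual (a - b)\<close> the phase is
  \<open>s (m \<cdot> m)\<close>, irrelevant for the modulus, plus
  \<open>s (y \<cdot> y) - 2 s (m \<cdot> y)\<close>. So each summand is a value of the extension
  operator of \<open>E\<close>, at the frequency \<open>(s, - 2 s m)\<close>. Distinct
  \<open>p\<close> give distinct frequencies, and after Hoelder the full fourth moment
  applies.\<close>

lemma slice_bound:
  assumes G: "G \<subseteq> V n \<times> K" and b: "b \<in> K" and E: "E \<subseteq> V n" and h: "\<And>y. y \<in> E \<Longrightarrow> norm (h y) \<le> 1"
    and ne: "\<And>p. p \<in> G \<Longrightarrow> snd p \<noteq> b"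
  shows "(\<Sum>p\<in>G. norm (\<Sum>y\<in>E. h y * \<chi> (dual (snd p \<ominus> b) \<otimes> dot F n (vdiff (fst p) y) (vdiff (fst p) y)))) ^ 4
    \<le> real (card G) ^ 3 * (q ^ (n + 1) * energy n E)"
proof -
  have finG: "finite G" using G finite_V fin by (meson finite_SigmaI finite_subset)
  \<comment> \<open>The \<open>restrict\<close> makes the second component extensional, hence an
    element of \<open>V n\<close>.\<close>
  define \<theta> where "\<theta> = (\<lambda>p::(nat \<Rightarrow> 'a) \<times> 'a. (dual (snd p \<ominus> b),
      restrict (\<lambda>i. \<ominus> (two \<otimes> dual (snd p \<ominus> b)) \<otimes> fst p i) {1..n}))"
  define T where "T = (\<lambda>v. norm (\<Sum>y\<in>E. h y * \<chi> (fst v \<otimes> dot F n y y \<oplus> dot F n (snd v) y)))"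
  have c: "dual (snd p \<ominus> b) \<in> K - {\<zero>}" if "p \<in> G" for p
    using that ne[OF that] G b by (intro dual_closed) auto
  have \<theta>_mem: "\<theta> p \<in> K \<times> V n" if p: "p \<in> G" for p
  proof -
    have "fst p \<in> V n" using p G by auto
    from V_vec[OF this, THEN Pi_mem] show ?thesis using c[OF p] by (auto simp: \<theta>_def vec_space_def)
  qed
  have eq: "norm (\<Sum>y\<in>E. h y * \<chi> (dual (snd p \<ominus> b) \<otimes> dot F n (vdiff (fst p) y) (vdiff (fst p) y))) = T (\<theta> p)"
    if p: "p \<in> G" for p
  proof -
    define s m w where "s = dual (snd p \<ominus> b)" and "m = fst p" and "w = (\<lambda>i. \<ominus> (two \<otimes> s) \<otimes> m i)"
    have s: "s \<in> K" using c[OF p] by (simp add: s_def)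
    have "fst p \<in> V n" using p G by auto
    from V_vec[OF this] have mv: "m \<in> {1..n} \<rightarrow> K" by (simp only: m_def)
    have "(\<Sum>y\<in>E. h y * \<chi> (s \<otimes> dot F n (vdiff m y) (vdiff m y)))
        = (\<Sum>y\<in>E. \<chi> (s \<otimes> dot F n m m) * (h y * \<chi> (s \<otimes> dot F n y y \<oplus> dot F n (snd (\<theta> p)) y)))"
    proof (rule sum.cong[OF refl])
      fix y assume "y \<in> E"
      then have yv: "y \<in> {1..n} \<rightarrow> K" using E V_vec by blast
      have "dot F n (snd (\<theta> p)) y = dot F n w y"
        by (rule dot_cong) (use yv scale_vec[OF _ mv, of "\<ominus> (two \<otimes> s)"] s in \<open>auto simp: \<theta>_def w_def s_def m_def\<close>)
      also have "\<dots> = \<ominus> (two \<otimes> s) \<otimes> dot F n m y"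
        unfolding w_def using s mv yv by (intro dot_scale_left) auto
      finally have w: "dot F n (snd (\<theta> p)) y = \<ominus> (two \<otimes> s) \<otimes> dot F n m y" .
      define a d e where "a = dot F n m m" and "d = dot F n m y" and "e = dot F n y y"
      have K: "a \<in> K" "d \<in> K" "e \<in> K" using mv yv by (simp_all add: a_def d_def e_def)
      have "dot F n (vdiff m y) (vdiff m y) = (a \<ominus> d) \<ominus> (d \<ominus> e)"
        using mv yv vdiff_vec[OF mv yv] dot_commute[OF yv mv]
        by (simp add: dot_vdiff_left dot_vdiff_right a_def d_def e_def)
      moreover have "s \<otimes> ((a \<ominus> d) \<ominus> (d \<ominus> e)) = s \<otimes> a \<oplus> (s \<otimes> e \<oplus> \<ominus> (two \<otimes> s) \<otimes> d)"
        unfolding two_def using K s by algebra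
      ultimately have "\<chi> (s \<otimes> dot F n (vdiff m y) (vdiff m y)) = \<chi> (s \<otimes> a) * \<chi> (s \<otimes> e \<oplus> \<ominus> (two \<otimes> s) \<otimes> d)"
        using K s by (simp add: chi_add)
      then show "h y * \<chi> (s \<otimes> dot F n (vdiff m y) (vdiff m y))
        = \<chi> (s \<otimes> dot F n m m) * (h y * \<chi> (s \<otimes> dot F n y y \<oplus> dot F n (snd (\<theta> p)) y))"
        unfolding w a_def d_def e_def by simp
    qed
    also have "\<dots> = \<chi> (s \<otimes> dot F n m m) * (\<Sum>y\<in>E. h y * \<chi> (s \<otimes> dot F n y y \<oplus> dot F n (snd (\<theta> p)) y))"
      by (rule sum_distrib_left[symmetric])
    finally show ?thesis using s mv by (simp add: T_def norm_mult chi_norm s_def m_def \<theta>_def)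
  qed
  \<comment> \<open>The first component determines the height because \<open>dual\<close> is an
    involution on nonzero elements; the second then determines \<open>fst p\<close> because
    \<open>two\<close> times the first component is nonzero.\<close>
  have inj: "inj_on \<theta> G"
  proof (rule inj_onI)
    fix p p' assume p: "p \<in> G" "p' \<in> G" and eq: "\<theta> p = \<theta> p'"
    have mem: "fst p \<in> V n" "snd p \<in> K" "fst p' \<in> V n" "snd p' \<in> K" using p G by auto
    have "dual (snd p \<ominus> b) = dual (snd p' \<ominus> b)" using eq by (simp add: \<theta>_def)
    moreover have "snd p \<ominus> b \<in> K - {\<zero>}" "snd p' \<ominus> b \<in> K - {\<zero>}" using mem b ne[OF p(1)] ne[OF p(2)] by auto
    ultimately have "snd p \<ominus> b = snd p' \<ominus> b" using dual_dual by metis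
    moreover have "snd p = (snd p \<ominus> b) \<oplus> b" "snd p' = (snd p' \<ominus> b) \<oplus> b" using mem b by algebra+
    ultimately have s: "snd p = snd p'" by simp
    define c where "c = \<ominus> (two \<otimes> dual (snd p \<ominus> b))"
    have "two \<otimes> dual (snd p \<ominus> b) \<noteq> \<zero>" using c[OF p(1)] two_nonzero by (simp add: integral_iff)
    then have c0: "c \<in> K" "c \<noteq> \<zero>" using c[OF p(1)] minus_minus[of "two \<otimes> dual (snd p \<ominus> b)"]
      by (auto simp: c_def)
    have "fst p = fst p'"
    proof (rule V_eqI[OF mem(1,3)])
      fix i assume i: "i \<in> {1..n}"
      have "snd (\<theta> p) i = snd (\<theta> p') i" using eq by simp
      then have "c \<otimes> fst p i = c \<otimes> fst p' i" using i by (simp add: \<theta>_def c_def s)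
      then show "fst p i = fst p' i"
        using c0 m_lcancel[of c] V_vec[OF mem(1), THEN Pi_mem, OF i] V_vec[OF mem(3), THEN Pi_mem, OF i] by simp
    qed
    then show "p = p'" using s by (simp add: prod_eq_iff)
  qed
  have "(\<Sum>p\<in>G. T (\<theta> p)) ^ 4 \<le> real (card G) ^ 3 * (\<Sum>p\<in>G. T (\<theta> p) ^ 4)"
    by (rule sum_power4_le) (simp add: T_def)
  also have "(\<Sum>p\<in>G. T (\<theta> p) ^ 4) = (\<Sum>v\<in>\<theta> ` G. T v ^ 4)"
    using inj by (simp add: sum.reindex)
  also have "\<dots> \<le> (\<Sum>v\<in>K \<times> V n. T v ^ 4)"
  proof (rule sum_mono2)
    show "\<theta> ` G \<subseteq> K \<times> V n" using \<theta>_mem by blast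
  qed (use fin finite_V in \<open>auto simp: T_def\<close>)
  also have "\<dots> \<le> q ^ (n + 1) * energy n E"
    unfolding T_def by (rule fourth_moment_bound[OF E h])
  finally show ?thesis using eq by (simp add: mult_left_mono)
qed

text \<open>Only the second variable is grouped by height. The interaction of one slice with all the
  points of other heights is estimated at once, so Hoelder is used once per slice and only the
  energies of single slices occur.\<close>

lemma dual_sum_bound_energy:
  assumes G: "G \<subseteq> V n \<times> K" and g: "\<And>p. p \<in> G \<Longrightarrow> norm (g p) \<le> 1"
  shows "(\<Sum>x\<in>V n. (norm (dual_sum n G g x))\<^sup>2) \<le> q ^ n * card G +
     sqrt q ^ n * (\<Sum>b\<in>K. (real (card G) ^ 3 * (q ^ (n + 1) * energy n {y\<in>V n. (y, b) \<in> G})) powr (1 / 4))"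
proof -
  have finG: "finite G" using G finite_V fin by (meson finite_SigmaI finite_subset)
  define E where "E = (\<lambda>b. {y\<in>V n. (y, b) \<in> G})"
  define D where "D = (\<lambda>p p'::(nat \<Rightarrow> 'a) \<times> 'a. if p = p' then of_nat (q ^ n) else (0::complex))"
  define M where "M = (\<lambda>p p'. if snd p = snd p' then 0 else gauss (snd p \<ominus> snd p') ^ n *
      \<chi> (dual (snd p \<ominus> snd p') \<otimes> dot F n (vdiff (fst p) (fst p')) (vdiff (fst p) (fst p'))))"
  have "(\<Sum>x\<in>V n. (norm (dual_sum n G g x))\<^sup>2)
      = norm (complex_of_real (\<Sum>x\<in>V n. (norm (dual_sum n G g x))\<^sup>2))"
    by (simp only: norm_of_real abs_of_nonneg sum_nonneg zero_le_power2)
  also have "complex_of_real (\<Sum>x\<in>V n. (norm (dual_sum n G g x))\<^sup>2)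
      = (\<Sum>p\<in>G. \<Sum>p'\<in>G. g p * cnj (g p') * D p p') + (\<Sum>p\<in>G. \<Sum>p'\<in>G. g p * cnj (g p') * M p p')"
    unfolding dual_sum_expand[OF G] sum.distrib[symmetric]
    by (rule sum.cong[OF refl], rule sum.cong[OF refl]) (auto simp: D_def M_def)
  also have "norm \<dots> \<le> norm (\<Sum>p\<in>G. \<Sum>p'\<in>G. g p * cnj (g p') * D p p') + norm (\<Sum>p\<in>G. \<Sum>p'\<in>G. g p * cnj (g p') * M p p')"
    by (rule norm_triangle_ineq)
  finally have 0: "(\<Sum>x\<in>V n. (norm (dual_sum n G g x))\<^sup>2) \<le> norm (\<Sum>p\<in>G. \<Sum>p'\<in>G. g p * cnj (g p') * D p p')
      + norm (\<Sum>p\<in>G. \<Sum>p'\<in>G. g p * cnj (g p') * M p p')" .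
  have "norm (\<Sum>p\<in>G. \<Sum>p'\<in>G. g p * cnj (g p') * D p p') \<le> (\<Sum>p\<in>G. \<Sum>p'\<in>G. if p = p' then real (q ^ n) else 0)"
  proof (rule sum_norm_le, rule sum_norm_le)
    fix p p' assume p: "p \<in> G" "p' \<in> G"
    have "norm (g p) * norm (g p') * real (q ^ n) \<le> 1 * 1 * real (q ^ n)"
      using g p by (intro mult_mono) auto
    then show "norm (g p * cnj (g p') * D p p') \<le> (if p = p' then real (q ^ n) else 0)"
      by (auto simp: D_def norm_mult norm_power)
  qed
  also have "\<dots> = q ^ n * card G" using finG by simp
  finally have 1: "norm (\<Sum>p\<in>G. \<Sum>p'\<in>G. g p * cnj (g p') * D p p') \<le> q ^ n * card G" .
  have "(\<Sum>p\<in>G. \<Sum>p'\<in>G. g p * cnj (g p') * M p p')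
      = (\<Sum>p\<in>G. \<Sum>b\<in>K. \<Sum>y\<in>E b. g p * cnj (g (y, b)) * M p (y, b))"
    unfolding E_def by (intro sum.cong refl sum_slices[OF G])
  also have "\<dots> = (\<Sum>b\<in>K. \<Sum>p\<in>G. \<Sum>y\<in>E b. g p * cnj (g (y, b)) * M p (y, b))" by (rule sum.swap)
  finally have "norm (\<Sum>p\<in>G. \<Sum>p'\<in>G. g p * cnj (g p') * M p p')
      \<le> (\<Sum>b\<in>K. norm (\<Sum>p\<in>G. \<Sum>y\<in>E b. g p * cnj (g (y, b)) * M p (y, b)))"
    by (simp only: norm_sum)
  also have "\<dots> \<le> (\<Sum>b\<in>K. sqrt q ^ n * (real (card G) ^ 3 * (q ^ (n + 1) * energy n (E b))) powr (1 / 4))"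
  proof (rule sum_mono)
    fix b assume b: "b \<in> K"
    \<comment> \<open>Points at height \<open>b\<close> have kernel \<open>M\<close> equal to 0
      against this slice, and completing the square needs a nonzero height difference.\<close>
    define G' where "G' = {p\<in>G. snd p \<noteq> b}"
    define S where "S = (\<lambda>p. norm (\<Sum>y\<in>E b. cnj (g (y, b)) *
        \<chi> (dual (snd p \<ominus> b) \<otimes> dot F n (vdiff (fst p) y) (vdiff (fst p) y))))"
    have "norm (\<Sum>p\<in>G. \<Sum>y\<in>E b. g p * cnj (g (y, b)) * M p (y, b))
        \<le> (\<Sum>p\<in>G. if snd p \<noteq> b then sqrt q ^ n * S p else 0)"
    proof (rule sum_norm_le)
      fix p assume p: "p \<in> G"
      show "norm (\<Sum>y\<in>E b. g p * cnj (g (y, b)) * M p (y, b)) \<le> (if snd p \<noteq> b then sqrt q ^ n * S p else 0)"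
      proof (cases "snd p = b")
        case False
        have "(\<Sum>y\<in>E b. g p * cnj (g (y, b)) * M p (y, b)) = g p * gauss (snd p \<ominus> b) ^ n * (\<Sum>y\<in>E b. cnj (g (y, b)) *
            \<chi> (dual (snd p \<ominus> b) \<otimes> dot F n (vdiff (fst p) y) (vdiff (fst p) y)))"
          unfolding sum_distrib_left by (rule sum.cong) (use False in \<open>auto simp: M_def\<close>)
        then have "norm (\<Sum>y\<in>E b. g p * cnj (g (y, b)) * M p (y, b)) = norm (g p) * (sqrt q ^ n * S p)"
          using p G b False by (auto simp: norm_mult norm_power norm_gauss_diff S_def)
        also have "\<dots> \<le> 1 * (sqrt q ^ n * S p)" using g[OF p] by (intro mult_right_mono) (auto simp: S_def)
        finally show ?thesis using False by simp
      qed (simp add: M_def)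
    qed
    also have "\<dots> = (\<Sum>p\<in>G'. sqrt q ^ n * S p)"
      unfolding G'_def using finG by (simp add: sum.inter_filter)
    also have "\<dots> = sqrt q ^ n * (\<Sum>p\<in>G'. S p)" by (simp only: sum_distrib_left)
    also have "\<dots> \<le> sqrt q ^ n * (real (card G) ^ 3 * (q ^ (n + 1) * energy n (E b))) powr (1 / 4)"
    proof (rule mult_left_mono)
      have "(\<Sum>p\<in>G'. S p) ^ 4 \<le> real (card G') ^ 3 * (q ^ (n + 1) * energy n (E b))"
        unfolding S_def
        by (rule slice_bound) (use G b g in \<open>auto simp: G'_def E_def\<close>)
      also have "\<dots> \<le> real (card G) ^ 3 * (q ^ (n + 1) * energy n (E b))"
        using finG by (intro mult_right_mono power_mono) (auto simp: G'_def intro!: card_mono)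
      finally have 4: "(\<Sum>p\<in>G'. S p) ^ 4 \<le> real (card G) ^ 3 * (q ^ (n + 1) * energy n (E b))" .
      have S0: "(\<Sum>p\<in>G'. S p) \<ge> 0" by (rule sum_nonneg) (simp add: S_def)
      then have "(\<Sum>p\<in>G'. S p) = ((\<Sum>p\<in>G'. S p) ^ 4) powr (1 / 4)"
        by (simp only: power4_powr_quarter)
      also have "\<dots> \<le> (real (card G) ^ 3 * (q ^ (n + 1) * energy n (E b))) powr (1 / 4)"
        by (rule powr_mono2[OF _ _ 4]) (use S0 in auto)
      finally show "(\<Sum>p\<in>G'. S p) \<le> (real (card G) ^ 3 * (q ^ (n + 1) * energy n (E b))) powr (1 / 4)" .
    qed simp
    finally show "norm (\<Sum>p\<in>G. \<Sum>y\<in>E b. g p * cnj (g (y, b)) * M p (y, b))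
      \<le> sqrt q ^ n * (real (card G) ^ 3 * (q ^ (n + 1) * energy n (E b))) powr (1 / 4)" .
  qed
  also have "\<dots> = sqrt q ^ n * (\<Sum>b\<in>K. (real (card G) ^ 3 * (q ^ (n + 1) * energy n (E b))) powr (1 / 4))"
    by (simp only: sum_distrib_left)
  finally show ?thesis using 0 1 unfolding E_def by linarith
qed

lemma sqrt_power_quotient: "sqrt (real q) ^ n / real (q ^ n) = real q powr (- real n / 2)"
proof -
  have "sqrt (real q) ^ n = real q powr (real n / 2)"
    using q_pos by (simp add: powr_half_sqrt[symmetric] powr_powr flip: powr_realpow)
  moreover have "real (q ^ n) = real q powr (real n)" using q_pos by (simp add: powr_realpow)
  ultimately have "sqrt (real q) ^ n / real (q ^ n) = real q powr (real n / 2 - real n)"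
    by (simp only: powr_diff)
  also have "real n / 2 - real n = - real n / 2" by simp
  finally show ?thesis .
qed

text \<open>Division by \<open>q ^ n\<close> normalises the measure on the paraboloid and turns the
  decay, Plancherel and energy bounds into the assumptions \<open>A\<close>, \<open>B\<close> and
  \<open>C\<close> of \<open>exponent_comparison\<close>. The empty set is treated apart because
  that comparison needs \<open>N \<ge> 1\<close>.\<close>

lemma dual_sum_bound:
  fixes k n :: nat
  assumes n: "n = 2 * k + 1" and k: "k \<ge> 2" and G: "G \<subseteq> V n \<times> K"
    and g: "\<And>p. p \<in> G \<Longrightarrow> norm (g p) \<le> 1"
  shows "(\<Sum>x\<in>V n. (norm (dual_sum n G g x))\<^sup>2) / real (q ^ n)
    \<le> 5 * real (card G) powr ((3 * real k + 8) / (3 * real k + 5))"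
proof (cases "card G = 0")
  case True
  have "finite G" using G finite_V fin by (meson finite_SigmaI finite_subset)
  with True have "G = {}" by simp
  then show ?thesis by (simp add: dual_sum_def)
next
  case False
  define N where "N = real (card G)"
  define S where "S = (\<Sum>x\<in>V n. (norm (dual_sum n G g x))\<^sup>2)"
  define E where "E = (\<lambda>b. {y\<in>V n. (y, b) \<in> G})"
  define e where "e = (\<lambda>b. real (card (E b)))"
  have N: "N \<ge> 1" using False by (simp add: N_def)
  have q: "real q \<ge> 1" "real q > 0" using q_pos by linarith+
  have qn: "real (q ^ n) > 0" using q_pos by simp
  have rn: "real n = 2 * real k + 1" by (simp add: n)
  have sum_e: "(\<Sum>b\<in>K. e b) = N"
  proof -
    have "complex_of_real (\<Sum>b\<in>K. e b) = (\<Sum>p\<in>G. 1)"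
      unfolding sum_slices[OF G] by (simp add: e_def E_def)
    also have "\<dots> = complex_of_real N" by (simp add: N_def)
    finally show ?thesis by (simp only: of_real_eq_iff)
  qed
  show ?thesis unfolding S_def[symmetric] N_def[symmetric]
  proof (rule exponent_comparison[OF k q(1) N])
    have "S / real (q ^ n) \<le> (real (q ^ n) * N + N\<^sup>2 * sqrt (real q) ^ n) / real (q ^ n)"
      using dual_sum_bound_decay[OF G g] qn by (intro divide_right_mono) (simp_all add: S_def N_def)
    also have "\<dots> = N + N\<^sup>2 * (sqrt (real q) ^ n / real (q ^ n))"
      using qn by (simp add: add_divide_distrib)
    also have "\<dots> = N + N powr 2 * real q powr (- (2 * real k + 1) / 2)"
      unfolding sqrt_power_quotient rn using N by simp
    finally show "S / real (q ^ n) \<le> N + N powr 2 * real q powr (- (2 * real k + 1) / 2)" .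
    have "S / real (q ^ n) \<le> (real q ^ (n + 1) * N) / real (q ^ n)"
      using dual_sum_bound_Plancherel[OF G g] qn by (intro divide_right_mono) (simp_all add: S_def N_def)
    then show "S / real (q ^ n) \<le> real q * N" using q by simp
    have "S / real (q ^ n) \<le> (real (q ^ n) * N + sqrt (real q) ^ n *
        (\<Sum>b\<in>K. (N ^ 3 * (q ^ (n + 1) * energy n (E b))) powr (1/4))) / real (q ^ n)"
      using dual_sum_bound_energy[OF G g] qn by (intro divide_right_mono) (simp_all add: S_def N_def E_def)
    also have "\<dots> = N + sqrt (real q) ^ n / real (q ^ n) *
        (\<Sum>b\<in>K. (N ^ 3 * (q ^ (n + 1) * energy n (E b))) powr (1/4))"
      using qn by (simp add: add_divide_distrib)
    also have "\<dots> = N + real q powr (- (2 * real k + 1) / 2) *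
        (\<Sum>b\<in>K. (N ^ 3 * (q ^ (n + 1) * energy n (E b))) powr (1/4))"
      unfolding sqrt_power_quotient rn ..
    also have "\<dots> \<le> N + real q powr (- (2 * real k + 1) / 2) * (\<Sum>b\<in>K. (N ^ 3 * (real q ^ (2 * k + 1) *
      (e b ^ 3 + real q ^ (k + 1) * e b * (2 * e b + sqrt (real q ^ (k + 1) * e b))))) powr (1/4))"
    proof (rule add_left_mono, rule mult_left_mono, rule sum_mono, rule powr_mono2)
      fix b assume b: "b \<in> K"
      \<comment> \<open>One factor of \<open>q ^ (n + 1)\<close> is spent on
        \<open>energy_bound\<close>, which estimates \<open>q\<close> times the energy.\<close>
      have "real (q ^ (n + 1) * energy n (E b)) = real q ^ (2 * k + 1) * (real q * real (energy n (E b)))"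
        by (simp add: n)
      also have "\<dots> \<le> real q ^ (2 * k + 1) * (e b ^ 3 + real q ^ (k + 1) * e b * (2 * e b + sqrt (real q ^ (k + 1) * e b)))"
        using energy_bound[OF n, of "E b"] by (intro mult_left_mono) (auto simp: E_def e_def)
      finally show "N ^ 3 * real (q ^ (n + 1) * energy n (E b)) \<le> N ^ 3 * (real q ^ (2 * k + 1) *
        (e b ^ 3 + real q ^ (k + 1) * e b * (2 * e b + sqrt (real q ^ (k + 1) * e b))))"
        using N by (intro mult_left_mono) auto
    qed (use N in auto)
    also have "\<dots> \<le> N + (N powr (3/2) * q powr (- real k / 2) + 2 * (N powr (5/4) * q powr ((2 - real k) / 4))
        + N powr (9/8) * q powr ((6 - real k) / 8))"
      using slices_sum_le[of K e k] fin N unfolding sum_e by (intro add_left_mono) (auto simp: e_def)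
    finally show "S / real (q ^ n) \<le> N + N powr (3/2) * q powr (- real k / 2)
        + 2 * (N powr (5/4) * q powr ((2 - real k) / 4)) + N powr (9/8) * q powr ((6 - real k) / 8)"
      by (simp only: add.assoc)
  qed
qed

section \<open>The extension operator of the paraboloid\<close>

text \<open>Elements of \<open>V n\<close> are undefined outside \<open>{1..n}\<close>, so setting
  the coordinate \<open>Suc n\<close> yields an extensional vector on
  \<open>{1..Suc n}\<close>.\<close>

definition graph_point where "graph_point n x = x(Suc n := dot F n x x)"

definition ext_point where "ext_point n p = (fst p)(Suc n := snd p)"

lemma bij_ext_point: "bij_betw (ext_point n) (V n \<times> K) (vec_space F (Suc n))"
proof (rule bij_betw_byWitness[where f'="\<lambda>m. (restrict m {1..n}, m (Suc n))"])
  show "\<forall>p\<in>V n \<times> K. (\<lambda>m. (restrict m {1..n}, m (Suc n))) (ext_point n p) = p"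
    by (auto simp: ext_point_def vec_space_def PiE_def extensional_def restrict_def fun_eq_iff)
  show "\<forall>m\<in>vec_space F (Suc n). ext_point n (restrict m {1..n}, m (Suc n)) = m"
    by (auto simp: ext_point_def vec_space_def PiE_def extensional_def restrict_def fun_eq_iff)
  show "ext_point n ` (V n \<times> K) \<subseteq> vec_space F (Suc n)"
    by (auto simp: ext_point_def vec_space_def PiE_def extensional_def Pi_iff)
  show "(\<lambda>m. (restrict m {1..n}, m (Suc n))) ` vec_space F (Suc n) \<subseteq> V n \<times> K"
    by (auto simp: vec_space_def PiE_def extensional_def Pi_iff)
qed

lemma dot_Suc:
  assumes "x \<in> {1..n} \<rightarrow> K" "y \<in> {1..n} \<rightarrow> K" "a \<in> K" "b \<in> K"
  shows "dot F (Suc n) (x(Suc n := a)) (y(Suc n := b)) = dot F n x y \<oplus> a \<otimes> b"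
proof -
  have "{1..Suc n} = insert (Suc n) {1..n}" by auto
  then have "dot F (Suc n) (x(Suc n := a)) (y(Suc n := b))
      = a \<otimes> b \<oplus> (\<Oplus>i\<in>{1..n}. (x(Suc n := a)) i \<otimes> (y(Suc n := b)) i)"
    unfolding dot_def using assms by (simp add: finsum_insert Pi_iff)
  also have "(\<Oplus>i\<in>{1..n}. (x(Suc n := a)) i \<otimes> (y(Suc n := b)) i) = dot F n x y"
    unfolding dot_def using assms by (intro finsum_cong') (auto simp: Pi_iff)
  finally show ?thesis using assms by (simp add: a_comm fun_upd_def)
qed

lemma bij_graph_point: "bij_betw (graph_point n) (V n) (paraboloid F (Suc n))"
proof -
  have dot_power: "dot F n x x = (\<Oplus>i\<in>{1..n}. x i [^] (2::nat))" if "x \<in> {1..n} \<rightarrow> K" for x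
    unfolding dot_def using that by (intro finsum_cong') (auto simp: Pi_iff numeral_2_eq_2)
  have par: "paraboloid F (Suc n) = {\<xi> \<in> vec_space F (Suc n). \<xi> (Suc n) = dot F n \<xi> \<xi>}"
    using dot_power by (auto simp: paraboloid_def vec_space_def PiE_def Pi_iff)
  have restr: "dot F n (restrict m {1..n}) (restrict m {1..n}) = dot F n m m" if "m \<in> vec_space F (Suc n)" for m
    by (rule dot_cong) (use that in \<open>auto simp: vec_space_def PiE_def Pi_iff\<close>)
  have upd: "dot F n (x(Suc n := c)) (x(Suc n := c)) = dot F n x x" if "x \<in> {1..n} \<rightarrow> K" for x c
    by (rule dot_cong) (use that in auto)
  show ?thesis
  proof (rule bij_betw_byWitness[where f'="\<lambda>m. restrict m {1..n}"])
    show "\<forall>x\<in>V n. restrict (graph_point n x) {1..n} = x"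
      by (auto simp: graph_point_def vec_space_def PiE_def extensional_def restrict_def fun_eq_iff)
    show "\<forall>m\<in>paraboloid F (Suc n). graph_point n (restrict m {1..n}) = m"
    proof
      fix m assume m: "m \<in> paraboloid F (Suc n)"
      then have m': "m \<in> vec_space F (Suc n)" "m (Suc n) = dot F n m m" by (auto simp: par)
      then show "graph_point n (restrict m {1..n}) = m" unfolding graph_point_def restr[OF m'(1)]
        by (auto simp: vec_space_def PiE_def extensional_def restrict_def fun_eq_iff)
    qed
    show "graph_point n ` V n \<subseteq> paraboloid F (Suc n)"
    proof
      fix v assume "v \<in> graph_point n ` V n"
      then obtain x where x: "x \<in> V n" "v = graph_point n x" by auto
      have "ext_point n (x, dot F n x x) \<in> vec_space F (Suc n)"
        using bij_betw_apply[OF bij_ext_point, of "(x, dot F n x x)" n] x(1) V_vec[OF x(1)] by simp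
      then show "v \<in> paraboloid F (Suc n)"
        using x V_vec[OF x(1)] by (simp add: par graph_point_def ext_point_def upd)
    qed
    show "(\<lambda>m. restrict m {1..n}) ` paraboloid F (Suc n) \<subseteq> V n"
      by (auto simp: par vec_space_def PiE_def Pi_iff)
  qed
qed

lemma card_paraboloid: "card (paraboloid F (Suc n)) = q ^ n"
  using bij_betw_same_card[OF bij_graph_point] by (simp add: card_V)

lemma extension_op_ext_point:
  assumes p: "p \<in> V n \<times> K"
  shows "extension_op F \<chi> (Suc n) (paraboloid F (Suc n)) f (ext_point n p)
    = (\<Sum>x\<in>V n. f (graph_point n x) * \<chi> (dot F n (fst p) x \<oplus> snd p \<otimes> dot F n x x)) / of_nat (q ^ n)"
proof -
  have "(\<Sum>\<xi>\<in>paraboloid F (Suc n). f \<xi> * \<chi> (dot F (Suc n) (ext_point n p) \<xi>))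
      = (\<Sum>x\<in>V n. f (graph_point n x) * \<chi> (dot F (Suc n) (ext_point n p) (graph_point n x)))"
    by (rule sum.reindex_bij_betw[OF bij_graph_point, symmetric])
  also have "\<dots> = (\<Sum>x\<in>V n. f (graph_point n x) * \<chi> (dot F n (fst p) x \<oplus> snd p \<otimes> dot F n x x))"
  proof (rule sum.cong[OF refl])
    fix x assume x: "x \<in> V n"
    have "fst p \<in> V n" "snd p \<in> K" using p by auto
    then show "f (graph_point n x) * \<chi> (dot F (Suc n) (ext_point n p) (graph_point n x))
      = f (graph_point n x) * \<chi> (dot F n (fst p) x \<oplus> snd p \<otimes> dot F n x x)"
      using V_vec[OF x] V_vec[of "fst p" n] by (simp add: ext_point_def graph_point_def dot_Suc)
  qed
  finally show ?thesis by (simp add: extension_op_def card_paraboloid)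
qed

lemma Lp_norm_normalized_paraboloid:
  "Lp_norm_normalized (paraboloid F (Suc n)) 2 f
    = sqrt ((\<Sum>x\<in>V n. (norm (f (graph_point n x)))\<^sup>2) / real (q ^ n))"
proof -
  have "(\<Sum>\<xi>\<in>paraboloid F (Suc n). norm (f \<xi>) powr 2) = (\<Sum>x\<in>V n. norm (f (graph_point n x)) powr 2)"
    by (rule sum.reindex_bij_betw[OF bij_graph_point, symmetric])
  moreover have "(\<Sum>x\<in>V n. (norm (f (graph_point n x)))\<^sup>2) \<ge> 0" by (rule sum_nonneg) simp
  ultimately show ?thesis
    by (simp add: Lp_norm_normalized_def card_paraboloid powr_half_sqrt sum_nonneg)
qed

text \<open>Duality tested on sets: when \<open>g\<close> cancels the phases of the extension, the
  sum of moduli becomes a pairing of \<open>f\<close> with \<open>dual_sum n G g\<close>, and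
  Cauchy-Schwarz on the paraboloid brings in \<open>dual_sum_bound\<close>. Applied to level sets
  this is the weak-type estimate.\<close>

lemma sum_extension_op_le:
  fixes k n :: nat
  assumes n: "n = 2 * k + 1" and k: "k \<ge> 2" and G: "G \<subseteq> V n \<times> K"
  shows "(\<Sum>p\<in>G. norm (extension_op F \<chi> (Suc n) (paraboloid F (Suc n)) f (ext_point n p)))
    \<le> sqrt (5 * real (card G) powr ((3 * real k + 8) / (3 * real k + 5))) * Lp_norm_normalized (paraboloid F (Suc n)) 2 f"
proof -
  define X where "X = (\<lambda>p. extension_op F \<chi> (Suc n) (paraboloid F (Suc n)) f (ext_point n p))"
  define g where "g = (\<lambda>p. cnj (sgn (X p)))"
  have g1: "norm (g p) \<le> 1" for p by (simp add: g_def norm_sgn)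
  define a where "a = (\<Sum>x\<in>V n. (norm (f (graph_point n x)))\<^sup>2)"
  define b where "b = (\<Sum>x\<in>V n. (norm (dual_sum n G g x))\<^sup>2)"
  have ab: "a \<ge> 0" "b \<ge> 0" unfolding a_def b_def by (simp_all add: sum_nonneg)
  have qn: "real (q ^ n) > 0" using q_pos by simp
  have "complex_of_real (\<Sum>p\<in>G. norm (X p)) = (\<Sum>p\<in>G. g p * X p)"
    by (simp only: g_def cnj_sgn_mult of_real_sum)
  also have "\<dots> = (\<Sum>p\<in>G. \<Sum>x\<in>V n. f (graph_point n x) * (g p * \<chi> (dot F n (fst p) x \<oplus> snd p \<otimes> dot F n x x)) / of_nat (q ^ n))"
  proof (rule sum.cong[OF refl])
    fix p assume "p \<in> G"
    then have "p \<in> V n \<times> K" using G by auto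
    then show "g p * X p = (\<Sum>x\<in>V n. f (graph_point n x) * (g p * \<chi> (dot F n (fst p) x \<oplus> snd p \<otimes> dot F n x x)) / of_nat (q ^ n))"
      unfolding X_def extension_op_ext_point[OF \<open>p \<in> V n \<times> K\<close>]
      by (simp add: sum_distrib_left sum_divide_distrib mult_ac)
  qed
  also have "\<dots> = (\<Sum>x\<in>V n. f (graph_point n x) * dual_sum n G g x) / of_nat (q ^ n)"
    by (subst sum.swap) (simp add: dual_sum_def sum_distrib_left sum_divide_distrib)
  finally have eq: "complex_of_real (\<Sum>p\<in>G. norm (X p))
      = (\<Sum>x\<in>V n. f (graph_point n x) * dual_sum n G g x) / of_nat (q ^ n)" .
  have "(\<Sum>p\<in>G. norm (X p)) = norm (complex_of_real (\<Sum>p\<in>G. norm (X p)))"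
    by (simp only: norm_of_real abs_of_nonneg sum_nonneg norm_ge_zero)
  also have "\<dots> = norm (\<Sum>x\<in>V n. f (graph_point n x) * dual_sum n G g x) / real (q ^ n)"
    unfolding eq by (simp add: norm_divide norm_power)
  also have "\<dots> \<le> (\<Sum>x\<in>V n. norm (f (graph_point n x)) * norm (dual_sum n G g x)) / real (q ^ n)"
    using qn by (intro divide_right_mono sum_norm_le) (auto simp: norm_mult)
  also have "\<dots> \<le> (sqrt a * sqrt b) / real (q ^ n)"
  proof (rule divide_right_mono)
    have "(\<Sum>x\<in>V n. norm (f (graph_point n x)) * norm (dual_sum n G g x))\<^sup>2 \<le> a * b"
      unfolding a_def b_def by (rule Cauchy_Schwarz_ineq_sum)
    then show "(\<Sum>x\<in>V n. norm (f (graph_point n x)) * norm (dual_sum n G g x)) \<le> sqrt a * sqrt b"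
      unfolding real_sqrt_mult[symmetric] by (rule real_le_rsqrt)
  qed simp
  \<comment> \<open>The factor \<open>1 / q ^ n\<close> is shared equally, so that both norms are
    taken in the normalised measure.\<close>
  also have "\<dots> = sqrt (b / real (q ^ n)) * sqrt (a / real (q ^ n))"
  proof -
    have "sqrt (b / real (q ^ n)) * sqrt (a / real (q ^ n)) = sqrt a * sqrt b / (sqrt (real (q ^ n)) * sqrt (real (q ^ n)))"
      unfolding real_sqrt_divide by (simp add: mult.commute)
    then show ?thesis using qn by simp
  qed
  also have "\<dots> \<le> sqrt (5 * real (card G) powr ((3 * real k + 8) / (3 * real k + 5))) * sqrt (a / real (q ^ n))"
    using dual_sum_bound[OF n k G g1] ab by (intro mult_right_mono) (simp_all add: b_def)
  finally show ?thesis unfolding Lp_norm_normalized_paraboloid X_def a_def .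
qed

text \<open>The scale \<open>A\<close> is chosen so that the values \<open>X p / A\<close> meet the
  weak-type hypotheses with constant 1: singletons show that they are at most 1, and level sets
  bound the distribution function. The factor \<open>sqrt 5\<close> is inherited from
  \<open>dual_sum_bound\<close>.\<close>

lemma extension_op_bound:
  fixes k n :: nat and \<epsilon> r s :: real
  assumes n: "n = 2 * k + 1" and k: "k \<ge> 2" and \<epsilon>: "\<epsilon> > 0"
  defines "r \<equiv> 2 * (3 * real k + 5) / (3 * real k + 2)" and "s \<equiv> r + \<epsilon>"
  shows "Lp_norm_counting (vec_space F (Suc n)) (ereal s) (extension_op F \<chi> (Suc n) (paraboloid F (Suc n)) f)
    \<le> sqrt 5 * (2 powr r / (1 - 2 powr - \<epsilon>)) powr (1 / s) * Lp_norm_normalized (paraboloid F (Suc n)) 2 f"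
proof -
  define X where "X = (\<lambda>p. norm (extension_op F \<chi> (Suc n) (paraboloid F (Suc n)) f (ext_point n p)))"
  define A where "A = sqrt 5 * Lp_norm_normalized (paraboloid F (Suc n)) 2 f"
  have A0: "A \<ge> 0" by (simp only: A_def Lp_norm_normalized_paraboloid) (simp add: sum_nonneg)
  have r: "r > 0" and s: "s > 0" using \<epsilon> by (simp_all add: r_def s_def add_pos_pos)
  have fin_VK: "finite (V n \<times> K)" using finite_V fin by simp
  have X0: "X p \<ge> 0" for p by (simp add: X_def)
  have sum_X: "(\<Sum>p\<in>G. X p) \<le> A * real (card G) powr ((3 * real k + 8) / (3 * real k + 5) / 2)"
    if "G \<subseteq> V n \<times> K" for G
    using sum_extension_op_le[OF n k that, of f]
    by (simp add: X_def A_def real_sqrt_mult powr_half_sqrt[symmetric] powr_powr mult_ac)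
  have X_le: "X p \<le> A" if "p \<in> V n \<times> K" for p using sum_X[of "{p}"] that by simp
  have norm_eq: "Lp_norm_counting (vec_space F (Suc n)) (ereal s) (extension_op F \<chi> (Suc n) (paraboloid F (Suc n)) f)
     = (\<Sum>p\<in>V n \<times> K. X p powr s) powr (1 / s)"
    unfolding Lp_norm_counting_def X_def
    by (simp add: sum.reindex_bij_betw[OF bij_ext_point, symmetric])
  show ?thesis
  \<comment> \<open>Division by \<open>A\<close> is impossible if \<open>A = 0\<close>; the bound on
    singletons then makes the whole extension vanish.\<close>
  proof (cases "A = 0")
    case True
    then have "X p = 0" if "p \<in> V n \<times> K" for p using X_le[OF that] X0[of p] by simp
    then have "(\<Sum>p\<in>V n \<times> K. X p powr s) = 0" by (intro sum.neutral) simp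
    then show ?thesis unfolding norm_eq using True by (simp add: A_def)
  next
    case False
    with A0 have A: "A > 0" by simp
    have "(\<Sum>p\<in>V n \<times> K. (X p / A) powr (r + \<epsilon>)) \<le> 1 * 2 powr r / (1 - 2 powr - \<epsilon>)"
    proof (rule sum_powr_le_of_weak_type[OF fin_VK _ _ r \<epsilon>])
      show "0 \<le> X p / A \<and> X p / A \<le> 1" if "p \<in> V n \<times> K" for p
        using X_le[OF that] X0[of p] A by simp
      fix t :: real assume t: "t > 0"
      define G where "G = {p\<in>V n \<times> K. X p / A \<ge> t}"
      define N where "N = real (card G)"
      show "real (card {p\<in>V n \<times> K. X p / A \<ge> t}) \<le> 1 * t powr - r"
      proof (cases "N = 0")
        case True
        then show ?thesis by (simp add: N_def G_def)
      next
        case False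
        then have N: "N > 0" by (simp add: N_def)
        have "t * A * N = (\<Sum>p\<in>G. t * A)" by (simp add: N_def)
        also have "\<dots> \<le> (\<Sum>p\<in>G. X p)" using A by (intro sum_mono) (auto simp: G_def pos_le_divide_eq)
        also have "\<dots> \<le> A * N powr ((3 * real k + 8) / (3 * real k + 5) / 2)"
          unfolding N_def by (rule sum_X) (auto simp: G_def)
        finally have "t * N \<le> N powr ((3 * real k + 8) / (3 * real k + 5) / 2)" using A by (simp add: mult_ac)
        \<comment> \<open>This is \<open>1 / r'\<close>. Cancelling \<open>N\<close> from
          \<open>t * N \<le> N powr (1 - 1 / r)\<close> and raising to the power \<open>r\<close>
          gives the weak-type bound.\<close>
        also have "(3 * real k + 8) / (3 * real k + 5) / 2 = 1 - 1 / r" by (simp add: r_def field_simps)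
        also have "N powr (1 - 1 / r) = N / N powr (1 / r)" using N by (simp add: powr_diff)
        finally have "N powr (1 / r) \<le> 1 / t" using N t by (simp add: field_simps)
        then have "(N powr (1 / r)) powr r \<le> (1 / t) powr r" using r by (intro powr_mono2) auto
        then have "N \<le> (1 / t) powr r" using N r by (simp add: powr_powr)
        then show ?thesis using t by (simp add: N_def G_def powr_minus_divide powr_divide)
      qed
    qed simp
    then have le: "(\<Sum>p\<in>V n \<times> K. (X p / A) powr s) \<le> 2 powr r / (1 - 2 powr - \<epsilon>)" by (simp add: s_def)
    have "(\<Sum>p\<in>V n \<times> K. X p powr s) = A powr s * (\<Sum>p\<in>V n \<times> K. (X p / A) powr s)"
      unfolding sum_distrib_left by (rule sum.cong) (use A X0 in \<open>auto simp: powr_divide\<close>)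
    then have "(\<Sum>p\<in>V n \<times> K. X p powr s) powr (1 / s) = A * (\<Sum>p\<in>V n \<times> K. (X p / A) powr s) powr (1 / s)"
      using A s by (simp add: powr_mult sum_nonneg powr_powr)
    also have "\<dots> \<le> A * (2 powr r / (1 - 2 powr - \<epsilon>)) powr (1 / s)"
      using le A s by (intro mult_left_mono powr_mono2) (auto intro: sum_nonneg)
    finally show ?thesis unfolding norm_eq by (simp add: A_def mult_ac)
  qed
qed

text \<open>The extension of the constant 1 takes the value 1 at the origin. As the constant
  function has norm 1, this supplies the positive lower bound for the admissible constants in
  \<open>R_star\<close>.\<close>

lemma extension_op_one_pos:
  assumes "s > 0"
  shows "Lp_norm_counting (vec_space F (Suc n)) (ereal s) (extension_op F \<chi> (Suc n) (paraboloid F (Suc n)) (\<lambda>_. 1)) > 0"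
proof -
  define g where "g = extension_op F \<chi> (Suc n) (paraboloid F (Suc n)) (\<lambda>_. 1)"
  define z where "z = ext_point n (restrict (\<lambda>_. \<zero>) {1..n}, \<zero>)"
  have z0: "restrict (\<lambda>_. \<zero>) {1..n} \<in> V n" by (auto simp: vec_space_def)
  then have mem: "(restrict (\<lambda>_. \<zero>) {1..n}, \<zero>) \<in> V n \<times> K" by simp
  have z: "z \<in> vec_space F (Suc n)" unfolding z_def by (rule bij_betw_apply[OF bij_ext_point mem])
  have fin_vec: "finite (vec_space F (Suc n))" using finite_V .
  have "\<chi> (dot F n (restrict (\<lambda>_. \<zero>) {1..n}) x \<oplus> \<zero> \<otimes> dot F n x x) = 1" if "x \<in> V n" for x
  proof -
    have "dot F n (restrict (\<lambda>_. \<zero>) {1..n}) x = (\<Oplus>i\<in>{1..n}. \<zero>)"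
      unfolding dot_def using V_vec[OF that] by (intro finsum_cong') (auto simp: Pi_iff)
    also have "\<dots> = \<zero>" by simp
    finally show ?thesis using V_vec[OF that] by (simp add: chi_zero)
  qed
  then have "g z = 1"
    unfolding g_def z_def extension_op_ext_point[OF mem] using q_pos by (simp add: card_V)
  then have "1 \<le> (\<Sum>m\<in>vec_space F (Suc n). norm (g m) powr s)"
    using member_le_sum[OF z, of "\<lambda>m. norm (g m) powr s"] fin_vec by simp
  then show ?thesis unfolding g_def[symmetric] by (simp add: Lp_norm_counting_def)
qed

lemma R_star_le:
  fixes k n :: nat and \<epsilon> r s :: real
  assumes n: "n = 2 * k + 1" and k: "k \<ge> 2" and \<epsilon>: "\<epsilon> > 0"
  defines "r \<equiv> 2 * (3 * real k + 5) / (3 * real k + 2)" and "s \<equiv> r + \<epsilon>"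
  shows "R_star F \<chi> (Suc n) (paraboloid F (Suc n)) 2 (ereal s)
    \<le> sqrt 5 * (2 powr r / (1 - 2 powr - \<epsilon>)) powr (1 / s)"
proof -
  define C where "C = sqrt 5 * (2 powr r / (1 - 2 powr - \<epsilon>)) powr (1 / s)"
  define a where "a = (\<lambda>f. Lp_norm_counting (vec_space F (Suc n)) (ereal s) (extension_op F \<chi> (Suc n) (paraboloid F (Suc n)) f))"
  define b where "b = (\<lambda>f. Lp_norm_normalized (paraboloid F (Suc n)) 2 f)"
  have "s > 0" using \<epsilon> by (simp add: r_def s_def add_pos_pos)
  then have a1: "a (\<lambda>_. 1) > 0" unfolding a_def by (rule extension_op_one_pos)
  have b1: "b (\<lambda>_. 1) = 1"
    unfolding b_def Lp_norm_normalized_paraboloid using q_pos by (simp add: card_V)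
  have b0: "b f \<ge> 0" for f
    unfolding b_def Lp_norm_normalized_paraboloid by (simp add: sum_nonneg)
  have ab: "a f \<le> C * b f" for f
    using extension_op_bound[OF n k \<epsilon>, of f] by (simp only: a_def b_def C_def r_def s_def)
  have "(LEAST R. R > 0 \<and> (\<forall>f. a f \<le> R * b f)) \<le> C"
  proof (rule Least_real_le[where l="a (\<lambda>_. 1)"])
    show "a (\<lambda>_. 1) \<le> x" if "x > 0 \<and> (\<forall>f. a f \<le> x * b f)" for x
    proof -
      have "a (\<lambda>_. 1) \<le> x * b (\<lambda>_. 1)" using that by blast
      then show ?thesis by (simp only: b1 mult_1_right)
    qed
    have "C \<ge> a (\<lambda>_. 1)" using ab[of "\<lambda>_. 1"] b1 by simp
    then show "C > 0 \<and> (\<forall>f. a f \<le> C * b f)" using a1 ab less_le_trans by blast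
    show "y > 0 \<and> (\<forall>f. a f \<le> y * b f)" if "x > 0 \<and> (\<forall>f. a f \<le> x * b f)" "x \<le> y" for x y
    proof (intro conjI allI)
      show "y > 0" using that by linarith
      fix f
      have "a f \<le> x * b f" using that(1) by blast
      also have "\<dots> \<le> y * b f" by (rule mult_right_mono[OF that(2) b0])
      finally show "a f \<le> y * b f" .
    qed
    show "y > 0 \<and> (\<forall>f. a f \<le> y * b f)" if y: "y > 0" and x: "\<And>x. x > y \<Longrightarrow> x > 0 \<and> (\<forall>f. a f \<le> x * b f)" for y
    proof (intro conjI allI y)
      fix f
      show "a f \<le> y * b f"
      \<comment> \<open>The limit of the constants down to \<open>y\<close> is taken after division
        by \<open>b f\<close>; if \<open>b f = 0\<close>, a single admissible constant such as
        \<open>y + 1\<close> already gives the inequality.\<close>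
      proof (cases "b f = 0")
        case True
        have "a f \<le> (y + 1) * b f" using x[of "y + 1"] by simp
        then show ?thesis by (simp add: True)
      next
        case False
        then have bf: "b f > 0" using b0[of f] by simp
        have "a f / b f \<le> y"
        proof (rule field_le_epsilon)
          fix e :: real assume "e > 0"
          then have "a f \<le> (y + e) * b f" using x[of "y + e"] by simp
          then show "a f / b f \<le> y + e" using bf by (simp add: pos_divide_le_eq)
        qed
        then show ?thesis using bf by (simp add: pos_divide_le_eq)
      qed
    qed
  qed (rule a1)
  then show ?thesis unfolding R_star_def C_def a_def b_def .
qed

end

theorem theorem1p3:
  fixes d :: nat and \<epsilon> :: real
  assumes "d \<ge> 6" and "even d" and "\<epsilon> > 0"
  shows "\<exists>C>0. \<forall>(F :: 'a ring) (\<chi> :: 'a \<Rightarrow> complex).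
    odd_finite_field F \<longrightarrow> nontrivial_additive_character F \<chi> \<longrightarrow>
      R_star F \<chi> d (paraboloid F d) 2
        (ereal ((6 * real d + 8) / (3 * real d - 2) + \<epsilon>)) \<le> C"
proof -
  \<comment> \<open>Here \<open>d = 2 * k + 2\<close>, so \<open>d \<ge> 6\<close> becomes
    \<open>k \<ge> 2\<close>, and \<open>n = d - 1\<close> is odd because \<open>d\<close> is
    even.\<close>
  define k where "k = d div 2 - 1"
  define n where "n = 2 * k + 1"
  have d: "d = Suc n" and k: "k \<ge> 2" using assms by (auto simp: k_def n_def elim!: evenE)
  define r where "r = 2 * (3 * real k + 5) / (3 * real k + 2)"
  \<comment> \<open>The constant depends on \<open>d\<close> and \<open>\<epsilon>\<close> alone,
    through \<open>k\<close> and \<open>r\<close>, and is fixed before the field and the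
    character.\<close>
  define C where "C = sqrt 5 * (2 powr r / (1 - 2 powr - \<epsilon>)) powr (1 / (r + \<epsilon>))"
  have exponent: "(6 * real d + 8) / (3 * real d - 2) = r"
    by (simp add: d n_def r_def field_simps)
  have "(2::real) powr - \<epsilon> < 1" using assms(3) powr_less_mono[of "- \<epsilon>" 0 "2::real"] by simp
  then have "2 powr r / (1 - 2 powr - \<epsilon>) > 0" by simp
  then have "(2 powr r / (1 - 2 powr - \<epsilon>)) powr (1 / (r + \<epsilon>)) > 0" by (subst powr_gt_zero) linarith
  then have "C > 0" unfolding C_def by (intro mult_pos_pos) simp_all
  moreover have "R_star F \<chi> d (paraboloid F d) 2 (ereal ((6 * real d + 8) / (3 * real d - 2) + \<epsilon>)) \<le> C"
    if F: "odd_finite_field F" and \<chi>: "nontrivial_additive_character F \<chi>" for F :: "'a ring" and \<chi>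
  proof -
    interpret field F using F by (simp add: odd_finite_field_def)
    interpret odd_character F \<chi>
      by unfold_locales (use F \<chi> in \<open>auto simp: odd_finite_field_def\<close>)
    show ?thesis
      unfolding exponent unfolding d C_def r_def by (rule R_star_le[OF n_def k assms(3)])
  qed
  ultimately show ?thesis by blast
qed

end
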